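(* Suppose that the central curve $\boldsymbol m(y)=\mathbb E[\boldsymbol X\mid Y=y]$ is weak $(K,\tau)$-sliced stable with respect to $Y$ for constants $K$ and $\tau$ (WSSC), and that there is a constant $c_1>0$ with $\mathbb E[\xi_i^4]/\lambda_i^2\le c_1$ for all $i\ge 1$. Then there are constants $C>0$ and $H_0\ge K$ such that, for all $H>H_0$ and all sufficiently large $n>1+4H/\gamma$, $$\mathbb P\left(\left|\left\langle(\widetilde\Gamma_e-\Gamma_e)(\boldsymbol u),\boldsymbol u\right\rangle\right|\le\tfrac3\tau\langle\Gamma_e(\boldsymbol u),\boldsymbol u\rangle,\ \forall \boldsymbol u\in\mathbb S_{\mathcal H}\right)\ge 1-CH^2\sqrt{n+1}\exp\left(\frac{-\gamma^2(n+1)}{32H^2}\right)$$ (this is the property defining $H_0$), and such that, for any fixed integer $H>H_0$ and any sufficiently large $n>1+4H/\gamma$, $$\|\widehat\Gamma_e-\Gamma_e\|=O_p\left(\frac1\tau+\sqrt{\frac1n}\right)\quad\text{and}\quad \|\widehat\Gamma_e-\widetilde\Gamma_e\|=O_p\left(\sqrt{\frac1n}\right).$$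
   Context: Setting. $\mathcal H=L^2[0,1]$ with its usual inner product and norm; $\mathbb S_{\mathcal H}=\{\boldsymbol u\in\mathcal H:\|\boldsymbol u\|=1\}$; for operators $\|\cdot\|$ is the operator norm; $x\otimes y(z)=\langle x,z\rangle y$. The pair $(\boldsymbol X,Y)\in\mathcal H\times\mathbb R$ follows the multiple-index model $Y=f(\langle\boldsymbol\beta_1,\boldsymbol X\rangle,\dots,\langle\boldsymbol\beta_d,\boldsymbol X\rangle,\varepsilon)$ with $f:\mathbb R^{d+1}\to\mathbb R$ an unknown link, $\boldsymbol\beta_i\in\mathcal H$, $\varepsilon$ a random noise independent of $\boldsymbol X$, and $d$ known and fixed. Assume $\mathbb E[\boldsymbol X]=0$ and $\mathbb E\|\boldsymbol X\|^4<\infty$. $\Gamma=\mathrm{var}(\boldsymbol X)$ is the covariance operator, assumed non-singular, with decreasing eigenvalues $\lambda_1\ge\lambda_2\ge\dots>0$ and orthonormal eigenfunctions $\{\phi_i\}$; $\xi_i=\langle\boldsymbol X,\phi_i\rangle$, so $\boldsymbol X=\sum_i\xi_i\phi_i$. $\Gamma_e=\mathrm{var}(\mathbb E[\boldsymbol X\mid Y])$. Slicing. Given i.i.d. samples $(\boldsymbol X_i,Y_i)_{i=1}^n$ with $n=Hc$ ($c$ a positive integer, $H\ge d$), let $Y_{(1)}\le\dots\le Y_{(n)}$ be the order statistics, $\boldsymbol X_{(k)}$ the concomitant of $Y_{(k)}$, $Y_{h,j}=Y_{(c(h-1)+j)}$, $\boldsymbol X_{h,j}=\boldsymbol X_{(c(h-1)+j)}$.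 The slices are $\mathcal S_1=(-\infty,Y_{1,c}]$, $\mathcal S_h=(Y_{h-1,c},Y_{h,c}]$ for $2\le h\le H-1$, $\mathcal S_H=(Y_{H-1,c},\infty)$; $\mathfrak S_H(n)=\{\mathcal S_h\}_{h=1}^H$ is the sliced partition. With $\overline{\boldsymbol X}_{h,\cdot}=\frac1c\sum_{j=1}^c\boldsymbol X_{h,j}$, set $\widehat\Gamma_e=\frac1H\sum_{h=1}^H\overline{\boldsymbol X}_{h,\cdot}\otimes\overline{\boldsymbol X}_{h,\cdot}$. With $\overline{\boldsymbol m}_h=\mathbb E[\boldsymbol X\mid Y\in\mathcal S_h]$ (the conditional mean under the law of $(\boldsymbol X,Y)$, the interval $\mathcal S_h$ being regarded as fixed), set $\widetilde\Gamma_e=\frac1H\sum_{h=1}^H\overline{\boldsymbol m}_h\otimes\overline{\boldsymbol m}_h$. WSSC. Throughout, $\gamma$ is a fixed small positive constant. A partition $-\infty=a_0<a_1<\dots<a_H=\infty$ of $\mathbb R$ is a $\gamma$-partition if $\frac{1-\gamma}{H}\le\mathbb P(a_h\le Y\le a_{h+1})\le\frac{1+\gamma}{H}$ for $h=0,\dots,H-1$. For a positive integer $K$ and $\tau>1$, a continuous curve $\boldsymbol\kappa:\mathbb R\to\mathcal H$ is weak $(K,\tau)$-sliced stable w.r.t. $Y$ if for every $H\ge K$, every $\gamma$-partition and every $\boldsymbol u\in\mathbb S_{\mathcal H}$: $\frac1H\sum_{h=0}^{H-1}\mathrm{var}(\langle\boldsymbol u,\boldsymbol\kappa(Y)\rangle\mid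 a_h\le Y\le a_{h+1})\le\frac1\tau\mathrm{var}(\langle\boldsymbol u,\boldsymbol\kappa(Y)\rangle)$. $Z_n=O_p(a_n)$ means: for every $\epsilon>0$ there is $C_\epsilon>0$ with $\sup_n\mathbb P(|Z_n|\ge C_\epsilon a_n)\le\epsilon$.
   Formalization: The law of Y is additionally assumed to have no atoms; with an atom, large H gives empty slices (undefined conditional means), no γ-partition exists so WSSC is vacuous, and the 3/τ bound fails (e.g. Y two-valued). *)

theory Defs
  imports "HOL-Probability.Probability"
begin

section \<open>Operators on a real inner product space\<close>

definition tensor :: "'h::real_inner \<Rightarrow> 'h \<Rightarrow> 'h \<Rightarrow> 'h" where
  "tensor x y = (\<lambda>z. inner x z *\<^sub>R y)"

text \<open>The expectation of the random operator \<^term>\<open>tensor (Z - E Z) (Z - E Z)\<close> is taken pointwise,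
  because the Bochner integral is only available in second countable spaces, which the space of
  bounded operators with the operator norm is not.\<close>

definition cov_operator ::
    "'a measure \<Rightarrow> ('a \<Rightarrow> 'h::{real_inner,banach,second_countable_topology}) \<Rightarrow> 'h \<Rightarrow> 'h" where
  "cov_operator M Z u =
     (\<integral>\<omega>. tensor (Z \<omega> - (\<integral>\<omega>'. Z \<omega>' \<partial>M)) (Z \<omega> - (\<integral>\<omega>'. Z \<omega>' \<partial>M)) u \<partial>M)"

definition orthonormal_basis :: "(nat \<Rightarrow> 'h::real_inner) \<Rightarrow> bool" where
  "orthonormal_basis \<phi> \<longleftrightarrow>
     (\<forall>i j. inner (\<phi> i) (\<phi> j) = (if i = j then 1 else 0)) \<and> closure (span (range \<phi>)) = UNIV"


section \<open>Conditioning\<close>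

text \<open>Moments given an event \<open>A\<close> of positive probability are moments under the conditional law
  \<^term>\<open>uniform_measure M A\<close>, i.e. the measure sending \<open>B\<close> to \<open>P(A \<inter> B) / P(A)\<close>.\<close>

definition cond_mean ::
    "'a measure \<Rightarrow> ('a \<Rightarrow> 'h::{real_inner,banach,second_countable_topology}) \<Rightarrow> 'a set \<Rightarrow> 'h" where
  "cond_mean M Z A = (\<integral>\<omega>. Z \<omega> \<partial>uniform_measure M A)"

definition cond_var :: "'a measure \<Rightarrow> ('a \<Rightarrow> real) \<Rightarrow> 'a set \<Rightarrow> real" where
  "cond_var M Z A = prob_space.variance (uniform_measure M A) Z"

text \<open>\<open>m\<close> is a version of \<open>y \<mapsto> E[X | Y = y]\<close>, so that \<open>m(Y) = E[X | Y]\<close> almost surely.\<close>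

definition central_curve ::
    "'a measure \<Rightarrow> ('a \<Rightarrow> 'h::{real_inner,banach,second_countable_topology}) \<Rightarrow> ('a \<Rightarrow> real)
      \<Rightarrow> (real \<Rightarrow> 'h) \<Rightarrow> bool" where
  "central_curve M X Y m \<longleftrightarrow>
     m \<in> borel_measurable borel \<and> integrable M (\<lambda>\<omega>. m (Y \<omega>)) \<and>
     (\<forall>B\<in>sets borel. (LINT \<omega>:(Y -` B \<inter> space M)|M. m (Y \<omega>)) = (LINT \<omega>:(Y -` B \<inter> space M)|M. X \<omega>))"


section \<open>Weak sliced stability\<close>

definition gamma_partition ::
    "'a measure \<Rightarrow> ('a \<Rightarrow> real) \<Rightarrow> real \<Rightarrow> nat \<Rightarrow> (nat \<Rightarrow> ereal) \<Rightarrow> bool" where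
  "gamma_partition M Y \<gamma> H a \<longleftrightarrow>
     a 0 = -\<infinity> \<and> a H = \<infinity> \<and> strict_mono_on {0..H} a \<and>
     (\<forall>h<H. (1 - \<gamma>) / real H \<le> measure M {\<omega>\<in>space M. a h \<le> ereal (Y \<omega>) \<and> ereal (Y \<omega>) \<le> a (h + 1)} \<and>
            measure M {\<omega>\<in>space M. a h \<le> ereal (Y \<omega>) \<and> ereal (Y \<omega>) \<le> a (h + 1)} \<le> (1 + \<gamma>) / real H)"

definition weak_sliced_stable ::
    "'a measure \<Rightarrow> real \<Rightarrow> nat \<Rightarrow> real \<Rightarrow> (real \<Rightarrow> 'h::real_inner) \<Rightarrow> ('a \<Rightarrow> real) \<Rightarrow> bool" where
  "weak_sliced_stable M \<gamma> K \<tau> \<kappa> Y \<longleftrightarrow>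
     1 \<le> K \<and> 1 < \<tau> \<and> continuous_on UNIV \<kappa> \<and>
     (\<forall>H\<ge>K. \<forall>a. gamma_partition M Y \<gamma> H a \<longrightarrow>
        (\<forall>u. norm u = 1 \<longrightarrow>
           1 / real H * (\<Sum>h<H. cond_var M (\<lambda>\<omega>. inner u (\<kappa> (Y \<omega>)))
                             {\<omega>\<in>space M. a h \<le> ereal (Y \<omega>) \<and> ereal (Y \<omega>) \<le> a (h + 1)})
           \<le> 1 / \<tau> * prob_space.variance M (\<lambda>\<omega>. inner u (\<kappa> (Y \<omega>)))))"


section \<open>Slicing a sample\<close>

text \<open>Samples are indexed from \<open>0\<close>: a sample of size \<open>n\<close> is \<open>(x 0, y 0), \<dots>, (x (n - 1), y (n - 1))\<close>.
  Ranks \<open>k\<close>, slice numbers \<open>h\<close> and positions \<open>j\<close> within a slice count from \<open>1\<close>. \<open>order_index y n k\<close>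
  is the sample index of the \<open>k\<close>-th smallest response (ties, if any, are broken by sample index).\<close>

definition order_index :: "(nat \<Rightarrow> real) \<Rightarrow> nat \<Rightarrow> nat \<Rightarrow> nat" where
  "order_index y n k = sort_key y [0..<n] ! (k - 1)"

definition slice_response :: "(nat \<Rightarrow> real) \<Rightarrow> nat \<Rightarrow> nat \<Rightarrow> nat \<Rightarrow> nat \<Rightarrow> real" where
  "slice_response y H c h j = y (order_index y (H * c) (c * (h - 1) + j))"

definition slice_concomitant :: "(nat \<Rightarrow> 'h) \<Rightarrow> (nat \<Rightarrow> real) \<Rightarrow> nat \<Rightarrow> nat \<Rightarrow> nat \<Rightarrow> nat \<Rightarrow> 'h" where
  "slice_concomitant x y H c h j = x (order_index y (H * c) (c * (h - 1) + j))"

definition slice :: "(nat \<Rightarrow> real) \<Rightarrow> nat \<Rightarrow> nat \<Rightarrow> nat \<Rightarrow> real set" where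
  "slice y H c h =
     (if h = 1 then {..slice_response y H c 1 c}
      else if h = H then {slice_response y H c (H - 1) c<..}
      else {slice_response y H c (h - 1) c<..slice_response y H c h c})"

definition slice_sample_mean ::
    "(nat \<Rightarrow> 'h::real_vector) \<Rightarrow> (nat \<Rightarrow> real) \<Rightarrow> nat \<Rightarrow> nat \<Rightarrow> nat \<Rightarrow> 'h" where
  "slice_sample_mean x y H c h = (1 / real c) *\<^sub>R (\<Sum>j=1..c. slice_concomitant x y H c h j)"

definition Gamma_hat :: "(nat \<Rightarrow> 'h::real_inner) \<Rightarrow> (nat \<Rightarrow> real) \<Rightarrow> nat \<Rightarrow> nat \<Rightarrow> 'h \<Rightarrow> 'h" where
  "Gamma_hat x y H c u =
     (1 / real H) *\<^sub>R (\<Sum>h=1..H. tensor (slice_sample_mean x y H c h) (slice_sample_mean x y H c h) u)"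

text \<open>The slices are computed from the sample responses \<open>y\<close>, the conditional means from the
  population pair \<open>(X, Y)\<close> with the slices held fixed.\<close>

definition slice_population_mean ::
    "'a measure \<Rightarrow> ('a \<Rightarrow> 'h::{real_inner,banach,second_countable_topology}) \<Rightarrow> ('a \<Rightarrow> real)
      \<Rightarrow> (nat \<Rightarrow> real) \<Rightarrow> nat \<Rightarrow> nat \<Rightarrow> nat \<Rightarrow> 'h" where
  "slice_population_mean M X Y y H c h = cond_mean M X {\<omega>\<in>space M. Y \<omega> \<in> slice y H c h}"

definition Gamma_tilde ::
    "'a measure \<Rightarrow> ('a \<Rightarrow> 'h::{real_inner,banach,second_countable_topology}) \<Rightarrow> ('a \<Rightarrow> real)
      \<Rightarrow> (nat \<Rightarrow> real) \<Rightarrow> nat \<Rightarrow> nat \<Rightarrow> 'h \<Rightarrow> 'h" where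
  "Gamma_tilde M X Y y H c u =
     (1 / real H) *\<^sub>R (\<Sum>h=1..H. tensor (slice_population_mean M X Y y H c h)
                                      (slice_population_mean M X Y y H c h) u)"


section \<open>Boundedness in probability\<close>

definition bigO_prob ::
    "'a measure \<Rightarrow> 'i set \<Rightarrow> ('i \<Rightarrow> 'a \<Rightarrow> real) \<Rightarrow> ('i \<Rightarrow> real) \<Rightarrow> bool" where
  "bigO_prob M I Z a \<longleftrightarrow>
     (\<forall>\<epsilon>>0. \<exists>C>0. \<forall>i\<in>I. measure M {\<omega>\<in>space M. \<bar>Z i \<omega>\<bar> \<ge> C * a i} \<le> \<epsilon>)"

end

theory Submission
  imports Defs
begin

text \<open>
  Two facts about the random slices carry the theorem.

  \<^emph>\<open>The slices are almost equiprobable.\<close> The cuts between the slices are order statistics of the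
  responses. The distribution function \<open>F\<close> of \<open>Y\<close> maps responses to uniform variables, so a slice whose
  probability is off by a factor \<open>1 \<plusminus> \<delta>\<close> forces an atypical number of observations into one of \<open>O(H / \<delta>)\<close>
  intervals that are fixed in advance. Chernoff bounds for binomial counts give a probability of order
  \<open>H exp (- \<delta>\<^sup>2 n / (16 H))\<close> for this (\<open>prob_not_balanced\<close>). If all slices are balanced, a decomposition
  of the variance of \<open>\<langle>u, m(Y)\<rangle>\<close> into parts within and between slices, together with sliced stability,
  bounds the quadratic form of the difference of the population sliced covariance and \<open>\<Gamma>\<^sub>e\<close> by \<open>3 / \<tau>\<close> times
  that of \<open>\<Gamma>\<^sub>e\<close> (\<open>Gamma_tilde_near_cov_m\<close>). Being a \<open>\<gamma>\<close>-partition does not suffice here, as \<open>\<gamma>\<close> may be large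
  compared with \<open>1 / \<tau>\<close>; the tolerance has to be \<open>\<delta> = min \<gamma> (1 / (2 \<tau>))\<close>. The exponent \<open>n / H\<close>, in place of the
  \<open>n / H\<^sup>2\<close> of the theorem, pays for this as soon as \<open>H \<ge> \<gamma>\<^sup>2 / \<delta>\<^sup>2\<close>, which is how \<open>H\<^sub>0\<close> is chosen.

  \<^emph>\<open>Centred observations in a random slice are orthogonal.\<close> Given that an observation lies strictly between
  two order statistics, these are determined by the other observations, and the observation is
  distributed according to the law of \<open>(X, Y)\<close> given that \<open>Y\<close> falls between them. Hence the sum over a slice of \<open>X\<^sub>i\<close>
  minus the conditional mean of the slice has second moment at most \<open>n E \<parallel>X\<parallel>\<^sup>2\<close>
  (\<open>second_moment_slice_sum\<close>), and the sample mean of a slice differs from its population mean by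
  \<open>O\<^sub>p(1 / sqrt n)\<close> for fixed \<open>H\<close>. As the slice probabilities stay away from \<open>0\<close>, the means themselves are
  bounded in probability, and the rate carries over to the covariances. For fixed \<open>H\<close> and \<open>\<tau>\<close> the rate
  claimed for the distance to \<open>\<Gamma>\<^sub>e\<close> is bounded below by a positive constant, so there boundedness in probability
  of the sample covariance is enough.
\<close>

section \<open>Measure-theoretic preliminaries\<close>

text \<open>A set outside the \<open>\<sigma>\<close>-algebra has measure \<open>0\<close>, so a measurable superset is enough. This
  gives bounds for events about operator norms and about balance of all slices.\<close>

lemma (in finite_measure) measure_mono_outer:
  assumes "A \<subseteq> B" "B \<in> sets M"
  shows "measure M A \<le> measure M B"
  using assms by (cases "A \<in> sets M") (auto simp: finite_measure_mono measure_notin_sets)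

lemma uniform_measure_cong_AE:
  assumes [measurable]: "A \<in> sets M" "B \<in> sets M"
    and AE: "AE \<omega> in M. \<omega> \<in> A \<longleftrightarrow> \<omega> \<in> B"
  shows "uniform_measure M A = uniform_measure M B"
proof -
  have "emeasure M A = emeasure M B"
    by (rule emeasure_eq_AE) (use AE in auto)
  moreover have "AE \<omega> in M. (indicator A \<omega> :: ennreal) = indicator B \<omega>"
    using AE by eventually_elim (simp add: indicator_def)
  ultimately show ?thesis
    unfolding uniform_measure_def by (intro density_cong) auto
qed

text \<open>For a null event both sides are \<open>0\<close>: the density of the conditional law vanishes almost everywhere,
  and \<open>1 / 0 = 0\<close>.\<close>

lemma (in finite_measure) integral_uniform_measure:
  fixes Z :: "'a \<Rightarrow> 'b::{banach, second_countable_topology}"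
  assumes [measurable]: "A \<in> sets M" "Z \<in> borel_measurable M"
  shows "(\<integral>\<omega>. Z \<omega> \<partial>uniform_measure M A) =
    (1 / measure M A) *\<^sub>R (\<integral>\<omega>. indicator A \<omega> *\<^sub>R Z \<omega> \<partial>M)"
proof (cases "measure M A = 0")
  case True
  then have "A \<in> null_sets M"
    by (simp add: null_setsI emeasure_eq_measure)
  then have "AE \<omega> in M. (indicator A \<omega> / emeasure M A :: ennreal) = 0"
    by (rule AE_mp[OF AE_not_in]) auto
  then have "uniform_measure M A = density M (\<lambda>_. 0)"
    unfolding uniform_measure_def by (intro density_cong) auto
  also have "\<dots> = null_measure M"
    by (rule measure_eqI) (auto simp: emeasure_density)
  finally show ?thesis
    using True by simp
next
  case False
  have "uniform_measure M A = density M (\<lambda>\<omega>. ennreal (indicator A \<omega> / measure M A))"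
    unfolding uniform_measure_def using False
    by (intro density_cong)
       (auto simp: emeasure_eq_measure divide_ennreal zero_less_measure_iff indicator_def ennreal_1[symmetric]
             simp del: ennreal_1 split: if_splits)
  then have "(\<integral>\<omega>. Z \<omega> \<partial>uniform_measure M A) = (\<integral>\<omega>. (indicator A \<omega> / measure M A) *\<^sub>R Z \<omega> \<partial>M)"
    by (simp add: integral_density)
  also have "\<dots> = (\<integral>\<omega>. (1 / measure M A) *\<^sub>R (indicator A \<omega> *\<^sub>R Z \<omega>) \<partial>M)"
    by simp
  finally show ?thesis
    by (simp only: integral_scaleR_right)
qed

text \<open>The conditional form of \<open>E[(g - \<mu>)\<^sup>2] = E[g\<^sup>2] - \<mu>\<^sup>2\<close>, multiplied by the probability of the event so
  that it can be summed over a partition.\<close>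

lemma (in prob_space) cond_var_eq:
  fixes g :: "'a \<Rightarrow> real"
  assumes A [measurable]: "A \<in> sets M" and pos: "prob A > 0"
    and g: "integrable M g" and g2: "integrable M (\<lambda>\<omega>. (g \<omega>)\<^sup>2)"
  shows "prob A * cond_var M g A =
    (\<integral>\<omega>. indicator A \<omega> * (g \<omega>)\<^sup>2 \<partial>M) - prob A * (cond_mean M g A)\<^sup>2"
proof -
  have [measurable]: "g \<in> borel_measurable M"
    using g by simp
  define \<mu> where "\<mu> = cond_mean M g A"
  have i1: "integrable M (\<lambda>\<omega>. indicator A \<omega> * g \<omega>)"
    using integrable_mult_indicator[OF A g] by simp
  have i2: "integrable M (\<lambda>\<omega>. indicator A \<omega> * (g \<omega>)\<^sup>2)"
    using integrable_mult_indicator[OF A g2] by simp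
  have \<mu>: "prob A * \<mu> = (\<integral>\<omega>. indicator A \<omega> * g \<omega> \<partial>M)"
    unfolding \<mu>_def cond_mean_def using pos by (subst integral_uniform_measure) auto
  have "prob A * cond_var M g A = (\<integral>\<omega>. indicator A \<omega> * (g \<omega> - \<mu>)\<^sup>2 \<partial>M)"
    unfolding cond_var_def \<mu>_def cond_mean_def using pos
    by (subst integral_uniform_measure) auto
  also have "\<dots> = (\<integral>\<omega>. indicator A \<omega> * (g \<omega>)\<^sup>2 - (2 * \<mu>) * (indicator A \<omega> * g \<omega>) + \<mu>\<^sup>2 * indicator A \<omega> \<partial>M)"
    by (rule Bochner_Integration.integral_cong) (auto simp: power2_eq_square algebra_simps)
  also have "\<dots> = (\<integral>\<omega>. indicator A \<omega> * (g \<omega>)\<^sup>2 \<partial>M) - (2 * \<mu>) * (prob A * \<mu>) + \<mu>\<^sup>2 * prob A"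
  proof -
    have i3: "integrable M (\<lambda>\<omega>. \<mu>\<^sup>2 * indicator A \<omega> :: real)"
      by (intro integrable_mult_right) (simp add: emeasure_eq_measure)
    have i4: "integrable M (\<lambda>\<omega>. (2 * \<mu>) * (indicator A \<omega> * g \<omega>))"
      by (intro integrable_mult_right i1)
    show ?thesis
      unfolding Bochner_Integration.integral_add[OF Bochner_Integration.integrable_diff[OF i2 i4] i3]
        Bochner_Integration.integral_diff[OF i2 i4] \<mu>
      by simp
  qed
  finally show ?thesis
    unfolding \<mu>_def by (simp add: power2_eq_square algebra_simps)
qed

section \<open>Binomial tail bounds\<close>

lemma card_eq_sum_indicator:
  fixes n :: nat
  shows "real (card {i. i < n \<and> v i \<in> J}) = (\<Sum>i<n. indicator J (v i))"
proof -
  have "real (card {i. i < n \<and> v i \<in> J}) = (\<Sum>i\<in>{i \<in> {..<n}. v i \<in> J}. 1)"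
    by simp
  also have "\<dots> = (\<Sum>i<n. indicator J (v i))"
    unfolding sum.inter_filter[OF finite_lessThan] by (rule sum.cong) (auto simp: indicator_def)
  finally show ?thesis .
qed

text \<open>By independence the moment generating function of the count is \<open>(1 + p (e\<^sup>\<theta> - 1))\<^sup>n\<close>, and
  \<open>1 + x \<le> e\<^sup>x\<close>. The bound depends on \<open>n\<close> and \<open>p\<close> through the mean \<open>n p\<close> only, which makes the tail
  bounds below sensitive to relative rather than absolute deviations.\<close>

lemma (in prob_space) count_mgf:
  fixes V :: "nat \<Rightarrow> 'a \<Rightarrow> real"
  assumes indep: "indep_vars (\<lambda>_. borel) V {..<n}" and J [measurable]: "J \<in> sets borel"
    and p: "\<And>i. i < n \<Longrightarrow> prob {\<omega>\<in>space M. V i \<omega> \<in> J} = p"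
  shows "integrable M (\<lambda>\<omega>. exp (\<theta> * real (card {i. i < n \<and> V i \<omega> \<in> J})))" (is ?int)
    and "expectation (\<lambda>\<omega>. exp (\<theta> * real (card {i. i < n \<and> V i \<omega> \<in> J})))
      \<le> exp (real n * p * (exp \<theta> - 1))"
proof -
  define E where "E = (\<lambda>i \<omega>. exp (\<theta> * indicator J (V i \<omega>)) :: real)"
  have V [measurable]: "V i \<in> borel_measurable M" if "i < n" for i
    using indep that unfolding indep_vars_def by auto
  have E_alt: "E i \<omega> = 1 + (exp \<theta> - 1) * indicator {\<omega>\<in>space M. V i \<omega> \<in> J} \<omega>"
    if "\<omega> \<in> space M" for i \<omega>
    using that by (auto simp: E_def indicator_def)
  have prod: "exp (\<theta> * real (card {i. i < n \<and> V i \<omega> \<in> J})) = (\<Prod>i<n. E i \<omega>)" for \<omega>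
    unfolding E_def card_eq_sum_indicator by (simp only: sum_distrib_left exp_sum[OF finite_lessThan])
  have iE: "integrable M (E i)" if "i < n" for i
  proof -
    have "integrable M (\<lambda>\<omega>. 1 + (exp \<theta> - 1) * indicator {\<omega>\<in>space M. V i \<omega> \<in> J} \<omega>)"
      using that by (auto intro!: integrable_mult_right simp: emeasure_eq_measure)
    then show ?thesis
      by (subst Bochner_Integration.integrable_cong[OF refl E_alt])
  qed
  have EE: "expectation (E i) = 1 + (exp \<theta> - 1) * p" if "i < n" for i
  proof -
    have "expectation (E i) = expectation (\<lambda>\<omega>. 1 + (exp \<theta> - 1) * indicator {\<omega>\<in>space M. V i \<omega> \<in> J} \<omega>)"
      by (rule Bochner_Integration.integral_cong[OF refl E_alt])
    also have "\<dots> = 1 + (exp \<theta> - 1) * p"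
      using that p[OF that] by (subst Bochner_Integration.integral_add) (auto intro!: integrable_mult_right simp: emeasure_eq_measure prob_space)
    finally show ?thesis .
  qed
  have indE: "indep_vars (\<lambda>_. borel) E {..<n}"
    unfolding E_def by (rule indep_vars_compose2[OF indep]) measurable
  show ?int
    unfolding prod by (rule indep_vars_integrable[OF _ indE iE]) auto
  have "expectation (\<lambda>\<omega>. exp (\<theta> * real (card {i. i < n \<and> V i \<omega> \<in> J}))) = (1 + (exp \<theta> - 1) * p) ^ n"
    unfolding prod by (subst indep_vars_lebesgue_integral[OF _ indE iE]) (auto simp: EE)
  also have "\<dots> \<le> exp ((exp \<theta> - 1) * p) ^ n"
  proof (cases "n = 0")
    case False
    then have "0 \<le> expectation (E 0)"
      by (auto intro!: integral_nonneg_AE simp: E_def)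
    then show ?thesis
      using False by (intro power_mono) (auto simp: EE)
  qed simp
  also have "\<dots> = exp (real n * p * (exp \<theta> - 1))"
    by (simp add: exp_of_nat_mult[symmetric] algebra_simps)
  finally show "expectation (\<lambda>\<omega>. exp (\<theta> * real (card {i. i < n \<and> V i \<omega> \<in> J})))
      \<le> exp (real n * p * (exp \<theta> - 1))" .
qed

text \<open>A positive \<open>\<theta>\<close> gives the upper tail, a negative one the lower tail.\<close>

lemma (in prob_space) count_tail:
  fixes V :: "nat \<Rightarrow> 'a \<Rightarrow> real"
  assumes indep: "indep_vars (\<lambda>_. borel) V {..<n}" and J [measurable]: "J \<in> sets borel"
    and p: "\<And>i. i < n \<Longrightarrow> prob {\<omega>\<in>space M. V i \<omega> \<in> J} = p"
  shows "prob {\<omega>\<in>space M. \<theta> * k \<le> \<theta> * real (card {i. i < n \<and> V i \<omega> \<in> J})}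
    \<le> exp (real n * p * (exp \<theta> - 1) - \<theta> * k)"
proof -
  let ?N = "\<lambda>\<omega>. real (card {i. i < n \<and> V i \<omega> \<in> J})"
  have "prob {\<omega>\<in>space M. \<theta> * k \<le> \<theta> * ?N \<omega>} = prob {\<omega>\<in>space M. exp (\<theta> * k) \<le> exp (\<theta> * ?N \<omega>)}"
    by simp
  also have "\<dots> \<le> expectation (\<lambda>\<omega>. exp (\<theta> * ?N \<omega>)) / exp (\<theta> * k)"
    by (rule integral_Markov_inequality_measure[OF count_mgf(1)[OF assms], of "{}"]) auto
  also have "\<dots> \<le> exp (real n * p * (exp \<theta> - 1)) / exp (\<theta> * k)"
    by (intro divide_right_mono count_mgf(2)[OF assms]) auto
  finally show ?thesis
    by (simp add: exp_diff)
qed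

text \<open>With \<open>\<theta> = \<eta> / 2\<close> the estimate \<open>e\<^sup>\<theta> - 1 \<le> \<theta> + \<theta>\<^sup>2\<close> turns the exponent of the previous lemma into at most
  \<open>- k \<eta>\<^sup>2 / 4\<close>. Since \<open>k\<close> will be the slice size \<open>c = n / H\<close>, the exponent is of order \<open>n / H\<close>, one
  factor \<open>H\<close> better than what a bound in terms of absolute deviations of the empirical distribution
  function yields.\<close>

lemma (in prob_space) count_upper_tail:
  fixes V :: "nat \<Rightarrow> 'a \<Rightarrow> real"
  assumes indep: "indep_vars (\<lambda>_. borel) V {..<n}" and J [measurable]: "J \<in> sets borel"
    and p: "\<And>i. i < n \<Longrightarrow> prob {\<omega>\<in>space M. V i \<omega> \<in> J} = p"
    and \<eta>: "0 < \<eta>" "\<eta> \<le> 1" and le: "real n * p \<le> (1 - \<eta>) * k" and k: "k \<ge> 0"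
  shows "prob {\<omega>\<in>space M. k \<le> real (card {i. i < n \<and> V i \<omega> \<in> J})} \<le> exp (- (k * \<eta>\<^sup>2) / 4)"
proof -
  define \<theta> where "\<theta> = \<eta> / 2"
  have \<theta>: "0 < \<theta>" "\<theta> \<le> 1" using \<eta> by (auto simp: \<theta>_def)
  have "prob {\<omega>\<in>space M. k \<le> real (card {i. i < n \<and> V i \<omega> \<in> J})}
      = prob {\<omega>\<in>space M. \<theta> * k \<le> \<theta> * real (card {i. i < n \<and> V i \<omega> \<in> J})}"
    using \<theta> by simp
  also have "\<dots> \<le> exp (real n * p * (exp \<theta> - 1) - \<theta> * k)"
    by (rule count_tail[OF indep J p])
  also have "\<dots> \<le> exp (- (k * \<eta>\<^sup>2) / 4)"
  proof -
    have "real n * p * (exp \<theta> - 1) \<le> ((1 - \<eta>) * k) * (exp \<theta> - 1)"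
      using \<theta> le by (intro mult_right_mono) auto
    also have "\<dots> \<le> ((1 - \<eta>) * k) * (\<theta> + \<theta>\<^sup>2)"
      using exp_bound[of \<theta>] \<theta> \<eta> k by (intro mult_left_mono) auto
    also have "\<dots> = \<theta> * k - k * \<eta>\<^sup>2 / 4 - k * \<eta> ^ 3 / 4"
      unfolding \<theta>_def by (simp add: field_simps power2_eq_square power3_eq_cube)
    also have "\<dots> \<le> \<theta> * k - k * \<eta>\<^sup>2 / 4"
      using \<eta> k by simp
    finally show ?thesis by simp
  qed
  finally show ?thesis .
qed

lemma (in prob_space) count_lower_tail:
  fixes V :: "nat \<Rightarrow> 'a \<Rightarrow> real"
  assumes indep: "indep_vars (\<lambda>_. borel) V {..<n}" and J [measurable]: "J \<in> sets borel"
    and p: "\<And>i. i < n \<Longrightarrow> prob {\<omega>\<in>space M. V i \<omega> \<in> J} = p"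
    and \<eta>: "0 < \<eta>" "\<eta> \<le> 1" and le: "(1 + \<eta>) * k \<le> real n * p" and k: "k \<ge> 0"
  shows "prob {\<omega>\<in>space M. real (card {i. i < n \<and> V i \<omega> \<in> J}) \<le> k} \<le> exp (- (k * \<eta>\<^sup>2) / 4)"
proof -
  define s where "s = \<eta> / 2"
  have s: "0 < s" "s \<le> 1" using \<eta> by (auto simp: s_def)
  have "prob {\<omega>\<in>space M. real (card {i. i < n \<and> V i \<omega> \<in> J}) \<le> k}
      = prob {\<omega>\<in>space M. (- s) * k \<le> (- s) * real (card {i. i < n \<and> V i \<omega> \<in> J})}"
    using s by simp
  also have "\<dots> \<le> exp (real n * p * (exp (- s) - 1) - (- s) * k)"
    by (rule count_tail[OF indep J p])
  also have "\<dots> \<le> exp (- (k * \<eta>\<^sup>2) / 4)"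
  proof -
    have "exp (- s) \<le> 1 - s + s\<^sup>2 / 2"
    proof -
      have "1 / (1 + s + s\<^sup>2 / 2) \<le> 1 - s + s\<^sup>2 / 2"
      proof -
        have "(1 - s + s\<^sup>2 / 2) * (1 + s + s\<^sup>2 / 2) = 1 + s ^ 4 / 4"
          by (simp add: field_simps power2_eq_square power4_eq_xxxx)
        moreover have "1 + s + s\<^sup>2 / 2 > 0" using s by (intro add_pos_nonneg) auto
        ultimately show ?thesis
          by (simp add: divide_le_eq)
      qed
      moreover have "1 + s + s\<^sup>2 / 2 \<le> exp s"
        using exp_lower_Taylor_quadratic[of s] s by simp
      moreover have "1 + s + s\<^sup>2 / 2 > 0" using s by (intro add_pos_nonneg) auto
      ultimately have "1 / exp s \<le> 1 - s + s\<^sup>2 / 2"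
        by (smt (verit) frac_le)
      then show ?thesis by (simp add: exp_minus inverse_eq_divide)
    qed
    then have e: "exp (- s) - 1 \<le> - s + s\<^sup>2 / 2" by simp
    have "exp (- s) - 1 \<le> 0" using s by simp
    then have "real n * p * (exp (- s) - 1) \<le> ((1 + \<eta>) * k) * (exp (- s) - 1)"
      using le by (intro mult_right_mono_neg) auto
    also have "\<dots> \<le> ((1 + \<eta>) * k) * (- s + s\<^sup>2 / 2)"
      using e \<eta> k by (intro mult_left_mono) auto
    also have "\<dots> = - (s * k) - k * \<eta>\<^sup>2 / 4 - k * \<eta>\<^sup>2 * (1 - \<eta>) / 8"
      unfolding s_def by (simp add: field_simps power2_eq_square power3_eq_cube)
    also have "\<dots> \<le> - (s * k) - k * \<eta>\<^sup>2 / 4"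
      using \<eta> k by simp
    finally show ?thesis by simp
  qed
  finally show ?thesis .
qed

section \<open>Order statistics and slices\<close>

text \<open>The conventions \<open>- \<infinity>\<close> for rank \<open>0\<close> and \<open>\<infinity>\<close> beyond the last rank let the two outer slices be treated
  like the inner ones. The index list is a parameter because single observations will be left out.\<close>

definition order_stat :: "(nat \<Rightarrow> real) \<Rightarrow> nat list \<Rightarrow> nat \<Rightarrow> ereal" where
  "order_stat y xs k =
     (if k = 0 then -\<infinity> else if k \<le> length xs then ereal (y (sort_key y xs ! (k - 1))) else \<infinity>)"

lemma order_stat_mono:
  assumes "k \<le> l"
  shows "order_stat y xs k \<le> order_stat y xs l"
proof -
  have "y (sort_key y xs ! (k - 1)) \<le> y (sort_key y xs ! (l - 1))" if "k \<noteq> 0" "l \<le> length xs"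
    using sorted_nth_mono[of "map y (sort_key y xs)" "k - 1" "l - 1"] assms that by simp
  then show ?thesis
    using assms by (auto simp: order_stat_def)
qed

lemma order_stat_Suc_nth:
  "q < length xs \<Longrightarrow> order_stat y xs (Suc q) = ereal (y (sort_key y xs ! q))"
  by (simp add: order_stat_def)

text \<open>Removing the observation of rank \<open>q + 1\<close> lowers all higher ranks by one and keeps the lower ones.\<close>

lemma order_stat_remove:
  assumes "distinct xs" and q: "q < length xs" "sort_key y xs ! q = k"
  shows "order_stat y (filter (\<lambda>i. i \<noteq> k) xs) j = order_stat y xs (if j \<le> q then j else Suc j)"
proof -
  let ?S = "sort_key y xs"
  have dS: "distinct ?S" and len: "length ?S = length xs"
    using assms by auto
  have split: "?S = take q ?S @ k # drop (Suc q) ?S"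
    using id_take_nth_drop[of q ?S] q len by simp
  then have "distinct (take q ?S @ k # drop (Suc q) ?S)"
    using dS by simp
  then have "k \<notin> set (take q ?S)" "k \<notin> set (drop (Suc q) ?S)"
    by simp_all
  then have "filter (\<lambda>i. i \<noteq> k) (take q ?S) = take q ?S"
    "filter (\<lambda>i. i \<noteq> k) (drop (Suc q) ?S) = drop (Suc q) ?S"
    by (intro filter_True ballI; blast)+
  then have "filter (\<lambda>i. i \<noteq> k) (take q ?S @ k # drop (Suc q) ?S) = take q ?S @ drop (Suc q) ?S"
    by simp
  then have "filter (\<lambda>i. i \<noteq> k) ?S = take q ?S @ drop (Suc q) ?S"
    by (simp only: split[symmetric])
  then have S': "sort_key y (filter (\<lambda>i. i \<noteq> k) xs) = take q ?S @ drop (Suc q) ?S"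
    by (simp add: filter_sort)
  then have "length (filter (\<lambda>i. i \<noteq> k) xs) = length (take q ?S @ drop (Suc q) ?S)"
    by (metis length_sort)
  then have len': "length (filter (\<lambda>i. i \<noteq> k) xs) = length xs - 1"
    using q len by simp
  show ?thesis
    unfolding order_stat_def len' S' using q len
    by (auto simp: nth_append min_def)
qed

text \<open>If observation \<open>k\<close> lies strictly between two order statistics, then these are order statistics of
  the remaining sample, of ranks \<open>r\<close> and \<open>s - 1\<close>; and whether \<open>k\<close> lies between them can be read off the
  remaining sample as well. Given the other observations, the slab that contains \<open>k\<close> is therefore not
  random, which is what makes the slice sums tractable.\<close>

lemma leave_one_out:
  fixes k :: nat
  assumes xs: "distinct xs" "k \<in> set xs"
  defines "xs' \<equiv> filter (\<lambda>i. i \<noteq> k) xs"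
  shows "order_stat y xs r < ereal (y k) \<and> ereal (y k) < order_stat y xs s \<longleftrightarrow>
         order_stat y xs' r < ereal (y k) \<and> ereal (y k) < order_stat y xs' (s - 1)" (is "?L \<longleftrightarrow> ?R")
    and "order_stat y xs r < ereal (y k) \<Longrightarrow> ereal (y k) < order_stat y xs s \<Longrightarrow>
         order_stat y xs' r = order_stat y xs r \<and> order_stat y xs' (s - 1) = order_stat y xs s"
proof -
  from xs obtain q where q: "q < length xs" "sort_key y xs ! q = k"
    by (metis in_set_conv_nth length_sort set_sort)
  have yk: "ereal (y k) = order_stat y xs (Suc q)"
    using q by (simp add: order_stat_Suc_nth)
  note rem = order_stat_remove[OF xs(1) q, folded xs'_def]
  have r: "r \<le> q" if "order_stat y xs r < ereal (y k)"
    using that order_stat_mono[of "Suc q" r y xs] unfolding yk by (meson not_less not_less_eq_eq)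
  have s: "q < s - 1" if "ereal (y k) < order_stat y xs s"
  proof -
    have "\<not> s \<le> Suc q"
      using that order_stat_mono[of s "Suc q" y xs] unfolding yk by (meson not_less)
    then show ?thesis by simp
  qed
  have r': "r \<le> q" if "order_stat y xs' r < ereal (y k)"
  proof (rule ccontr)
    assume "\<not> r \<le> q"
    then show False
      using that order_stat_mono[of "Suc q" "Suc r" y xs] unfolding yk rem[of r] by simp
  qed
  have s': "q < s - 1" if "ereal (y k) < order_stat y xs' (s - 1)"
  proof (rule ccontr)
    assume "\<not> q < s - 1"
    then show False
      using that order_stat_mono[of "s - 1" "Suc q" y xs] unfolding yk rem[of "s - 1"] by simp
  qed
  show eq: "order_stat y xs' r = order_stat y xs r \<and> order_stat y xs' (s - 1) = order_stat y xs s"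
    if "order_stat y xs r < ereal (y k)" "ereal (y k) < order_stat y xs s"
    using r[OF that(1)] s[OF that(2)] by (simp add: rem)
  show "?L \<longleftrightarrow> ?R"
  proof
    assume L: ?L
    from eq[OF conjunct1[OF L] conjunct2[OF L]] L show ?R by simp
  next
    assume R: ?R
    have "order_stat y xs' r = order_stat y xs r" "order_stat y xs' (s - 1) = order_stat y xs s"
      using r'[OF conjunct1[OF R]] s'[OF conjunct2[OF R]] by (simp_all add: rem)
    with R show ?L by simp
  qed
qed

lemma bij_betw_sort_key: "bij_betw ((!) (sort_key y [0..<n])) {..<n} {..<n}"
  by (rule bij_betw_nth) auto

lemma sort_key_nth_less: "q < n \<Longrightarrow> sort_key y [0..<n] ! q < n"
  using bij_betwE[OF bij_betw_sort_key[of y n]] by blast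

lemma open_slab_subset:
  "{i. i < n \<and> order_stat y [0..<n] r < ereal (y i) \<and> ereal (y i) < order_stat y [0..<n] s}
    \<subseteq> (!) (sort_key y [0..<n]) ` {r..<min (s - 1) n}"
proof
  fix i assume i: "i \<in> {i. i < n \<and> order_stat y [0..<n] r < ereal (y i) \<and> ereal (y i) < order_stat y [0..<n] s}"
  then obtain q where q: "q < n" "sort_key y [0..<n] ! q = i"
    using bij_betw_imp_surj_on[OF bij_betw_sort_key[of y n]] by (metis (no_types, lifting) imageE lessThan_iff mem_Collect_eq)
  then have "ereal (y i) = order_stat y [0..<n] (Suc q)"
    by (simp add: order_stat_Suc_nth)
  then have "r < Suc q" "Suc q < s"
    using i order_stat_mono[of "Suc q" r y "[0..<n]"] order_stat_mono[of s "Suc q" y "[0..<n]"]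
    by (auto simp: not_less[symmetric])
  then show "i \<in> (!) (sort_key y [0..<n]) ` {r..<min (s - 1) n}"
    using q by auto
qed

text \<open>Both counts hold with ties: ties can only remove points from an open slab and add points to a closed
  one.\<close>

lemma card_open_slab_le:
  "card {i. i < n \<and> order_stat y [0..<n] r < ereal (y i) \<and> ereal (y i) < order_stat y [0..<n] s}
    \<le> min (s - 1) n - r"
proof -
  have "card {i. i < n \<and> order_stat y [0..<n] r < ereal (y i) \<and> ereal (y i) < order_stat y [0..<n] s}
      \<le> card ((!) (sort_key y [0..<n]) ` {r..<min (s - 1) n})"
    by (rule card_mono[OF _ open_slab_subset]) simp
  also have "\<dots> \<le> card {r..<min (s - 1) n}"
    by (rule card_image_le) simp
  finally show ?thesis by simp
qed

lemma card_closed_slab_ge: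
  "min s n - r
    \<le> card {i. i < n \<and> order_stat y [0..<n] r \<le> ereal (y i) \<and> ereal (y i) \<le> order_stat y [0..<n] s}"
proof -
  have "min s n - r = card ((!) (sort_key y [0..<n]) ` {r..<min s n})"
    by (subst card_image) (auto intro: inj_on_subset[OF bij_betw_imp_inj_on[OF bij_betw_sort_key]])
  also have "\<dots> \<le> card {i. i < n \<and> order_stat y [0..<n] r \<le> ereal (y i) \<and> ereal (y i) \<le> order_stat y [0..<n] s}"
  proof (rule card_mono)
    show "(!) (sort_key y [0..<n]) ` {r..<min s n}
      \<subseteq> {i. i < n \<and> order_stat y [0..<n] r \<le> ereal (y i) \<and> ereal (y i) \<le> order_stat y [0..<n] s}"
    proof clarify
      fix q assume q: "q \<in> {r..<min s n}"
      have "ereal (y (sort_key y [0..<n] ! q)) = order_stat y [0..<n] (Suc q)"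
        using q by (simp add: order_stat_Suc_nth)
      then show "sort_key y [0..<n] ! q < n \<and>
          order_stat y [0..<n] r \<le> ereal (y (sort_key y [0..<n] ! q)) \<and>
          ereal (y (sort_key y [0..<n] ! q)) \<le> order_stat y [0..<n] s"
        using q by (auto intro: order_stat_mono sort_key_nth_less)
    qed
  qed simp
  finally show ?thesis .
qed

lemma open_slab_eq:
  assumes inj: "inj_on y {..<n}"
  shows "{i. i < n \<and> order_stat y [0..<n] r < ereal (y i) \<and> ereal (y i) < order_stat y [0..<n] s}
    = (!) (sort_key y [0..<n]) ` {r..<min (s - 1) n}"
proof (rule antisym[OF open_slab_subset], clarify)
  fix q assume q: "q \<in> {r..<min (s - 1) n}"
  have strict: "order_stat y [0..<n] k < order_stat y [0..<n] l" if "k < l" "k \<le> n" for k l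
  proof (cases "k = 0 \<or> l > n")
    case True
    then show ?thesis using that by (auto simp: order_stat_def)
  next
    case False
    then have "sort_key y [0..<n] ! (k - 1) \<noteq> sort_key y [0..<n] ! (l - 1)"
      using that by (subst nth_eq_iff_index_eq) auto
    then have "order_stat y [0..<n] k \<noteq> order_stat y [0..<n] l"
      using False that inj_onD[OF inj, of "sort_key y [0..<n] ! (k - 1)" "sort_key y [0..<n] ! (l - 1)"]
      by (auto simp: order_stat_def sort_key_nth_less)
    then show ?thesis
      using order_stat_mono[of k l y "[0..<n]"] that by auto
  qed
  have "ereal (y (sort_key y [0..<n] ! q)) = order_stat y [0..<n] (Suc q)"
    using q by (simp add: order_stat_Suc_nth)
  then show "sort_key y [0..<n] ! q < n \<and>
      order_stat y [0..<n] r < ereal (y (sort_key y [0..<n] ! q)) \<and>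
      ereal (y (sort_key y [0..<n] ! q)) < order_stat y [0..<n] s"
    using q by (auto intro: strict sort_key_nth_less)
qed

text \<open>The boundary between slices \<open>h\<close> and \<open>h + 1\<close>. The last slice extends to \<open>\<infinity>\<close> rather than to the largest
  observation, so its right end has rank \<open>n + 1\<close>.\<close>

definition slice_cut :: "(nat \<Rightarrow> real) \<Rightarrow> nat \<Rightarrow> nat \<Rightarrow> nat \<Rightarrow> ereal" where
  "slice_cut y H c h = order_stat y [0..<H * c] (if h = H then H * c + 1 else c * h)"

lemma slice_cut_0 [simp]: "H \<noteq> 0 \<Longrightarrow> slice_cut y H c 0 = -\<infinity>"
  by (simp add: slice_cut_def order_stat_def)

lemma slice_cut_H [simp]: "slice_cut y H c H = \<infinity>"
  by (simp add: slice_cut_def order_stat_def)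

lemma slice_cut_mono: "h \<le> h' \<Longrightarrow> h' \<le> H \<Longrightarrow> slice_cut y H c h \<le> slice_cut y H c h'"
  unfolding slice_cut_def
  by (rule order_stat_mono) (auto simp: mult.commute[of c] intro: le_SucI mult_le_mono1 )

lemma slice_cut_finite:
  assumes "0 < h" "h < H" "c > 0"
  shows "slice_cut y H c h = ereal (slice_response y H c h c)"
proof -
  have "c * h \<le> H * c" using assms by (simp add: mult.commute)
  moreover have "c * (h - 1) + c = c * h" using assms by (cases h) auto
  ultimately show ?thesis
    using assms by (simp add: slice_cut_def order_stat_def slice_response_def order_index_def)
qed

lemma slice_eq:
  assumes "1 \<le> h" "h \<le> H" "H \<ge> 2" "c > 0"
  shows "slice y H c h = {t. slice_cut y H c (h - 1) < ereal t \<and> ereal t \<le> slice_cut y H c h}"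
  using assms by (cases "h = 1"; cases "h = H") (auto simp: slice_def slice_cut_finite)

lemma slice_sample_mean_eq:
  fixes x :: "nat \<Rightarrow> 'h::real_vector"
  shows "slice_sample_mean x y H c h =
    (1 / real c) *\<^sub>R (\<Sum>q\<in>{c * (h - 1)..<c * (h - 1) + c}. x (sort_key y [0..<H * c] ! q))"
proof -
  have "(\<Sum>j=1..c. slice_concomitant x y H c h j)
      = (\<Sum>q\<in>{c * (h - 1)..<c * (h - 1) + c}. x (sort_key y [0..<H * c] ! q))"
    unfolding slice_concomitant_def order_index_def
    by (rule sum.reindex_bij_witness[of _ "\<lambda>q. q + 1 - c * (h - 1)" "\<lambda>j. c * (h - 1) + j - 1"]) auto
  then show ?thesis
    by (simp add: slice_sample_mean_def)
qed

text \<open>Sorting selects among the finitely many rearrangements of the index list by finitely many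
  comparisons. Only the coordinates that occur in the list have to be measurable, so that the results
  apply to finite product spaces.\<close>

lemma measurable_insort_key:
  fixes y :: "'a \<Rightarrow> nat \<Rightarrow> real"
  assumes "\<And>i. i \<in> set (x # xs) \<Longrightarrow> (\<lambda>\<omega>. y \<omega> i) \<in> borel_measurable M"
  shows "(\<lambda>\<omega>. insort_key (y \<omega>) x xs) \<in> measurable M (count_space {l. mset l = mset (x # xs)})"
  using assms
proof (induction xs)
  case Nil
  then show ?case by simp
next
  case (Cons a xs)
  have IH: "(\<lambda>\<omega>. insort_key (y \<omega>) x xs) \<in> measurable M (count_space {l. mset l = mset (x # xs)})"
    by (rule Cons.IH) (use Cons.prems in auto)
  have [measurable]: "(\<lambda>\<omega>. y \<omega> x) \<in> borel_measurable M" "(\<lambda>\<omega>. y \<omega> a) \<in> borel_measurable M"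
    using Cons.prems by auto
  have "(\<lambda>\<omega>. a # insort_key (y \<omega>) x xs) \<in> measurable M (count_space {l. mset l = mset (x # a # xs)})"
    by (rule measurable_compose[OF IH]) auto
  then have "(\<lambda>\<omega>. if y \<omega> x \<le> y \<omega> a then x # a # xs else a # insort_key (y \<omega>) x xs)
      \<in> measurable M (count_space {l. mset l = mset (x # a # xs)})"
    by (intro measurable_If) auto
  then show ?case by simp
qed

lemma measurable_sort_key:
  fixes y :: "'a \<Rightarrow> nat \<Rightarrow> real"
  assumes "\<And>i. i \<in> set xs \<Longrightarrow> (\<lambda>\<omega>. y \<omega> i) \<in> borel_measurable M"
  shows "(\<lambda>\<omega>. sort_key (y \<omega>) xs) \<in> measurable M (count_space {l. mset l = mset xs})"
  using assms
proof (induction xs)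
  case Nil
  then show ?case by simp
next
  case (Cons x xs)
  have IH: "(\<lambda>\<omega>. sort_key (y \<omega>) xs) \<in> measurable M (count_space {l. mset l = mset xs})"
    by (rule Cons.IH) (use Cons.prems in auto)
  have "(\<lambda>\<omega>. insort_key (y \<omega>) x (sort_key (y \<omega>) xs)) \<in> measurable M (count_space {l. mset l = mset (x # xs)})"
  proof (rule measurable_compose_countable'[OF _ IH])
    fix l assume l: "l \<in> {l. mset l = mset xs}"
    then have set: "set l = set xs" and mset: "mset (x # l) = mset (x # xs)"
      by (auto dest: mset_eq_setD)
    show "(\<lambda>\<omega>. insort_key (y \<omega>) x l) \<in> measurable M (count_space {l. mset l = mset (x # xs)})"
      using measurable_insort_key[of x l y M] Cons.prems unfolding mset by (auto simp: set)
  qed simp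
  then show ?case by simp
qed

lemma measurable_sort_key_nth:
  fixes y :: "'a \<Rightarrow> nat \<Rightarrow> real"
  assumes "\<And>i. i \<in> set xs \<Longrightarrow> (\<lambda>\<omega>. y \<omega> i) \<in> borel_measurable M"
    and v: "\<And>i. i \<in> set xs \<Longrightarrow> v i \<in> measurable M N" and q: "q < length xs"
  shows "(\<lambda>\<omega>. v (sort_key (y \<omega>) xs ! q) \<omega>) \<in> measurable M N"
proof (rule measurable_compose_countable'[OF _ measurable_sort_key[OF assms(1)]])
  fix l assume "l \<in> {l. mset l = mset xs}"
  then have "set l = set xs" "length l = length xs"
    by (auto dest: mset_eq_setD mset_eq_length)
  then show "v (l ! q) \<in> measurable M N"
    using q by (metis nth_mem v)
qed simp_all

lemma measurable_order_stat:
  fixes y :: "'a \<Rightarrow> nat \<Rightarrow> real"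
  assumes "\<And>i. i \<in> set xs \<Longrightarrow> (\<lambda>\<omega>. y \<omega> i) \<in> borel_measurable M"
  shows "(\<lambda>\<omega>. order_stat (y \<omega>) xs k) \<in> borel_measurable M"
proof -
  have "(\<lambda>\<omega>. y \<omega> (sort_key (y \<omega>) xs ! (k - 1))) \<in> borel_measurable M" if "k \<noteq> 0" "k \<le> length xs"
    by (rule measurable_sort_key_nth[where v = "\<lambda>i \<omega>. y \<omega> i"]) (use assms that in auto)
  then show ?thesis
    unfolding order_stat_def by (cases "k = 0 \<or> k > length xs") auto
qed

section \<open>Probabilities of the slices\<close>

text \<open>The population pair and its i.i.d. sample. As the law of \<open>Y\<close> has no atoms, open, half-open and closed
  intervals with the same end points are interchangeable up to null events; the open ones are called
  slabs below.\<close>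

locale sliced_sample = prob_space M for M :: "'a measure" +
  fixes X :: "'a \<Rightarrow> 'h::{real_inner,banach,second_countable_topology}"
    and Y :: "'a \<Rightarrow> real"
    and Xs :: "nat \<Rightarrow> 'a \<Rightarrow> 'h"
    and Ys :: "nat \<Rightarrow> 'a \<Rightarrow> real"
  assumes X [measurable]: "X \<in> borel_measurable M"
    and Y [measurable]: "Y \<in> borel_measurable M"
    and second_moment: "integrable M (\<lambda>\<omega>. (norm (X \<omega>))\<^sup>2)"
    and no_atoms: "\<And>y. prob {\<omega>\<in>space M. Y \<omega> = y} = 0"
    and Xs [measurable]: "\<And>i. Xs i \<in> borel_measurable M"
    and Ys [measurable]: "\<And>i. Ys i \<in> borel_measurable M"
    and indep: "indep_vars (\<lambda>_. borel \<Otimes>\<^sub>M borel) (\<lambda>i \<omega>. (Xs i \<omega>, Ys i \<omega>)) UNIV"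
    and same_law: "\<And>i. distr M (borel \<Otimes>\<^sub>M borel) (\<lambda>\<omega>. (Xs i \<omega>, Ys i \<omega>)) =
                        distr M (borel \<Otimes>\<^sub>M borel) (\<lambda>\<omega>. (X \<omega>, Y \<omega>))"
begin

definition slab :: "ereal \<Rightarrow> ereal \<Rightarrow> 'a set" where
  "slab a b = {\<omega>\<in>space M. a < ereal (Y \<omega>) \<and> ereal (Y \<omega>) < b}"

definition cdf_Y :: "ereal \<Rightarrow> real" where
  "cdf_Y a = prob {\<omega>\<in>space M. ereal (Y \<omega>) \<le> a}"

lemma sets_slab [measurable]: "slab a b \<in> sets M"
  unfolding slab_def by measurable

lemma AE_Y_neq: "AE \<omega> in M. ereal (Y \<omega>) \<noteq> a"
proof (cases a)
  case (real r)
  have "{\<omega>\<in>space M. Y \<omega> = r} \<in> null_sets M"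
    using no_atoms[of r] by (intro null_setsI) (auto simp: emeasure_eq_measure)
  from AE_not_in[OF this] show ?thesis
    using real by (auto elim!: AE_mp)
qed auto

lemma cdf_Y_nonneg: "0 \<le> cdf_Y a" and cdf_Y_le_1: "cdf_Y a \<le> 1"
  by (auto simp: cdf_Y_def)

lemma cdf_Y_infty [simp]: "cdf_Y \<infinity> = 1" "cdf_Y (-\<infinity>) = 0"
  by (auto simp: cdf_Y_def prob_space)

lemma cdf_Y_mono: "a \<le> b \<Longrightarrow> cdf_Y a \<le> cdf_Y b"
  unfolding cdf_Y_def by (rule finite_measure_mono) auto

lemma cdf_Y_less: "cdf_Y a < cdf_Y b \<Longrightarrow> a < b"
  using cdf_Y_mono[of b a] by (meson leD leI)

lemma prob_slab: "a \<le> b \<Longrightarrow> prob (slab a b) = cdf_Y b - cdf_Y a"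
proof -
  assume "a \<le> b"
  then have "cdf_Y b - cdf_Y a =
      prob ({\<omega>\<in>space M. ereal (Y \<omega>) \<le> b} - {\<omega>\<in>space M. ereal (Y \<omega>) \<le> a})"
    unfolding cdf_Y_def by (subst finite_measure_Diff) auto
  also have "\<dots> = prob (slab a b)"
  proof (rule finite_measure_eq_AE)
    show "AE \<omega> in M. \<omega> \<in> {\<omega>\<in>space M. ereal (Y \<omega>) \<le> b} - {\<omega>\<in>space M. ereal (Y \<omega>) \<le> a} \<longleftrightarrow> \<omega> \<in> slab a b"
      using AE_Y_neq[of b] by eventually_elim (auto simp: slab_def)
  qed auto
  finally show ?thesis by simp
qed

lemma cdf_Y_eq_cdf: "cdf_Y (ereal t) = cdf (distr M borel Y) t"
  by (simp add: cdf_Y_def cdf_def measure_distr vimage_def Int_def conj_commute)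

text \<open>The probability integral transform: \<open>F(Y)\<close> is uniform on \<open>[0, 1]\<close>. As \<open>F\<close> is continuous and monotone, the
  set where \<open>F \<le> s\<close> is a half-line ending in its largest point, where \<open>F\<close> equals \<open>s\<close>.\<close>

lemma cdf_Y_transform_le:
  assumes "0 \<le> t" "t \<le> 1"
  shows "prob {\<omega>\<in>space M. cdf_Y (Y \<omega>) \<le> t} = t"
proof -
  interpret D: real_distribution "distr M borel Y"
    by (rule real_distribution_distr) simp
  define F where "F = (\<lambda>t. cdf_Y (ereal t))"
  have F: "F = cdf (distr M borel Y)"
    by (simp add: F_def cdf_Y_eq_cdf fun_eq_iff)
  have F_mono: "mono F"
    unfolding F_def by (intro monoI cdf_Y_mono) simp
  have [measurable]: "F \<in> borel_measurable borel"
    by (rule borel_measurable_mono[OF F_mono])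
  have "isCont F x" for x
  proof -
    have "measure (distr M borel Y) {x} = prob {\<omega>\<in>space M. Y \<omega> = x}"
      by (simp add: measure_distr vimage_def Int_def conj_commute)
    then show ?thesis
      unfolding F by (simp add: D.isCont_cdf no_atoms)
  qed
  then have F_cont: "continuous_on UNIV F"
    by (simp add: continuous_on_eq_continuous_at)
  have interior: "prob {\<omega>\<in>space M. F (Y \<omega>) \<le> s} = s" if s: "0 < s" "s < 1" for s
  proof -
    have "eventually (\<lambda>x. F x < s) at_bot"
      using D.cdf_lim_at_bot s unfolding F by (intro order_tendstoD(2)) auto
    then obtain x0 where x0: "F x0 < s"
      by (auto simp: eventually_at_bot_linorder)
    have "eventually (\<lambda>x. F x > s) at_top"
      using D.cdf_lim_at_top_prob s unfolding F by (intro order_tendstoD(1)) auto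
    then obtain x1 where x1: "F x1 > s"
      by (auto simp: eventually_at_top_linorder)
    define S where "S = {x. F x \<le> s}"
    have bdd: "bdd_above S"
    proof (rule bdd_aboveI)
      fix x assume "x \<in> S"
      then have "\<not> x1 \<le> x"
        using x1 monoD[OF F_mono, of x1 x] by (auto simp: S_def)
      then show "x \<le> x1" by simp
    qed
    have "closed S"
      unfolding S_def using continuous_closed_vimage[of "{..s}" F] F_cont
      by (simp add: vimage_def continuous_on_eq_continuous_at)
    moreover have "S \<noteq> {}"
      using x0 by (auto simp: S_def intro: less_imp_le)
    ultimately have Sup_in: "Sup S \<in> S"
      using bdd by (intro closed_contains_Sup)
    have "S = {..Sup S}"
    proof (intro antisym subsetI)
      show "x \<in> {..Sup S}" if "x \<in> S" for x
        using that bdd by (simp add: cSup_upper)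
      show "x \<in> S" if "x \<in> {..Sup S}" for x
        using Sup_in that monoD[OF F_mono, of x "Sup S"] by (simp add: S_def)
    qed
    moreover have "F (Sup S) = s"
    proof (rule antisym)
      show "F (Sup S) \<le> s" using Sup_in by (simp add: S_def)
      have "\<exists>x\<ge>Sup S. x \<le> x1 \<and> F x = s"
      proof (rule IVT')
        show "Sup S \<le> x1"
        proof (rule ccontr)
          assume "\<not> Sup S \<le> x1"
          then have "F x1 \<le> F (Sup S)"
            by (intro monoD[OF F_mono]) simp
          then show False
            using x1 Sup_in by (simp add: S_def)
        qed
        show "F (Sup S) \<le> s" "s \<le> F x1"
          using x1 Sup_in by (simp_all add: S_def)
        show "continuous_on {Sup S..x1} F"
          using F_cont by (rule continuous_on_subset) simp
      qed
      then obtain x where "x \<ge> Sup S" "F x = s" by auto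
      moreover have "x \<le> Sup S"
        using \<open>F x = s\<close> bdd by (intro cSup_upper) (auto simp: S_def)
      ultimately show "s \<le> F (Sup S)" by simp
    qed
    ultimately have "{\<omega>\<in>space M. F (Y \<omega>) \<le> s} = {\<omega>\<in>space M. ereal (Y \<omega>) \<le> ereal (Sup S)}"
      by (auto simp: S_def)
    then show ?thesis
      using \<open>F (Sup S) = s\<close> by (simp add: F_def cdf_Y_def)
  qed
  have "prob {\<omega>\<in>space M. F (Y \<omega>) \<le> t} = t"
  proof -
    consider "0 < t" "t < 1" | "t = 1" | "t = 0" using assms by linarith
    then show ?thesis
    proof cases
      case 2
      then show ?thesis using cdf_Y_le_1 by (simp add: F_def prob_space)
    next
      case 3
      have "prob {\<omega>\<in>space M. F (Y \<omega>) \<le> 0} \<le> s" if "0 < s" "s < 1" for s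
      proof -
        have "prob {\<omega>\<in>space M. F (Y \<omega>) \<le> 0} \<le> prob {\<omega>\<in>space M. F (Y \<omega>) \<le> s}"
          using that by (intro finite_measure_mono) auto
        then show ?thesis using interior[OF that] by simp
      qed
      then have "prob {\<omega>\<in>space M. F (Y \<omega>) \<le> 0} \<le> 0"
        by (intro dense_ge_bounded[of 0 1]) auto
      then show ?thesis
        using 3 by (simp add: measure_le_0_iff)
    qed (use interior in simp)
  qed
  then show ?thesis by (simp add: F_def)
qed

lemma measurable_cdf_Y_real [measurable]: "(\<lambda>t. cdf_Y (ereal t)) \<in> borel_measurable borel"
  by (intro borel_measurable_mono monoI cdf_Y_mono) simp

lemma cdf_Y_transform:
  assumes "0 \<le> s" "s \<le> t" "t \<le> 1"
  shows "prob {\<omega>\<in>space M. cdf_Y (Y \<omega>) \<in> {s..t}} = t - s"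
proof -
  let ?P = "\<lambda>s. {\<omega>\<in>space M. cdf_Y (Y \<omega>) \<le> s}"
  have [simp]: "?P s \<in> events" for s by measurable
  have at_s: "prob {\<omega>\<in>space M. cdf_Y (Y \<omega>) = s} = 0"
  proof (cases "s = 0")
    case True
    have "prob {\<omega>\<in>space M. cdf_Y (Y \<omega>) = s} \<le> prob (?P 0)"
      using True by (intro finite_measure_mono) auto
    then show ?thesis
      using cdf_Y_transform_le[of 0] by (simp add: measure_le_0_iff)
  next
    case False
    have "prob {\<omega>\<in>space M. cdf_Y (Y \<omega>) = s} \<le> s - x" if "0 < x" "x < s" for x
    proof -
      have "prob {\<omega>\<in>space M. cdf_Y (Y \<omega>) = s} \<le> prob (?P s - ?P x)"
        using that by (intro finite_measure_mono) auto
      also have "\<dots> = prob (?P s) - prob (?P x)"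
        using that by (intro finite_measure_Diff) auto
      also have "\<dots> = s - x"
        using that assms by (simp add: cdf_Y_transform_le)
      finally show ?thesis .
    qed
    then have "x \<le> s - prob {\<omega>\<in>space M. cdf_Y (Y \<omega>) = s}" if "0 < x" "x < s" for x
      using that by fastforce
    then have "s \<le> s - prob {\<omega>\<in>space M. cdf_Y (Y \<omega>) = s}"
      using False assms by (intro dense_le_bounded[of 0 s]) auto
    then show ?thesis
      by (simp add: measure_le_0_iff)
  qed
  have "{\<omega>\<in>space M. cdf_Y (Y \<omega>) \<in> {s..t}} = (?P t - ?P s) \<union> {\<omega>\<in>space M. cdf_Y (Y \<omega>) = s}"
    using assms by auto
  then have "prob {\<omega>\<in>space M. cdf_Y (Y \<omega>) \<in> {s..t}} = prob (?P t - ?P s) + prob {\<omega>\<in>space M. cdf_Y (Y \<omega>) = s}"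
    by (simp only:) (subst finite_measure_Union, auto)
  also have "\<dots> = prob (?P t) - prob (?P s) + 0"
    using assms at_s by (subst finite_measure_Diff) auto
  finally show ?thesis
    using assms by (simp add: cdf_Y_transform_le)
qed

lemma same_law_Y:
  assumes [measurable]: "J \<in> sets borel"
  shows "prob {\<omega>\<in>space M. Ys i \<omega> \<in> J} = prob {\<omega>\<in>space M. Y \<omega> \<in> J}"
proof -
  have "prob {\<omega>\<in>space M. Ys i \<omega> \<in> J} = measure (distr M (borel \<Otimes>\<^sub>M borel) (\<lambda>\<omega>. (Xs i \<omega>, Ys i \<omega>))) (UNIV \<times> J)"
    by (subst measure_distr) (auto simp: vimage_def Int_def intro!: arg_cong[where f = prob])
  also have "\<dots> = prob {\<omega>\<in>space M. Y \<omega> \<in> J}"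
    unfolding same_law by (subst measure_distr) (auto simp: vimage_def Int_def intro!: arg_cong[where f = prob])
  finally show ?thesis .
qed

lemma indep_Ys: "indep_vars (\<lambda>_. borel) Ys I"
  using indep_vars_compose2[OF indep, of "\<lambda>_. snd" "\<lambda>_. borel"]
  by (auto intro: indep_vars_subset)

text \<open>The slices form a \<open>\<delta>\<close>-partition, in terms of slabs.\<close>

definition balanced :: "real \<Rightarrow> (nat \<Rightarrow> real) \<Rightarrow> nat \<Rightarrow> nat \<Rightarrow> bool" where
  "balanced \<delta> y H c \<longleftrightarrow> (\<forall>h\<in>{1..H}.
     (1 - \<delta>) / real H \<le> prob (slab (slice_cut y H c (h - 1)) (slice_cut y H c h)) \<and>
     prob (slab (slice_cut y H c (h - 1)) (slice_cut y H c h)) \<le> (1 + \<delta>) / real H)"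

text \<open>Deterministic core of the concentration argument. Divide the range \<open>[0, 1]\<close> of \<open>F\<close> into \<open>L = H r\<close> cells.
  A slice with probability above \<open>(1 + \<delta>) / H\<close> contains \<open>kp\<close> consecutive cells, which together hold at
  most the \<open>c\<close> observations of that slice; a slice with probability below \<open>(1 - \<delta>) / H\<close> is covered by \<open>km\<close>
  consecutive cells, which hold at least \<open>c\<close> observations. So it is enough to exclude such counts for
  the at most \<open>L + 1\<close> runs of cells of each kind, which do not depend on the sample.\<close>

lemma balanced_if_grid_counts:
  fixes y :: "nat \<Rightarrow> real" and \<delta> :: real and c H r kp km :: nat
  defines "L \<equiv> H * r"
  defines "N \<equiv> \<lambda>i k. card {j. j < H * c \<and> cdf_Y (y j) \<in> {real i / real L..real (i + k) / real L}}"
  assumes H: "H > 0" and c: "c > 0" and r: "r > 0" and \<delta>: "0 < \<delta>" "\<delta> \<le> 1"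
    and kp: "1 + real kp \<le> (1 + \<delta>) * r"
    and km: "1 + (1 - \<delta>) * r \<le> real km"
    and many: "\<And>i. i + kp \<le> L \<Longrightarrow> c < N i kp"
    and few: "\<And>i. i \<le> L \<Longrightarrow> N i km < c"
  shows "balanced \<delta> y H c"
  unfolding balanced_def
proof
  fix h assume h: "h \<in> {1..H}"
  define v where "v = (\<lambda>h. cdf_Y (slice_cut y H c h))"
  have prob: "prob (slab (slice_cut y H c (h - 1)) (slice_cut y H c h)) = v h - v (h - 1)"
    unfolding v_def using h by (intro prob_slab slice_cut_mono) auto
  have L: "L > 0" using H r by (simp add: L_def)
  have v01: "0 \<le> v h" "v h \<le> 1" for h by (auto simp: v_def cdf_Y_nonneg cdf_Y_le_1)
  define n where "n = H * c"
  define rk where "rk = (\<lambda>h. if h = H then n + 1 else c * h)"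
  have cut: "slice_cut y H c h = order_stat y [0..<n] (rk h)" for h
    by (simp add: slice_cut_def rk_def n_def)
  have rk_less: "rk (h - 1) = c * (h - 1)"
    using h by (auto simp: rk_def)
  have ch: "c * h = c * (h - 1) + c" "c * h \<le> n"
    using h by (auto simp: n_def algebra_simps)
  have "v h - v (h - 1) \<le> (1 + \<delta>) / real H"
  proof (rule ccontr)
    assume "\<not> ?thesis"
    then have "real L * ((1 + \<delta>) / real H) < real L * (v h - v (h - 1))"
      using L by (intro mult_strict_left_mono) auto
    moreover have "real L * ((1 + \<delta>) / real H) = (1 + \<delta>) * r"
      using H by (simp add: L_def)
    ultimately have big: "real L * v h > real L * v (h - 1) + (1 + \<delta>) * r"
      by (simp add: right_diff_distrib)
    \<comment> \<open>The first grid point beyond the left end of the slice.\<close>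
    define i where "i = nat \<lfloor>real L * v (h - 1)\<rfloor> + 1"
    have i: "real L * v (h - 1) < real i" "real i \<le> real L * v (h - 1) + 1"
      using v01[of "h - 1"] L unfolding i_def by (auto simp: of_nat_nat) linarith+
    have ik: "real (i + kp) < real L * v h"
      using i big kp by simp
    also have "\<dots> \<le> real L"
      using v01[of h] by (simp add: mult_left_le)
    finally have "i + kp \<le> L" by simp
    from many[OF this] have "c < N i kp" .
    also have "N i kp \<le> card {j. j < n \<and> order_stat y [0..<n] (rk (h - 1)) < ereal (y j) \<and>
        ereal (y j) < order_stat y [0..<n] (rk h)}"
      unfolding N_def n_def[symmetric]
    proof (rule card_mono)
      show "{j. j < n \<and> cdf_Y (y j) \<in> {real i / real L..real (i + kp) / real L}} \<subseteq>
        {j. j < n \<and> order_stat y [0..<n] (rk (h - 1)) < ereal (y j) \<and> ereal (y j) < order_stat y [0..<n] (rk h)}"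
      proof clarify
        fix j assume j: "cdf_Y (y j) \<in> {real i / real L..real (i + kp) / real L}"
        have "v (h - 1) < real i / real L" "real (i + kp) / real L < v h"
          using i ik L by (auto simp: field_simps)
        with j have "v (h - 1) < cdf_Y (y j)" "cdf_Y (y j) < v h" by auto
        then show "order_stat y [0..<n] (rk (h - 1)) < ereal (y j) \<and> ereal (y j) < order_stat y [0..<n] (rk h)"
          unfolding v_def cut by (auto dest: cdf_Y_less)
      qed
    qed simp
    also have "\<dots> \<le> min (rk h - 1) n - rk (h - 1)"
      by (rule card_open_slab_le)
    also have "\<dots> \<le> c"
      using ch rk_less by (auto simp: rk_def n_def algebra_simps)
    finally show False by simp
  qed
  moreover have "(1 - \<delta>) / real H \<le> v h - v (h - 1)"
  proof (rule ccontr)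
    assume "\<not> ?thesis"
    then have "real L * (v h - v (h - 1)) < real L * ((1 - \<delta>) / real H)"
      using L by (intro mult_strict_left_mono) auto
    moreover have "real L * ((1 - \<delta>) / real H) = (1 - \<delta>) * r"
      using H by (simp add: L_def)
    ultimately have small: "real L * v h < real L * v (h - 1) + (1 - \<delta>) * r"
      by (simp add: right_diff_distrib)
    \<comment> \<open>The last grid point before the left end of the slice.\<close>
    define i where "i = nat \<lfloor>real L * v (h - 1)\<rfloor>"
    have i: "real i \<le> real L * v (h - 1)" "real L * v (h - 1) \<le> real i + 1"
      using v01[of "h - 1"] L unfolding i_def by (auto simp: of_nat_nat)
    have "real L * v (h - 1) \<le> real L"
      using v01[of "h - 1"] by (simp add: mult_left_le)
    then have iL: "i \<le> L" using i by simp
    have ik: "real L * v h \<le> real (i + km)"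
      using small i km by simp
    have "c \<le> min (rk h) n - rk (h - 1)"
      using ch rk_less by (auto simp: rk_def n_def algebra_simps)
    also have "\<dots> \<le> card {j. j < n \<and> order_stat y [0..<n] (rk (h - 1)) \<le> ereal (y j) \<and>
        ereal (y j) \<le> order_stat y [0..<n] (rk h)}"
      by (rule card_closed_slab_ge)
    also have "\<dots> \<le> N i km"
      unfolding N_def n_def[symmetric]
    proof (rule card_mono)
      show "{j. j < n \<and> order_stat y [0..<n] (rk (h - 1)) \<le> ereal (y j) \<and> ereal (y j) \<le> order_stat y [0..<n] (rk h)}
        \<subseteq> {j. j < n \<and> cdf_Y (y j) \<in> {real i / real L..real (i + km) / real L}}"
      proof clarify
        fix j assume "order_stat y [0..<n] (rk (h - 1)) \<le> ereal (y j)" "ereal (y j) \<le> order_stat y [0..<n] (rk h)"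
        then have "v (h - 1) \<le> cdf_Y (y j)" "cdf_Y (y j) \<le> v h"
          unfolding v_def cut by (auto intro: cdf_Y_mono)
        moreover have "real i / real L \<le> v (h - 1)" "v h \<le> real (i + km) / real L"
          using i ik L by (auto simp: field_simps)
        ultimately show "cdf_Y (y j) \<in> {real i / real L..real (i + km) / real L}" by auto
      qed
    qed simp
    finally show False using few[OF iL] by simp
  qed
  ultimately show "(1 - \<delta>) / real H \<le> prob (slab (slice_cut y H c (h - 1)) (slice_cut y H c h)) \<and>
      prob (slab (slice_cut y H c (h - 1)) (slice_cut y H c h)) \<le> (1 + \<delta>) / real H"
    unfolding prob by simp
qed

end

context sliced_sample
begin

lemma measurable_count [measurable]:
  assumes [measurable]: "J \<in> sets borel"
  shows "(\<lambda>\<omega>. real (card {j. j < n \<and> Ys j \<omega> \<in> J})) \<in> borel_measurable M"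
  unfolding card_eq_sum_indicator by measurable

text \<open>A grid with \<open>r \<ge> 4 / \<delta>\<close> cells per slice leaves room for rounding: the runs of cells in the previous
  lemma can be chosen with expected counts at least \<open>(1 + \<delta> / 2) c\<close> and at most \<open>(1 - \<delta> / 2) c\<close>. Then the
  binomial tail bounds apply to each run, and a union bound costs only the factor \<open>2 (L + 1)\<close>.\<close>

lemma prob_not_balanced:
  fixes \<delta> :: real and H c r :: nat
  assumes \<delta>: "0 < \<delta>" "\<delta> \<le> 1" and H: "H > 0" and c: "c > 0" and r: "real r \<ge> 4 / \<delta>"
  shows "prob {\<omega>\<in>space M. \<not> balanced \<delta> (\<lambda>i. Ys i \<omega>) H c}
    \<le> 2 * (real (H * r) + 1) * exp (- (real c * \<delta>\<^sup>2 / 16))"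
proof -
  define L where "L = H * r"
  define J where "J = (\<lambda>i k. {t. cdf_Y (ereal t) \<in> {real i / real L..real (i + k) / real L}})"
  define N where "N = (\<lambda>\<omega> i k. card {j. j < H * c \<and> Ys j \<omega> \<in> J i k})"
  have [measurable]: "J i k \<in> sets borel" for i k
    unfolding J_def by measurable
  have "4 / \<delta> > 0" using \<delta> by simp
  then have r0: "r > 0" using r by (intro gr0I) auto
  have r\<delta>: "4 \<le> \<delta> * r" using r \<delta> by (simp add: field_simps)
  have L: "L > 0" using H r0 by (simp add: L_def)
  define kp where "kp = nat \<lceil>(1 + \<delta> / 2) * r\<rceil>"
  define km where "km = nat \<lceil>(1 - \<delta>) * r\<rceil> + 1"
  have nat_ceil: "x \<le> real (nat \<lceil>x\<rceil>)" "real (nat \<lceil>x\<rceil>) \<le> x + 1" if "0 \<le> x" for x :: real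
    using that ceiling_correct[of x] by (simp_all add: real_nat_ceiling_ge)
  have kp: "(1 + \<delta> / 2) * r \<le> real kp" "1 + real kp \<le> (1 + \<delta>) * r"
    using \<delta> r\<delta> nat_ceil[of "(1 + \<delta> / 2) * r"] unfolding kp_def
    by (simp_all add: algebra_simps)
  have km: "1 + (1 - \<delta>) * r \<le> real km" "real km \<le> (1 - \<delta> / 2) * r"
  proof -
    have "0 \<le> (1 - \<delta>) * r"
      using \<delta> by simp
    from nat_ceil[OF this] r\<delta> show "1 + (1 - \<delta>) * r \<le> real km" "real km \<le> (1 - \<delta> / 2) * r"
      unfolding km_def of_nat_add by (simp_all add: algebra_simps)
  qed
  define few where "few = (\<lambda>i. {\<omega>\<in>space M. i + kp \<le> L \<and> real (N \<omega> i kp) \<le> real c})"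
  define many where "many = (\<lambda>i. {\<omega>\<in>space M. real c \<le> real (N \<omega> i km)})"
  have [measurable]: "few i \<in> events" "many i \<in> events" for i
    unfolding few_def many_def N_def by measurable
  have tail: "- (real c * (\<delta> / 2)\<^sup>2) / 4 = - (real c * \<delta>\<^sup>2 / 16)"
    by (simp add: power2_eq_square)
  have few: "prob (few i) \<le> exp (- (real c * \<delta>\<^sup>2 / 16))" for i
  proof (cases "i + kp \<le> L")
    case True
    have p: "prob {\<omega>\<in>space M. Ys j \<omega> \<in> J i kp} = real kp / real L" for j
    proof -
      have "prob {\<omega>\<in>space M. Ys j \<omega> \<in> J i kp} = real (i + kp) / real L - real i / real L"
        unfolding same_law_Y[OF \<open>J i kp \<in> sets borel\<close>] unfolding J_def mem_Collect_eq
        using L True by (intro cdf_Y_transform) (auto simp: field_simps)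
      then show ?thesis by (simp add: diff_divide_distrib[symmetric])
    qed
    have "1 + \<delta> / 2 \<le> real kp / real r"
      using kp(1) r0 by (simp add: pos_le_divide_eq)
    then have "real c * (1 + \<delta> / 2) \<le> real c * (real kp / real r)"
      by (rule mult_left_mono) simp
    also have "\<dots> = real (H * c) * (real kp / real L)"
      using H by (simp add: L_def)
    finally have "(1 + \<delta> / 2) * real c \<le> real (H * c) * (real kp / real L)"
      by (simp only: mult.commute)
    then have "prob {\<omega>\<in>space M. real (N \<omega> i kp) \<le> real c} \<le> exp (- (real c * (\<delta> / 2)\<^sup>2) / 4)"
      unfolding N_def using \<delta> p by (intro count_lower_tail[OF indep_Ys]) auto
    then show ?thesis
      using True unfolding few_def tail by simp
  next
    case False
    then have "few i = {}" by (simp add: few_def)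
    then show ?thesis by simp
  qed
  have many: "prob (many i) \<le> exp (- (real c * \<delta>\<^sup>2 / 16))" if "i \<le> L" for i
  proof -
    define p where "p = prob {\<omega>\<in>space M. Y \<omega> \<in> J i km}"
    have "p \<le> prob {\<omega>\<in>space M. cdf_Y (Y \<omega>) \<in> {real i / real L..min 1 (real (i + km) / real L)}}"
      unfolding p_def J_def by (intro finite_measure_mono) (auto simp: cdf_Y_le_1)
    also have "\<dots> = min 1 (real (i + km) / real L) - real i / real L"
      using that L by (intro cdf_Y_transform) (auto simp: field_simps)
    also have "\<dots> \<le> real (i + km) / real L - real i / real L"
      by simp
    also have "\<dots> = real km / real L"
      by (simp add: add_divide_distrib)
    finally have p: "p \<le> real km / real L" .
    have "real (H * c) * p \<le> real (H * c) * (real km / real L)"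
      using p by (intro mult_left_mono) auto
    also have "\<dots> = real c * (real km / real r)"
      using H by (simp add: L_def)
    also have "\<dots> \<le> real c * (1 - \<delta> / 2)"
      using km(2) r0 by (intro mult_left_mono) (simp_all add: pos_divide_le_eq)
    also have "\<dots> = (1 - \<delta> / 2) * real c"
      by (rule mult.commute)
    finally have "prob {\<omega>\<in>space M. real c \<le> real (N \<omega> i km)} \<le> exp (- (real c * (\<delta> / 2)\<^sup>2) / 4)"
      unfolding N_def using \<delta> same_law_Y[of "J i km"]
      by (intro count_upper_tail[OF indep_Ys, where p = p]) (auto simp: p_def)
    then show ?thesis
      unfolding many_def tail .
  qed
  have "{\<omega>\<in>space M. \<not> balanced \<delta> (\<lambda>i. Ys i \<omega>) H c} \<subseteq> (\<Union>i\<in>{..L}. few i \<union> many i)"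
  proof (rule subsetI, rule ccontr)
    fix \<omega> assume \<omega>: "\<omega> \<in> {\<omega>\<in>space M. \<not> balanced \<delta> (\<lambda>i. Ys i \<omega>) H c}"
      and "\<omega> \<notin> (\<Union>i\<in>{..L}. few i \<union> many i)"
    then have "\<And>i. i + kp \<le> L \<Longrightarrow> c < N \<omega> i kp" "\<And>i. i \<le> L \<Longrightarrow> N \<omega> i km < c"
      by (force simp: few_def many_def not_le)+
    then have "balanced \<delta> (\<lambda>i. Ys i \<omega>) H c"
      unfolding N_def J_def L_def mem_Collect_eq
      by (intro balanced_if_grid_counts[OF H c r0 \<delta> kp(2) km(1)]) auto
    then show False using \<omega> by simp
  qed
  then have "prob {\<omega>\<in>space M. \<not> balanced \<delta> (\<lambda>i. Ys i \<omega>) H c} \<le> prob (\<Union>i\<in>{..L}. few i \<union> many i)"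
    by (rule measure_mono_outer) measurable
  also have "\<dots> \<le> (\<Sum>i\<in>{..L}. prob (few i \<union> many i))"
    by (rule finite_measure_subadditive_finite) auto
  also have "\<dots> \<le> (\<Sum>i\<in>{..L}. 2 * exp (- (real c * \<delta>\<^sup>2 / 16)))"
  proof (rule sum_mono)
    fix i assume "i \<in> {..L}"
    have "prob (few i \<union> many i) \<le> prob (few i) + prob (many i)"
      by (rule measure_Un_le) auto
    then show "prob (few i \<union> many i) \<le> 2 * exp (- (real c * \<delta>\<^sup>2 / 16))"
      using few[of i] many[of i] \<open>i \<in> {..L}\<close> by simp
  qed
  also have "\<dots> = 2 * (real (H * r) + 1) * exp (- (real c * \<delta>\<^sup>2 / 16))"
    by (simp add: L_def algebra_simps)
  finally show ?thesis .
qed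

section \<open>Conditional means of the slices\<close>

lemma integrable_X: "integrable M X"
proof (rule Bochner_Integration.integrable_bound[where f = "\<lambda>\<omega>. 1 + (norm (X \<omega>))\<^sup>2"])
  have "norm (X \<omega>) \<le> 1 + (norm (X \<omega>))\<^sup>2" for \<omega>
  proof -
    have "2 * norm (X \<omega>) \<le> (norm (X \<omega>))\<^sup>2 + 1"
      using sum_squares_bound[of "norm (X \<omega>)" 1] by simp
    then show ?thesis
      using norm_ge_zero[of "X \<omega>"] by linarith
  qed
  then show "AE \<omega> in M. norm (X \<omega>) \<le> norm (1 + (norm (X \<omega>))\<^sup>2)"
    by simp
qed (use second_moment in auto)

text \<open>The conditional mean as a function of the two end points, to be evaluated at random ones later.\<close>

definition slab_mean :: "ereal \<Rightarrow> ereal \<Rightarrow> 'h" where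
  "slab_mean a b = cond_mean M X (slab a b)"

lemma slab_mean_eq:
  "slab_mean a b = (1 / prob (slab a b)) *\<^sub>R (\<integral>\<omega>. indicator (slab a b) \<omega> *\<^sub>R X \<omega> \<partial>M)"
  unfolding slab_mean_def cond_mean_def by (rule integral_uniform_measure) auto

lemma prob_scaleR_slab_mean:
  "prob (slab a b) *\<^sub>R slab_mean a b = (\<integral>\<omega>. indicator (slab a b) \<omega> *\<^sub>R X \<omega> \<partial>M)"
proof (cases "prob (slab a b) = 0")
  case True
  then have "slab a b \<in> null_sets M"
    by (simp add: null_setsI emeasure_eq_measure)
  from AE_not_in[OF this] have "AE \<omega> in M. indicator (slab a b) \<omega> *\<^sub>R X \<omega> = 0"
    by eventually_elim simp
  then have "(\<integral>\<omega>. indicator (slab a b) \<omega> *\<^sub>R X \<omega> \<partial>M) = 0"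
    by (rule integral_eq_zero_AE)
  then show ?thesis using True by simp
qed (simp add: slab_mean_eq)

lemma norm_slab_mean_le:
  "norm (slab_mean a b) \<le> expectation (\<lambda>\<omega>. norm (X \<omega>)) / prob (slab a b)"
proof -
  have "norm (\<integral>\<omega>. indicator (slab a b) \<omega> *\<^sub>R X \<omega> \<partial>M) \<le> (\<integral>\<omega>. norm (indicator (slab a b) \<omega> *\<^sub>R X \<omega>) \<partial>M)"
    by (rule integral_norm_bound)
  also have "\<dots> \<le> (\<integral>\<omega>. norm (X \<omega>) \<partial>M)"
    using integrable_X by (intro integral_mono integrable_norm integrable_mult_indicator) (auto simp: indicator_def)
  finally show ?thesis
    unfolding slab_mean_eq by (simp add: divide_right_mono)
qed

lemma slice_population_mean_eq:
  assumes "1 \<le> h" "h \<le> H" "H \<ge> 2" "c > 0"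
  shows "slice_population_mean M X Y y H c h = slab_mean (slice_cut y H c (h - 1)) (slice_cut y H c h)"
proof -
  have "uniform_measure M {\<omega>\<in>space M. Y \<omega> \<in> slice y H c h} =
      uniform_measure M (slab (slice_cut y H c (h - 1)) (slice_cut y H c h))"
    unfolding slice_eq[OF assms]
  proof (rule uniform_measure_cong_AE)
    show "AE \<omega> in M. \<omega> \<in> {\<omega>\<in>space M. Y \<omega> \<in> {t. slice_cut y H c (h - 1) < ereal t \<and> ereal t \<le> slice_cut y H c h}} \<longleftrightarrow>
        \<omega> \<in> slab (slice_cut y H c (h - 1)) (slice_cut y H c h)"
      using AE_Y_neq[of "slice_cut y H c h"] by eventually_elim (auto simp: slab_def)
  qed auto
  then show ?thesis
    by (simp add: slice_population_mean_def slab_mean_def cond_mean_def)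
qed

lemma measurable_prob_slab [measurable (raw)]:
  assumes [measurable]: "a \<in> borel_measurable N" "b \<in> borel_measurable N"
  shows "(\<lambda>x. prob (slab (a x) (b x))) \<in> borel_measurable N"
proof -
  have "prob (slab (a x) (b x)) = (\<integral>\<omega>. (if a x < ereal (Y \<omega>) \<and> ereal (Y \<omega>) < b x then 1 else 0) \<partial>M)" for x
  proof -
    have "prob (slab (a x) (b x)) = (\<integral>\<omega>. indicator (slab (a x) (b x)) \<omega> \<partial>M)"
      by simp
    also have "\<dots> = (\<integral>\<omega>. (if a x < ereal (Y \<omega>) \<and> ereal (Y \<omega>) < b x then 1 else 0) \<partial>M)"
      by (rule Bochner_Integration.integral_cong) (auto simp: slab_def indicator_def)
    finally show ?thesis .
  qed
  then show ?thesis by simp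
qed

lemma measurable_slab_mean [measurable (raw)]:
  assumes [measurable]: "a \<in> borel_measurable N" "b \<in> borel_measurable N"
  shows "(\<lambda>x. slab_mean (a x) (b x)) \<in> borel_measurable N"
proof -
  have eq: "(\<integral>\<omega>. indicator (slab (a x) (b x)) \<omega> *\<^sub>R X \<omega> \<partial>M) =
      (\<integral>\<omega>. (if a x < ereal (Y \<omega>) \<and> ereal (Y \<omega>) < b x then X \<omega> else 0) \<partial>M)" for x
    by (rule Bochner_Integration.integral_cong) (auto simp: slab_def indicator_def)
  show ?thesis
    unfolding slab_mean_eq eq by measurable
qed

lemma measurable_slice_cut [measurable]: "(\<lambda>\<omega>. slice_cut (\<lambda>i. Ys i \<omega>) H c h) \<in> borel_measurable M"
  unfolding slice_cut_def by (rule measurable_order_stat) simp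

end

section \<open>The central curve\<close>

text \<open>Reduces a closed condition on all vectors to countably many of them.\<close>

lemma closed_contains_dense:
  assumes "closed S" "D \<subseteq> S" and dense: "\<And>U. open U \<Longrightarrow> U \<noteq> {} \<Longrightarrow> \<exists>d\<in>D. d \<in> U"
  shows "x \<in> S"
proof (rule ccontr)
  assume "x \<notin> S"
  then obtain d where "d \<in> D" "d \<in> - S"
    using dense[of "- S"] \<open>closed S\<close> by (auto simp: open_Compl)
  then show False
    using \<open>D \<subseteq> S\<close> by auto
qed

locale sliced_curve = sliced_sample M X Y Xs Ys
  for M :: "'a measure"
    and X :: "'a \<Rightarrow> 'h::{real_inner,banach,second_countable_topology}"
    and Y :: "'a \<Rightarrow> real" and Xs :: "nat \<Rightarrow> 'a \<Rightarrow> 'h" and Ys :: "nat \<Rightarrow> 'a \<Rightarrow> real" +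
  fixes m :: "real \<Rightarrow> 'h"
  assumes mean_zero: "(\<integral>\<omega>. X \<omega> \<partial>M) = 0"
    and curve: "central_curve M X Y m"
begin

lemma measurable_m [measurable]: "m \<in> borel_measurable borel"
  and integrable_m: "integrable M (\<lambda>\<omega>. m (Y \<omega>))"
  using curve by (auto simp: central_curve_def)

lemma set_integral_m:
  assumes "B \<in> sets borel"
  shows "(\<integral>\<omega>. indicator (Y -` B \<inter> space M) \<omega> *\<^sub>R m (Y \<omega>) \<partial>M) =
    (\<integral>\<omega>. indicator (Y -` B \<inter> space M) \<omega> *\<^sub>R X \<omega> \<partial>M)"
  using curve assms by (auto simp: central_curve_def set_lebesgue_integral_def)

lemma mean_m: "(\<integral>\<omega>. m (Y \<omega>) \<partial>M) = 0"
proof -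
  have "(\<integral>\<omega>. m (Y \<omega>) \<partial>M) = (\<integral>\<omega>. indicator (Y -` UNIV \<inter> space M) \<omega> *\<^sub>R m (Y \<omega>) \<partial>M)"
    by (rule Bochner_Integration.integral_cong) auto
  also have "\<dots> = (\<integral>\<omega>. indicator (Y -` UNIV \<inter> space M) \<omega> *\<^sub>R X \<omega> \<partial>M)"
    by (rule set_integral_m) simp
  also have "\<dots> = (\<integral>\<omega>. X \<omega> \<partial>M)"
    by (rule Bochner_Integration.integral_cong) auto
  finally show ?thesis
    using mean_zero by simp
qed

lemma integral_slab_m:
  "(\<integral>\<omega>. indicator (slab a b) \<omega> *\<^sub>R m (Y \<omega>) \<partial>M) = prob (slab a b) *\<^sub>R slab_mean a b"
proof -
  have "slab a b = Y -` {t. a < ereal t \<and> ereal t < b} \<inter> space M"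
    by (auto simp: slab_def)
  then show ?thesis
    unfolding prob_scaleR_slab_mean using set_integral_m[of "{t. a < ereal t \<and> ereal t < b}"] by simp
qed

text \<open>Jensen's inequality for the norm of \<open>m(Y) = E[X | Y]\<close>. The inequality \<open>\<langle>u, m(Y)\<rangle> \<le> \<parallel>u\<parallel> E[\<parallel>X\<parallel> | Y]\<close> holds
  almost surely for each vector \<open>u\<close>, hence for all vectors of a countable dense set simultaneously,
  hence by continuity for all \<open>u\<close> simultaneously. Taking \<open>u = m(Y)\<close> gives \<open>\<parallel>m(Y)\<parallel> \<le> E[\<parallel>X\<parallel> | Y]\<close>, whose
  square is integrable by the real-valued Jensen inequality.\<close>

lemma m_second_moment: "integrable M (\<lambda>\<omega>. (norm (m (Y \<omega>)))\<^sup>2)"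
proof -
  define F where "F = vimage_algebra (space M) Y borel"
  have sub: "subalgebra M F"
    unfolding subalgebra_def F_def by (auto simp: sets_vimage_algebra2 intro: measurable_sets)
  interpret F: finite_measure_subalgebra M F
    by unfold_locales (rule sub)
  have YF: "Y \<in> measurable F borel"
    unfolding F_def by (rule measurable_vimage_algebra1) simp
  have iX: "integrable M X" by (rule integrable_X)
  define Z where "Z = real_cond_exp M F (\<lambda>\<omega>. norm (X \<omega>))"
  have coord: "AE \<omega> in M. inner u (m (Y \<omega>)) \<le> norm u * Z \<omega>" for u
  proof -
    have "AE \<omega> in M. real_cond_exp M F (\<lambda>\<omega>. inner u (X \<omega>)) \<omega> = inner u (m (Y \<omega>))"
    proof (rule F.real_cond_exp_charact)
      fix A assume "A \<in> sets F"
      then obtain B where B: "A = Y -` B \<inter> space M" "B \<in> sets borel"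
        unfolding F_def by (subst (asm) sets_vimage_algebra2) auto
      have A: "A \<in> sets M"
        using B Y by (auto intro: measurable_sets)
      have "(\<integral>\<omega>. indicator A \<omega> *\<^sub>R inner u (X \<omega>) \<partial>M) = inner u (\<integral>\<omega>. indicator A \<omega> *\<^sub>R X \<omega> \<partial>M)"
        using integrable_mult_indicator[OF A iX]
        by (subst integral_inner_right[symmetric]) (simp_all add: inner_scaleR_right)
      also have "\<dots> = inner u (\<integral>\<omega>. indicator A \<omega> *\<^sub>R m (Y \<omega>) \<partial>M)"
        using set_integral_m[OF B(2)] B(1) by simp
      also have "\<dots> = (\<integral>\<omega>. indicator A \<omega> *\<^sub>R inner u (m (Y \<omega>)) \<partial>M)"
        using integrable_mult_indicator[OF A integrable_m]
        by (subst integral_inner_right[symmetric]) (simp_all add: inner_scaleR_right)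
      finally show "(\<integral>\<omega>\<in>A. inner u (X \<omega>) \<partial>M) = (\<integral>\<omega>\<in>A. inner u (m (Y \<omega>)) \<partial>M)"
        by (simp add: set_lebesgue_integral_def)
    next
      show "(\<lambda>\<omega>. inner u (m (Y \<omega>))) \<in> borel_measurable F"
        using YF by measurable
    qed (use iX integrable_m in auto)
    moreover have "AE \<omega> in M. real_cond_exp M F (\<lambda>\<omega>. inner u (X \<omega>)) \<omega> \<le> real_cond_exp M F (\<lambda>\<omega>. norm u * norm (X \<omega>)) \<omega>"
      using iX by (intro F.real_cond_exp_mono) (auto intro!: AE_I2 norm_cauchy_schwarz)
    moreover have "AE \<omega> in M. real_cond_exp M F (\<lambda>\<omega>. norm u * norm (X \<omega>)) \<omega> = norm u * Z \<omega>"
      unfolding Z_def using iX by (intro F.real_cond_exp_cmult) auto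
    ultimately show ?thesis
      by eventually_elim simp
  qed
  obtain D :: "'h set" where D: "countable D" "\<And>U. open U \<Longrightarrow> U \<noteq> {} \<Longrightarrow> \<exists>d\<in>D. d \<in> U"
    by (rule countable_dense_setE) blast
  have "AE \<omega> in M. \<forall>u\<in>D. inner u (m (Y \<omega>)) \<le> norm u * Z \<omega>"
    using D(1) coord by (simp add: AE_ball_countable)
  then have bound: "AE \<omega> in M. (norm (m (Y \<omega>)))\<^sup>2 \<le> (Z \<omega>)\<^sup>2"
  proof eventually_elim
    case (elim \<omega>)
    have "closed {u. inner u (m (Y \<omega>)) \<le> norm u * Z \<omega>}"
      by (intro closed_Collect_le continuous_intros)
    then have "m (Y \<omega>) \<in> {u. inner u (m (Y \<omega>)) \<le> norm u * Z \<omega>}"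
      using elim D(2) by (intro closed_contains_dense[where D = D]) auto
    then have "norm (m (Y \<omega>)) * norm (m (Y \<omega>)) \<le> norm (m (Y \<omega>)) * Z \<omega>"
      by (simp add: power2_norm_eq_inner[symmetric] power2_eq_square)
    then have "norm (m (Y \<omega>)) = 0 \<or> norm (m (Y \<omega>)) \<le> Z \<omega>"
      by (cases "norm (m (Y \<omega>)) = 0") (simp_all add: mult_le_cancel_left)
    then show ?case
      by (auto intro: power_mono)
  qed
  have "integrable M (\<lambda>\<omega>. (Z \<omega>)\<^sup>2)"
    unfolding Z_def
  proof (rule F.integrable_convex_cond_exp[where I = UNIV])
    show "integrable M (\<lambda>\<omega>. norm (X \<omega>))" using iX by simp
    show "convex_on UNIV (\<lambda>x::real. x\<^sup>2)"
      by (rule convex_power_even) simp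
  qed (use second_moment in auto)
  then show ?thesis
    by (rule Bochner_Integration.integrable_bound) (use bound in auto)
qed

lemma integrable_m_inner_sq: "integrable M (\<lambda>\<omega>. (inner u (m (Y \<omega>)))\<^sup>2)"
proof (rule Bochner_Integration.integrable_bound)
  show "integrable M (\<lambda>\<omega>. (norm u)\<^sup>2 * (norm (m (Y \<omega>)))\<^sup>2)"
    using m_second_moment by simp
  show "AE \<omega> in M. norm ((inner u (m (Y \<omega>)))\<^sup>2) \<le> norm ((norm u)\<^sup>2 * (norm (m (Y \<omega>)))\<^sup>2)"
    using Cauchy_Schwarz_ineq2[of u] by (auto simp flip: power_mult_distrib intro!: AE_I2 power2_le_iff_abs_le[THEN iffD2] )
qed auto

lemma cov_m_eq: "cov_operator M (\<lambda>\<omega>. m (Y \<omega>)) u = (\<integral>\<omega>. inner (m (Y \<omega>)) u *\<^sub>R m (Y \<omega>) \<partial>M)"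
  by (simp add: cov_operator_def mean_m tensor_def)

lemma integrable_cov_m: "integrable M (\<lambda>\<omega>. inner (m (Y \<omega>)) u *\<^sub>R m (Y \<omega>))"
proof (rule Bochner_Integration.integrable_bound)
  show "integrable M (\<lambda>\<omega>. norm u * (norm (m (Y \<omega>)))\<^sup>2)"
    using m_second_moment by simp
  show "AE \<omega> in M. norm (inner (m (Y \<omega>)) u *\<^sub>R m (Y \<omega>)) \<le> norm (norm u * (norm (m (Y \<omega>)))\<^sup>2)"
  proof (rule AE_I2)
    fix \<omega>
    have "\<bar>inner (m (Y \<omega>)) u\<bar> * norm (m (Y \<omega>)) \<le> (norm (m (Y \<omega>)) * norm u) * norm (m (Y \<omega>))"
      by (intro mult_right_mono Cauchy_Schwarz_ineq2) auto
    then show "norm (inner (m (Y \<omega>)) u *\<^sub>R m (Y \<omega>)) \<le> norm (norm u * (norm (m (Y \<omega>)))\<^sup>2)"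
      by (simp add: power2_eq_square mult_ac)
  qed
qed auto

lemma bounded_linear_cov_m: "bounded_linear (cov_operator M (\<lambda>\<omega>. m (Y \<omega>)))"
proof (rule bounded_linear_intro)
  fix u v :: 'h and r :: real
  show "cov_operator M (\<lambda>\<omega>. m (Y \<omega>)) (u + v) = cov_operator M (\<lambda>\<omega>. m (Y \<omega>)) u + cov_operator M (\<lambda>\<omega>. m (Y \<omega>)) v"
    unfolding cov_m_eq inner_add_right scaleR_add_left
    by (rule Bochner_Integration.integral_add[OF integrable_cov_m integrable_cov_m])
  show "cov_operator M (\<lambda>\<omega>. m (Y \<omega>)) (r *\<^sub>R u) = r *\<^sub>R cov_operator M (\<lambda>\<omega>. m (Y \<omega>)) u"
    unfolding cov_m_eq inner_scaleR_right scaleR_scaleR[symmetric] by (rule integral_scaleR_right)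
  have "norm (cov_operator M (\<lambda>\<omega>. m (Y \<omega>)) u) \<le> (\<integral>\<omega>. norm (inner (m (Y \<omega>)) u *\<^sub>R m (Y \<omega>)) \<partial>M)"
    unfolding cov_m_eq by (rule integral_norm_bound)
  also have "\<dots> \<le> (\<integral>\<omega>. norm u * (norm (m (Y \<omega>)))\<^sup>2 \<partial>M)"
  proof (rule integral_mono)
    show "integrable M (\<lambda>\<omega>. norm u * (norm (m (Y \<omega>)))\<^sup>2)"
      using m_second_moment by simp
    fix \<omega>
    have "\<bar>inner (m (Y \<omega>)) u\<bar> * norm (m (Y \<omega>)) \<le> (norm (m (Y \<omega>)) * norm u) * norm (m (Y \<omega>))"
      by (intro mult_right_mono Cauchy_Schwarz_ineq2) auto
    then show "norm (inner (m (Y \<omega>)) u *\<^sub>R m (Y \<omega>)) \<le> norm u * (norm (m (Y \<omega>)))\<^sup>2"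
      by (simp add: power2_eq_square mult_ac)
  qed (intro integrable_norm integrable_cov_m)
  also have "\<dots> = norm u * (\<integral>\<omega>. (norm (m (Y \<omega>)))\<^sup>2 \<partial>M)"
    by simp
  finally show "norm (cov_operator M (\<lambda>\<omega>. m (Y \<omega>)) u) \<le> norm u * (\<integral>\<omega>. (norm (m (Y \<omega>)))\<^sup>2 \<partial>M)" .
qed

lemma cov_m_quadratic:
  "inner (cov_operator M (\<lambda>\<omega>. m (Y \<omega>)) u) u = (\<integral>\<omega>. (inner u (m (Y \<omega>)))\<^sup>2 \<partial>M)"
proof -
  have "inner (cov_operator M (\<lambda>\<omega>. m (Y \<omega>)) u) u = (\<integral>\<omega>. inner (inner (m (Y \<omega>)) u *\<^sub>R m (Y \<omega>)) u \<partial>M)"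
    unfolding cov_m_eq by (rule integral_inner_left[symmetric]) (rule integrable_cov_m)
  also have "\<dots> = (\<integral>\<omega>. (inner u (m (Y \<omega>)))\<^sup>2 \<partial>M)"
    by (simp add: power2_eq_square inner_commute)
  finally show ?thesis .
qed

lemma variance_inner_m:
  "variance (\<lambda>\<omega>. inner u (m (Y \<omega>))) = (\<integral>\<omega>. (inner u (m (Y \<omega>)))\<^sup>2 \<partial>M)"
proof -
  have "(\<integral>\<omega>. inner u (m (Y \<omega>)) \<partial>M) = inner u (\<integral>\<omega>. m (Y \<omega>) \<partial>M)"
    by (rule integral_inner_right) (rule integrable_m)
  then show ?thesis by (simp add: mean_m)
qed

section \<open>The population sliced covariance under balanced slices\<close>

lemma Gamma_tilde_quadratic:
  assumes "H \<ge> 2" "c > 0"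
  shows "inner (Gamma_tilde M X Y y H c u) u =
    1 / real H * (\<Sum>h=1..H. (inner u (slab_mean (slice_cut y H c (h - 1)) (slice_cut y H c h)))\<^sup>2)"
proof -
  have "inner (Gamma_tilde M X Y y H c u) u =
      1 / real H * (\<Sum>h=1..H. inner (tensor (slice_population_mean M X Y y H c h) (slice_population_mean M X Y y H c h) u) u)"
    by (simp add: Gamma_tilde_def inner_sum_left)
  also have "(\<Sum>h=1..H. inner (tensor (slice_population_mean M X Y y H c h) (slice_population_mean M X Y y H c h) u) u)
      = (\<Sum>h=1..H. (inner u (slab_mean (slice_cut y H c (h - 1)) (slice_cut y H c h)))\<^sup>2)"
    using assms by (intro sum.cong) (auto simp: tensor_def slice_population_mean_eq power2_eq_square inner_commute)
  finally show ?thesis .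
qed

text \<open>Away from the cuts, the indicator of the slab between two successive cuts is the difference of the
  indicators of \<open>Y\<close> lying below them, and the sum telescopes.\<close>

lemma slabs_cover:
  assumes "H > 0"
  shows "AE \<omega> in M. (\<Sum>h=1..H. indicator (slab (slice_cut y H c (h - 1)) (slice_cut y H c h)) \<omega> :: real) = 1"
proof -
  have "AE \<omega> in M. \<forall>h\<in>{..H}. ereal (Y \<omega>) \<noteq> slice_cut y H c h"
    by (subst AE_ball_countable) (auto intro: AE_Y_neq)
  then show ?thesis
    using AE_space
  proof eventually_elim
    case (elim \<omega>)
    define s where "s = (\<lambda>h. if ereal (Y \<omega>) < slice_cut y H c h then 1 else 0 :: real)"
    have "indicator (slab (slice_cut y H c (Suc h - 1)) (slice_cut y H c (Suc h))) \<omega> = s (Suc h) - s h" if "h < H" for h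
    proof -
      have "slice_cut y H c h \<le> slice_cut y H c (Suc h)" "ereal (Y \<omega>) \<noteq> slice_cut y H c h"
        using that elim by (auto intro: slice_cut_mono)
      then show ?thesis
        using elim by (auto simp: s_def slab_def indicator_def)
    qed
    then have "(\<Sum>h=1..H. indicator (slab (slice_cut y H c (h - 1)) (slice_cut y H c h)) \<omega>) = (\<Sum>h<H. s (Suc h) - s h)"
      unfolding One_nat_def sum.atLeast1_atMost_eq by (intro sum.cong) simp_all
    also have "\<dots> = s H - s 0"
      by (rule sum_lessThan_telescope)
    finally show ?case
      using assms by (simp add: s_def)
  qed
qed

lemma closed_slab_AE:
  "AE \<omega> in M. \<omega> \<in> {\<omega>\<in>space M. a \<le> ereal (Y \<omega>) \<and> ereal (Y \<omega>) \<le> b} \<longleftrightarrow> \<omega> \<in> slab a b"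
  using AE_Y_neq[of a] AE_Y_neq[of b] by eventually_elim (auto simp: slab_def)

lemma prob_closed_slab:
  "prob {\<omega>\<in>space M. a \<le> ereal (Y \<omega>) \<and> ereal (Y \<omega>) \<le> b} = prob (slab a b)"
  by (rule finite_measure_eq_AE[OF closed_slab_AE]) auto

lemma cond_var_closed_slab:
  "cond_var M g {\<omega>\<in>space M. a \<le> ereal (Y \<omega>) \<and> ereal (Y \<omega>) \<le> b} = cond_var M g (slab a b)"
proof -
  have "uniform_measure M {\<omega>\<in>space M. a \<le> ereal (Y \<omega>) \<and> ereal (Y \<omega>) \<le> b} = uniform_measure M (slab a b)"
    by (rule uniform_measure_cong_AE[OF _ _ closed_slab_AE]) auto
  then show ?thesis by (simp add: cond_var_def)
qed

text \<open>The cuts are strictly increasing because each slice has positive probability.\<close>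

lemma gamma_partition_if_balanced:
  assumes bal: "balanced \<delta> y H c" and \<delta>: "\<delta> \<le> \<gamma>" "\<gamma> < 1" and H: "H > 0"
  shows "gamma_partition M Y \<gamma> H (slice_cut y H c)"
proof -
  have p: "(1 - \<gamma>) / real H \<le> prob (slab (slice_cut y H c h) (slice_cut y H c (h + 1)))"
    "prob (slab (slice_cut y H c h) (slice_cut y H c (h + 1))) \<le> (1 + \<gamma>) / real H" if "h < H" for h
  proof -
    have "(1 - \<gamma>) / real H \<le> (1 - \<delta>) / real H" "(1 + \<delta>) / real H \<le> (1 + \<gamma>) / real H"
      using \<delta> H by (auto intro!: divide_right_mono)
    moreover have "(1 - \<delta>) / real H \<le> prob (slab (slice_cut y H c h) (slice_cut y H c (h + 1)))"
      "prob (slab (slice_cut y H c h) (slice_cut y H c (h + 1))) \<le> (1 + \<delta>) / real H"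
      using bal that unfolding balanced_def by (auto dest!: bspec[of _ _ "h + 1"])
    ultimately show "(1 - \<gamma>) / real H \<le> prob (slab (slice_cut y H c h) (slice_cut y H c (h + 1)))"
      "prob (slab (slice_cut y H c h) (slice_cut y H c (h + 1))) \<le> (1 + \<gamma>) / real H"
      by linarith+
  qed
  have "strict_mono_on {0..H} (slice_cut y H c)"
  proof (rule strict_mono_onI)
    fix i j assume ij: "i \<in> {0..H}" "j \<in> {0..H}" "i < j"
    have "0 < (1 - \<gamma>) / real H"
      using \<delta> H by simp
    also have "\<dots> \<le> prob (slab (slice_cut y H c i) (slice_cut y H c (i + 1)))"
      using p ij by simp
    also have "\<dots> = cdf_Y (slice_cut y H c (i + 1)) - cdf_Y (slice_cut y H c i)"
      using ij by (intro prob_slab slice_cut_mono) auto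
    finally have "slice_cut y H c i < slice_cut y H c (i + 1)"
      by (intro cdf_Y_less) simp
    also have "\<dots> \<le> slice_cut y H c j"
      using ij by (intro slice_cut_mono) auto
    finally show "slice_cut y H c i < slice_cut y H c j" .
  qed
  then show ?thesis
    unfolding gamma_partition_def prob_closed_slab using p H by auto
qed

text \<open>Write \<open>g = \<langle>u, m(Y)\<rangle>\<close>, \<open>V = E[g\<^sup>2]\<close>, and let \<open>p\<^sub>h\<close>, \<open>\<mu>\<^sub>h\<close>, \<open>w\<^sub>h\<close> be probability, conditional mean and conditional
  variance of \<open>g\<close> on the \<open>h\<close>-th slice. Then \<open>V = \<Sum> p\<^sub>h w\<^sub>h + \<Sum> p\<^sub>h \<mu>\<^sub>h\<^sup>2\<close>, while the quadratic form of the sliced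
  covariance is \<open>\<Sum> \<mu>\<^sub>h\<^sup>2 / H\<close>. The difference consists of the variances within the slices, which sliced
  stability bounds by \<open>2 V / \<tau>\<close>, and of \<open>\<Sum> (1 / H - p\<^sub>h) \<mu>\<^sub>h\<^sup>2\<close>, which is at most \<open>2 \<delta> V\<close>. The latter is of order
  \<open>\<gamma> V\<close> for a general \<open>\<gamma>\<close>-partition, which need not be small compared with \<open>V / \<tau>\<close>; this is why balance is
  required with the smaller tolerance \<open>\<delta> \<le> 1 / (2 \<tau>)\<close>.\<close>

lemma Gamma_tilde_near_cov_m:
  assumes wss: "weak_sliced_stable M \<gamma> K \<tau> m Y" and bal: "balanced \<delta> y H c"
    and \<delta>: "0 < \<delta>" "\<delta> \<le> \<gamma>" "\<gamma> < 1" "\<delta> \<le> 1 / (2 * \<tau>)"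
    and H: "H \<ge> K" "H \<ge> 2" and c: "c > 0" and u: "norm u = 1"
  shows "\<bar>inner (Gamma_tilde M X Y y H c u - cov_operator M (\<lambda>\<omega>. m (Y \<omega>)) u) u\<bar>
    \<le> 3 / \<tau> * inner (cov_operator M (\<lambda>\<omega>. m (Y \<omega>)) u) u"
proof -
  define g where "g = (\<lambda>\<omega>. inner u (m (Y \<omega>)))"
  define V where "V = (\<integral>\<omega>. (g \<omega>)\<^sup>2 \<partial>M)"
  define A where "A = (\<lambda>h. slab (slice_cut y H c (h - 1)) (slice_cut y H c h))"
  define p where "p = (\<lambda>h. prob (A h))"
  define \<mu> where "\<mu> = (\<lambda>h. inner u (slab_mean (slice_cut y H c (h - 1)) (slice_cut y H c h)))"
  define w where "w = (\<lambda>h. cond_var M g (A h))"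
  have \<tau>: "1 < \<tau>" using wss by (simp add: weak_sliced_stable_def)
  have "1 / (2 * \<tau>) \<le> 1 / 2" using \<tau> by (simp add: field_simps)
  then have \<delta>_half: "\<delta> \<le> 1 / 2" using \<delta> by linarith
  have [measurable]: "g \<in> borel_measurable M" "A h \<in> events" for h
    unfolding g_def A_def by measurable
  have ig: "integrable M g" unfolding g_def using integrable_m by simp
  have ig2: "integrable M (\<lambda>\<omega>. (g \<omega>)\<^sup>2)" unfolding g_def by (rule integrable_m_inner_sq)
  have V0: "0 \<le> V" unfolding V_def by simp
  have p: "(1 - \<delta>) / real H \<le> p h" "p h \<le> (1 + \<delta>) / real H" if "h \<in> {1..H}" for h
    using bal that by (auto simp: balanced_def p_def A_def)
  have p0: "0 < p h" if "h \<in> {1..H}" for h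
  proof -
    have "0 < (1 - \<delta>) / real H" using \<delta>_half H by simp
    then show ?thesis using p(1)[OF that] by linarith
  qed
  have p\<mu>: "p h * \<mu> h = (\<integral>\<omega>. indicator (A h) \<omega> * g \<omega> \<partial>M)" for h
  proof -
    have "(\<integral>\<omega>. indicator (A h) \<omega> * g \<omega> \<partial>M) = (\<integral>\<omega>. inner u (indicator (A h) \<omega> *\<^sub>R m (Y \<omega>)) \<partial>M)"
      by (simp add: g_def inner_scaleR_right)
    also have "\<dots> = inner u (\<integral>\<omega>. indicator (A h) \<omega> *\<^sub>R m (Y \<omega>) \<partial>M)"
      by (intro integral_inner_right integrable_mult_indicator integrable_m) simp
    also have "\<dots> = p h * \<mu> h"
      unfolding A_def p_def \<mu>_def integral_slab_m by simp
    finally show ?thesis ..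
  qed
  have decomp: "(\<integral>\<omega>. indicator (A h) \<omega> * (g \<omega>)\<^sup>2 \<partial>M) = p h * w h + p h * (\<mu> h)\<^sup>2"
    if "h \<in> {1..H}" for h
  proof -
    have "p h * cond_mean M g (A h) = (\<integral>\<omega>. indicator (A h) \<omega> * g \<omega> \<partial>M)"
      unfolding cond_mean_def p_def using p0[OF that, unfolded p_def]
      by (subst integral_uniform_measure) auto
    then have "p h * cond_mean M g (A h) = p h * \<mu> h"
      by (simp only: p\<mu>)
    then have "cond_mean M g (A h) = \<mu> h"
      using p0[OF that] by simp
    then show ?thesis
      using cond_var_eq[of "A h" g] p0[OF that] ig ig2 by (simp add: p_def w_def)
  qed
  have w0: "0 \<le> w h" for h
    unfolding w_def cond_var_def by simp
  have "V = (\<integral>\<omega>. (\<Sum>h=1..H. indicator (A h) \<omega> * (g \<omega>)\<^sup>2) \<partial>M)"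
    unfolding V_def
  proof (rule integral_cong_AE)
    have "AE \<omega> in M. (\<Sum>h=1..H. indicator (A h) \<omega> :: real) = 1"
      unfolding A_def using H by (intro slabs_cover) simp
    then show "AE \<omega> in M. (g \<omega>)\<^sup>2 = (\<Sum>h=1..H. indicator (A h) \<omega> * (g \<omega>)\<^sup>2)"
      by eventually_elim (simp add: sum_distrib_right[symmetric])
  qed auto
  also have "\<dots> = (\<Sum>h=1..H. (\<integral>\<omega>. indicator (A h) \<omega> * (g \<omega>)\<^sup>2 \<partial>M))"
    using integrable_mult_indicator[OF _ ig2] by (intro Bochner_Integration.integral_sum) simp
  also have "\<dots> = (\<Sum>h=1..H. p h * w h) + (\<Sum>h=1..H. p h * (\<mu> h)\<^sup>2)"
    by (simp add: decomp sum.distrib)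
  finally have V: "V = (\<Sum>h=1..H. p h * w h) + (\<Sum>h=1..H. p h * (\<mu> h)\<^sup>2)" .

  \<comment> \<open>Stability bounds the within-slice part of \<open>V\<close>.\<close>
  have "gamma_partition M Y \<gamma> H (slice_cut y H c)"
    using bal \<delta> H by (intro gamma_partition_if_balanced) auto
  then have "1 / real H * (\<Sum>h<H. cond_var M g {\<omega>\<in>space M. slice_cut y H c h \<le> ereal (Y \<omega>) \<and> ereal (Y \<omega>) \<le> slice_cut y H c (h + 1)})
      \<le> 1 / \<tau> * variance g"
    using wss H u unfolding weak_sliced_stable_def g_def by blast
  also have "variance g = V"
    unfolding g_def V_def by (rule variance_inner_m)
  also have "(\<Sum>h<H. cond_var M g {\<omega>\<in>space M. slice_cut y H c h \<le> ereal (Y \<omega>) \<and> ereal (Y \<omega>) \<le> slice_cut y H c (h + 1)})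
      = (\<Sum>h=1..H. w h)"
    unfolding cond_var_closed_slab w_def A_def One_nat_def sum.atLeast1_atMost_eq by simp
  finally have stable: "(\<Sum>h=1..H. w h) / real H \<le> V / \<tau>"
    by simp
  have "(\<Sum>h=1..H. p h * w h) \<le> (\<Sum>h=1..H. (2 / real H) * w h)"
  proof (intro sum_mono mult_right_mono w0)
    fix h assume h: "h \<in> {1..H}"
    have "(1 + \<delta>) / real H \<le> 2 / real H"
      using \<delta>_half by (intro divide_right_mono) auto
    then show "p h \<le> 2 / real H"
      using p(2)[OF h] by linarith
  qed
  also have "\<dots> = 2 * ((\<Sum>h=1..H. w h) / real H)"
    by (simp add: sum_distrib_left sum_divide_distrib)
  finally have within: "(\<Sum>h=1..H. p h * w h) \<le> 2 * (V / \<tau>)"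
    using stable by linarith
  have within0: "0 \<le> (\<Sum>h=1..H. p h * w h)"
    using p0 w0 by (intro sum_nonneg mult_nonneg_nonneg) (auto intro: less_imp_le)

  \<comment> \<open>The imbalance of the slices only perturbs the between-slice part.\<close>
  have "\<bar>\<Sum>h=1..H. (1 / real H - p h) * (\<mu> h)\<^sup>2\<bar> \<le> (\<Sum>h=1..H. \<bar>(1 / real H - p h) * (\<mu> h)\<^sup>2\<bar>)"
    by (rule sum_abs)
  also have "\<dots> \<le> (\<Sum>h=1..H. (2 * \<delta>) * (p h * (\<mu> h)\<^sup>2))"
  proof (rule sum_mono)
    fix h assume h: "h \<in> {1..H}"
    have "\<bar>1 / real H - p h\<bar> \<le> \<delta> / real H"
      using p[OF h] by (auto simp: abs_le_iff add_divide_distrib diff_divide_distrib)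
    also have "\<delta> / real H \<le> (2 * \<delta>) * p h"
    proof -
      have "1 / 2 / real H \<le> (1 - \<delta>) / real H"
        using \<delta>_half by (intro divide_right_mono) auto
      then have "1 / 2 / real H \<le> p h"
        using p(1)[OF h] by linarith
      then have "(2 * \<delta>) * (1 / 2 / real H) \<le> (2 * \<delta>) * p h"
        using \<delta> by (intro mult_left_mono) auto
      then show ?thesis by simp
    qed
    finally have "\<bar>1 / real H - p h\<bar> * (\<mu> h)\<^sup>2 \<le> ((2 * \<delta>) * p h) * (\<mu> h)\<^sup>2"
      by (rule mult_right_mono) simp
    then show "\<bar>(1 / real H - p h) * (\<mu> h)\<^sup>2\<bar> \<le> (2 * \<delta>) * (p h * (\<mu> h)\<^sup>2)"
      by (simp add: abs_mult mult.assoc)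
  qed
  also have "\<dots> = (2 * \<delta>) * (\<Sum>h=1..H. p h * (\<mu> h)\<^sup>2)"
    by (rule sum_distrib_left[symmetric])
  also have "\<dots> \<le> (1 / \<tau>) * V"
  proof (rule mult_mono)
    show "2 * \<delta> \<le> 1 / \<tau>" using \<delta>(4) \<tau> by (simp add: field_simps)
    show "(\<Sum>h=1..H. p h * (\<mu> h)\<^sup>2) \<le> V" using V within0 by simp
    show "0 \<le> (\<Sum>h=1..H. p h * (\<mu> h)\<^sup>2)"
      using p0 by (intro sum_nonneg mult_nonneg_nonneg) (auto intro: less_imp_le)
  qed (use \<tau> in simp)
  finally have between: "\<bar>\<Sum>h=1..H. (1 / real H - p h) * (\<mu> h)\<^sup>2\<bar> \<le> V / \<tau>"
    by simp
  have cov: "inner (cov_operator M (\<lambda>\<omega>. m (Y \<omega>)) u) u = V"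
    unfolding cov_m_quadratic V_def g_def ..
  have "inner (Gamma_tilde M X Y y H c u - cov_operator M (\<lambda>\<omega>. m (Y \<omega>)) u) u
      = 1 / real H * (\<Sum>h=1..H. (\<mu> h)\<^sup>2) - V"
    unfolding inner_diff_left cov Gamma_tilde_quadratic[OF H(2) c] \<mu>_def ..
  also have "\<dots> = (\<Sum>h=1..H. (1 / real H - p h) * (\<mu> h)\<^sup>2) - (\<Sum>h=1..H. p h * w h)"
    unfolding V by (simp add: left_diff_distrib sum_subtractf sum_distrib_left)
  finally have "\<bar>inner (Gamma_tilde M X Y y H c u - cov_operator M (\<lambda>\<omega>. m (Y \<omega>)) u) u\<bar> \<le> 3 * (V / \<tau>)"
    using between within within0 V0 \<tau> by (auto simp: abs_le_iff)
  then show ?thesis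
    unfolding cov by simp
qed

text \<open>Both sides of the inequality are homogeneous of degree two and continuous in \<open>u\<close>, so the unit sphere
  may be replaced by a countable dense set of vectors.\<close>

lemma Gamma_tilde_near_cov_m_event:
  assumes H: "H \<ge> 2" and c: "c > 0"
  shows "{\<omega>\<in>space M. \<forall>u. norm u = 1 \<longrightarrow>
      \<bar>inner (Gamma_tilde M X Y (\<lambda>i. Ys i \<omega>) H c u - cov_operator M (\<lambda>\<omega>. m (Y \<omega>)) u) u\<bar>
        \<le> r * inner (cov_operator M (\<lambda>\<omega>. m (Y \<omega>)) u) u} \<in> events"
proof -
  define G where "G = cov_operator M (\<lambda>\<omega>. m (Y \<omega>))"
  interpret G: bounded_linear G
    unfolding G_def by (rule bounded_linear_cov_m)
  define \<mu> where "\<mu> = (\<lambda>\<omega> h. slab_mean (slice_cut (\<lambda>i. Ys i \<omega>) H c (h - 1)) (slice_cut (\<lambda>i. Ys i \<omega>) H c h))"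
  define P where "P = (\<lambda>\<omega> u. \<bar>1 / real H * (\<Sum>h=1..H. (inner u (\<mu> \<omega> h))\<^sup>2) - inner (G u) u\<bar> \<le> r * inner (G u) u)"
  have [measurable]: "(\<lambda>\<omega>. \<mu> \<omega> h) \<in> borel_measurable M" for h
    unfolding \<mu>_def by measurable
  obtain D :: "'h set" where D: "countable D" "\<And>U. open U \<Longrightarrow> U \<noteq> {} \<Longrightarrow> \<exists>d\<in>D. d \<in> U"
    by (rule countable_dense_setE) blast
  have eq: "(\<forall>u. norm u = 1 \<longrightarrow>
      \<bar>inner (Gamma_tilde M X Y (\<lambda>i. Ys i \<omega>) H c u - cov_operator M (\<lambda>\<omega>. m (Y \<omega>)) u) u\<bar>
        \<le> r * inner (cov_operator M (\<lambda>\<omega>. m (Y \<omega>)) u) u) \<longleftrightarrow> (\<forall>u\<in>D. P \<omega> u)" for \<omega>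
  proof -
    have "(\<forall>u. norm u = 1 \<longrightarrow>
      \<bar>inner (Gamma_tilde M X Y (\<lambda>i. Ys i \<omega>) H c u - cov_operator M (\<lambda>\<omega>. m (Y \<omega>)) u) u\<bar>
        \<le> r * inner (cov_operator M (\<lambda>\<omega>. m (Y \<omega>)) u) u) \<longleftrightarrow> (\<forall>u. norm u = 1 \<longrightarrow> P \<omega> u)"
      unfolding inner_diff_left Gamma_tilde_quadratic[OF H c] P_def \<mu>_def G_def ..
    also have "\<dots> \<longleftrightarrow> (\<forall>u. P \<omega> u)"
    proof (intro iffI allI)
      fix u assume *: "\<forall>u. norm u = 1 \<longrightarrow> P \<omega> u"
      show "P \<omega> u"
      proof (cases "u = 0")
        case True
        then show ?thesis by (simp add: P_def)
      next
        case False
        define v where "v = (1 / norm u) *\<^sub>R u"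
        have uv: "u = norm u *\<^sub>R v" and "norm v = 1"
          using False by (simp_all add: v_def)
        then have "P \<omega> v" using * by simp
        then have "(norm u)\<^sup>2 * \<bar>1 / real H * (\<Sum>h=1..H. (inner v (\<mu> \<omega> h))\<^sup>2) - inner (G v) v\<bar>
            \<le> (norm u)\<^sup>2 * (r * inner (G v) v)"
          unfolding P_def by (intro mult_left_mono) auto
        then have "\<bar>(norm u)\<^sup>2 * (1 / real H * (\<Sum>h=1..H. (inner v (\<mu> \<omega> h))\<^sup>2)) - (norm u)\<^sup>2 * inner (G v) v\<bar>
            \<le> r * ((norm u)\<^sup>2 * inner (G v) v)"
          unfolding right_diff_distrib[symmetric] abs_mult by (simp only: abs_power2 mult.left_commute)
        moreover have "1 / real H * (\<Sum>h=1..H. (inner u (\<mu> \<omega> h))\<^sup>2) =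
            (norm u)\<^sup>2 * (1 / real H * (\<Sum>h=1..H. (inner v (\<mu> \<omega> h))\<^sup>2))"
          by (subst uv) (simp add: power_mult_distrib sum_distrib_left mult_ac)
        moreover have "inner (G u) u = (norm u)\<^sup>2 * inner (G v) v"
          by (subst (1 2) uv) (simp add: G.scaleR power2_eq_square)
        ultimately show ?thesis
          unfolding P_def by (simp only:)
      qed
    qed auto
    also have "\<dots> \<longleftrightarrow> (\<forall>u\<in>D. P \<omega> u)"
    proof (intro iffI allI)
      fix u assume *: "\<forall>u\<in>D. P \<omega> u"
      have "closed {u. P \<omega> u}"
        unfolding P_def by (intro closed_Collect_le continuous_intros G.continuous_on)
      then have "u \<in> {u. P \<omega> u}"
        using * D(2) by (intro closed_contains_dense[where D = D]) auto
      then show "P \<omega> u" by simp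
    qed auto
    finally show ?thesis .
  qed
  have "{\<omega>\<in>space M. \<forall>u\<in>D. P \<omega> u} \<in> events"
    unfolding P_def using D(1) by measurable
  then show ?thesis
    unfolding eq .
qed

end

section \<open>Fluctuation of the slice sums\<close>

lemma insort_key_cong:
  "(\<And>i. i \<in> insert x (set xs) \<Longrightarrow> y i = y' i) \<Longrightarrow> insort_key y x xs = insort_key y' x xs"
  by (induction xs) auto

lemma sort_key_cong_set:
  "(\<And>i. i \<in> set xs \<Longrightarrow> y i = y' i) \<Longrightarrow> sort_key y xs = sort_key y' xs"
proof (induction xs)
  case (Cons x xs)
  then have "sort_key y xs = sort_key y' xs" by simp
  moreover have "insort_key y x (sort_key y' xs) = insort_key y' x (sort_key y' xs)"
    by (rule insort_key_cong) (use Cons.prems in auto)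
  ultimately show ?case by simp
qed simp

lemma order_stat_cong:
  assumes "\<And>i. i \<in> set xs \<Longrightarrow> y i = y' i"
  shows "order_stat y xs k = order_stat y' xs k"
proof -
  have "y (sort_key y' xs ! (k - 1)) = y' (sort_key y' xs ! (k - 1))" if "k \<noteq> 0" "k \<le> length xs"
  proof (rule assms)
    have "sort_key y' xs ! (k - 1) \<in> set (sort_key y' xs)"
      using that by (intro nth_mem) simp
    then show "sort_key y' xs ! (k - 1) \<in> set xs" by simp
  qed
  moreover have "sort_key y xs = sort_key y' xs"
    by (rule sort_key_cong_set) (rule assms)
  ultimately show ?thesis
    by (simp add: order_stat_def)
qed

context sliced_sample
begin

text \<open>The centred contribution of an observation to the slice sum of a slab.\<close>

definition residual :: "ereal \<Rightarrow> ereal \<Rightarrow> 'h \<times> real \<Rightarrow> 'h" where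
  "residual a b z = (if a < ereal (snd z) \<and> ereal (snd z) < b then fst z - slab_mean a b else 0)"

abbreviation law :: "('h \<times> real) measure" where
  "law \<equiv> distr M (borel \<Otimes>\<^sub>M borel) (\<lambda>\<omega>. (X \<omega>, Y \<omega>))"

lemma measurable_residual [measurable (raw)]:
  assumes [measurable]: "a \<in> borel_measurable N" "b \<in> borel_measurable N" "z \<in> measurable N (borel \<Otimes>\<^sub>M borel)"
  shows "(\<lambda>x. residual (a x) (b x) (z x)) \<in> borel_measurable N"
  unfolding residual_def by measurable

lemma residual_XY:
  "\<omega> \<in> space M \<Longrightarrow> residual a b (X \<omega>, Y \<omega>) = indicator (slab a b) \<omega> *\<^sub>R X \<omega> - indicator (slab a b) \<omega> *\<^sub>R slab_mean a b"
  by (auto simp: residual_def slab_def indicator_def)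

lemma integral_residual:
  "integrable law (residual a b)" "(\<integral>z. residual a b z \<partial>law) = 0"
proof -
  have i: "integrable M (\<lambda>\<omega>. indicator (slab a b) \<omega> *\<^sub>R X \<omega>)"
    "integrable M (\<lambda>\<omega>. indicator (slab a b) \<omega> *\<^sub>R slab_mean a b)"
    by (auto intro!: integrable_mult_indicator integrable_X)
  have *: "integrable M (\<lambda>\<omega>. residual a b (X \<omega>, Y \<omega>))"
    by (subst Bochner_Integration.integrable_cong[OF refl residual_XY]) (auto intro: i)
  then show "integrable law (residual a b)"
    by (subst integrable_distr_eq) auto
  have "(\<integral>z. residual a b z \<partial>law) = (\<integral>\<omega>. residual a b (X \<omega>, Y \<omega>) \<partial>M)"
    by (rule integral_distr) auto
  also have "\<dots> = (\<integral>\<omega>. indicator (slab a b) \<omega> *\<^sub>R X \<omega> - indicator (slab a b) \<omega> *\<^sub>R slab_mean a b \<partial>M)"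
    by (rule Bochner_Integration.integral_cong[OF refl residual_XY])
  also have "\<dots> = (\<integral>\<omega>. indicator (slab a b) \<omega> *\<^sub>R X \<omega> \<partial>M) - prob (slab a b) *\<^sub>R slab_mean a b"
    unfolding Bochner_Integration.integral_diff[OF i]
    by (subst integral_scaleR_left) (auto simp: emeasure_eq_measure)
  finally show "(\<integral>z. residual a b z \<partial>law) = 0"
    by (simp add: prob_scaleR_slab_mean)
qed

text \<open>The variance within the slab is at most the second moment.\<close>

lemma nn_integral_residual:
  "(\<integral>\<^sup>+z. ennreal ((norm (residual a b z))\<^sup>2) \<partial>law) \<le> ennreal (expectation (\<lambda>\<omega>. (norm (X \<omega>))\<^sup>2))"
proof -
  let ?I = "\<lambda>\<omega>. indicator (slab a b) \<omega> :: real"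
  let ?\<mu> = "slab_mean a b"
  have i0: "integrable M (\<lambda>\<omega>. ?I \<omega> *\<^sub>R X \<omega>)"
    by (intro integrable_mult_indicator integrable_X) simp
  have i1: "integrable M (\<lambda>\<omega>. ?I \<omega> * (norm (X \<omega>))\<^sup>2)"
    using integrable_mult_indicator[OF _ second_moment] by simp
  have i2: "integrable M (\<lambda>\<omega>. 2 * inner (?I \<omega> *\<^sub>R X \<omega>) ?\<mu>)"
    by (intro integrable_mult_right integrable_inner_left integrable_mult_indicator integrable_X) auto
  have i3: "integrable M (\<lambda>\<omega>. ?I \<omega> * (norm ?\<mu>)\<^sup>2)"
    by (intro integrable_mult_left) (auto simp: emeasure_eq_measure)
  have eq: "(norm (residual a b (X \<omega>, Y \<omega>)))\<^sup>2 =
      ?I \<omega> * (norm (X \<omega>))\<^sup>2 - 2 * inner (?I \<omega> *\<^sub>R X \<omega>) ?\<mu> + ?I \<omega> * (norm ?\<mu>)\<^sup>2"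
    if "\<omega> \<in> space M" for \<omega>
    unfolding residual_XY[OF that]
    by (cases "\<omega> \<in> slab a b") (auto simp: power2_norm_eq_inner inner_diff inner_commute)
  have "(\<integral>\<^sup>+z. ennreal ((norm (residual a b z))\<^sup>2) \<partial>law) = (\<integral>\<^sup>+\<omega>. ennreal ((norm (residual a b (X \<omega>, Y \<omega>)))\<^sup>2) \<partial>M)"
    by (rule nn_integral_distr) auto
  also have "\<dots> = ennreal (\<integral>\<omega>. (norm (residual a b (X \<omega>, Y \<omega>)))\<^sup>2 \<partial>M)"
  proof (rule nn_integral_eq_integral)
    show "integrable M (\<lambda>\<omega>. (norm (residual a b (X \<omega>, Y \<omega>)))\<^sup>2)"
      by (simp only: eq cong: Bochner_Integration.integrable_cong)
         (intro Bochner_Integration.integrable_add Bochner_Integration.integrable_diff i1 i2 i3)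
  qed auto
  also have "(\<integral>\<omega>. (norm (residual a b (X \<omega>, Y \<omega>)))\<^sup>2 \<partial>M) =
      (\<integral>\<omega>. ?I \<omega> * (norm (X \<omega>))\<^sup>2 - 2 * inner (?I \<omega> *\<^sub>R X \<omega>) ?\<mu> + ?I \<omega> * (norm ?\<mu>)\<^sup>2 \<partial>M)"
    by (rule Bochner_Integration.integral_cong[OF refl eq])
  also have "\<dots> = (\<integral>\<omega>. ?I \<omega> * (norm (X \<omega>))\<^sup>2 \<partial>M) - (\<integral>\<omega>. 2 * inner (?I \<omega> *\<^sub>R X \<omega>) ?\<mu> \<partial>M)
      + (\<integral>\<omega>. ?I \<omega> * (norm ?\<mu>)\<^sup>2 \<partial>M)"
    unfolding Bochner_Integration.integral_add[OF Bochner_Integration.integrable_diff[OF i1 i2] i3]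
      Bochner_Integration.integral_diff[OF i1 i2] ..
  also have "(\<integral>\<omega>. 2 * inner (?I \<omega> *\<^sub>R X \<omega>) ?\<mu> \<partial>M) = 2 * inner (\<integral>\<omega>. ?I \<omega> *\<^sub>R X \<omega> \<partial>M) ?\<mu>"
    unfolding integral_mult_right_zero
    by (subst integral_inner_left) (rule i0, rule refl)
  also have "\<dots> = 2 * prob (slab a b) * (norm ?\<mu>)\<^sup>2"
    unfolding prob_scaleR_slab_mean[symmetric] by (simp add: power2_norm_eq_inner)
  also have "(\<integral>\<omega>. ?I \<omega> * (norm ?\<mu>)\<^sup>2 \<partial>M) = prob (slab a b) * (norm ?\<mu>)\<^sup>2"
    by simp
  also have "(\<integral>\<omega>. ?I \<omega> * (norm (X \<omega>))\<^sup>2 \<partial>M) - 2 * prob (slab a b) * (norm ?\<mu>)\<^sup>2 + prob (slab a b) * (norm ?\<mu>)\<^sup>2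
      \<le> (\<integral>\<omega>. ?I \<omega> * (norm (X \<omega>))\<^sup>2 \<partial>M)"
    by simp
  also have "(\<integral>\<omega>. ?I \<omega> * (norm (X \<omega>))\<^sup>2 \<partial>M) \<le> (\<integral>\<omega>. (norm (X \<omega>))\<^sup>2 \<partial>M)"
    using i1 second_moment by (intro integral_mono) (auto simp: indicator_def)
  finally show ?thesis
    by (simp add: ennreal_leI)
qed

lemma sample_law:
  assumes "n > 0"
  shows "distr M (PiM {..<n} (\<lambda>_. borel \<Otimes>\<^sub>M borel)) (\<lambda>\<omega>. \<lambda>i\<in>{..<n}. (Xs i \<omega>, Ys i \<omega>)) = PiM {..<n} (\<lambda>_. law)"
proof -
  have "indep_vars (\<lambda>_. borel \<Otimes>\<^sub>M borel) (\<lambda>i \<omega>. (Xs i \<omega>, Ys i \<omega>)) {..<n}"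
    by (rule indep_vars_subset[OF indep]) simp
  then have "distr M (PiM {..<n} (\<lambda>_. borel \<Otimes>\<^sub>M borel)) (\<lambda>\<omega>. \<lambda>i\<in>{..<n}. (Xs i \<omega>, Ys i \<omega>)) =
      PiM {..<n} (\<lambda>i. distr M (borel \<Otimes>\<^sub>M borel) (\<lambda>\<omega>. (Xs i \<omega>, Ys i \<omega>)))"
    using assms by (subst (asm) indep_vars_iff_distr_eq_PiM) auto
  then show ?thesis
    by (simp add: same_law)
qed

text \<open>The slabs are random and depend on the whole sample, and still the centred observations in a slab are
  orthogonal. Indeed, integrate over observation \<open>k\<close> with all others fixed. Wherever its residual does not
  vanish, the end points are those of the sample without \<open>k\<close>, so the inner product of the \<open>k\<close>-th and the
  \<open>l\<close>-th residual integrates to the product of the mean residual over a fixed slab, which is \<open>0\<close>, with a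
  fixed vector. The diagonal terms contribute at most \<open>E \<parallel>X\<parallel>\<^sup>2\<close> each. This replaces uniform empirical
  process bounds over all possible slabs.\<close>

lemma second_moment_slice_sum:
  fixes n r s :: nat
  defines "a \<equiv> \<lambda>\<omega>. order_stat (\<lambda>i. Ys i \<omega>) [0..<n] r"
    and "b \<equiv> \<lambda>\<omega>. order_stat (\<lambda>i. Ys i \<omega>) [0..<n] s"
  defines "S \<equiv> \<lambda>\<omega>. \<Sum>k<n. residual (a \<omega>) (b \<omega>) (Xs k \<omega>, Ys k \<omega>)"
  assumes n: "n > 0"
  shows "integrable M (\<lambda>\<omega>. (norm (S \<omega>))\<^sup>2)"
    and "expectation (\<lambda>\<omega>. (norm (S \<omega>))\<^sup>2) \<le> real n * expectation (\<lambda>\<omega>. (norm (X \<omega>))\<^sup>2)"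
proof -
  define \<sigma>2 where "\<sigma>2 = expectation (\<lambda>\<omega>. (norm (X \<omega>))\<^sup>2)"
  have \<sigma>2: "0 \<le> \<sigma>2" unfolding \<sigma>2_def by simp
  interpret law: prob_space law
    by (rule prob_space_distr) measurable
  interpret P: product_prob_space "\<lambda>_::nat. law"
    by unfold_locales
  define Pn where "Pn = PiM {..<n} (\<lambda>_. law)"
  define lo where "lo = (\<lambda>z :: nat \<Rightarrow> 'h \<times> real. order_stat (\<lambda>i. snd (z i)) [0..<n] r)"
  define hi where "hi = (\<lambda>z :: nat \<Rightarrow> 'h \<times> real. order_stat (\<lambda>i. snd (z i)) [0..<n] s)"
  define lo' where "lo' = (\<lambda>k (z :: nat \<Rightarrow> 'h \<times> real). order_stat (\<lambda>i. snd (z i)) (filter (\<lambda>i. i \<noteq> k) [0..<n]) r)"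
  define hi' where "hi' = (\<lambda>k (z :: nat \<Rightarrow> 'h \<times> real). order_stat (\<lambda>i. snd (z i)) (filter (\<lambda>i. i \<noteq> k) [0..<n]) (s - 1))"
  define W where "W = (\<lambda>k z. residual (lo z) (hi z) (z k))"
  have comp [measurable]: "(\<lambda>z. z i) \<in> measurable Pn (borel \<Otimes>\<^sub>M borel)" if "i < n" for i
    using measurable_component_singleton[of i "{..<n}" "\<lambda>_. law"] that by (simp add: Pn_def)
  have comp2: "(\<lambda>z. snd (z i)) \<in> borel_measurable Pn" if "i < n" for i
    using comp[OF that] by measurable
  have lohi [measurable]: "lo \<in> borel_measurable Pn" "hi \<in> borel_measurable Pn"
    unfolding lo_def hi_def by (auto intro!: measurable_order_stat comp2)
  have W_meas [measurable]: "W k \<in> borel_measurable Pn" if "k < n" for k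
    unfolding W_def using comp[OF that] by measurable

  \<comment> \<open>Conditionally on the other observations, the slab seen by observation \<open>k\<close> is fixed.\<close>
  have loo: "W k z = residual (lo' k z) (hi' k z) (z k)" if "k < n" for k z
    using leave_one_out[of "[0..<n]" k "\<lambda>i. snd (z i)" r s] that
    by (auto simp: W_def residual_def lo_def hi_def lo'_def hi'_def)
  have loo_inner: "inner (W k z) (W l z) =
      inner (residual (lo' k z) (hi' k z) (z k)) (residual (lo' k z) (hi' k z) (z l))" if "k < n" for k l z
  proof (cases "lo z < ereal (snd (z k)) \<and> ereal (snd (z k)) < hi z")
    case True
    then have "lo' k z = lo z" "hi' k z = hi z"
      using leave_one_out(2)[of "[0..<n]" k "\<lambda>i. snd (z i)" r s] that
      by (auto simp: lo_def hi_def lo'_def hi'_def)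
    then show ?thesis by (simp add: W_def)
  next
    case False
    then have "W k z = 0" unfolding W_def residual_def by auto
    then show ?thesis using loo[OF that, of z] by simp
  qed
  have upd: "lo' k (z(k := v)) = lo' k z" "hi' k (z(k := v)) = hi' k z" for k z v
    unfolding lo'_def hi'_def by (auto intro!: order_stat_cong)
  have ins: "insert k ({..<n} - {k}) = {..<n}" if "k < n" for k
    using that by auto

  have sq: "(\<integral>\<^sup>+z. ennreal ((norm (W k z))\<^sup>2) \<partial>Pn) \<le> ennreal \<sigma>2" if k: "k < n" for k
  proof -
    let ?J = "{..<n} - {k}"
    interpret J: prob_space "PiM ?J (\<lambda>_. law)"
      by (rule prob_space_PiM) unfold_locales
    have "(\<integral>\<^sup>+z. ennreal ((norm (W k z))\<^sup>2) \<partial>Pn) = (\<integral>\<^sup>+z. ennreal ((norm (W k z))\<^sup>2) \<partial>PiM (insert k ?J) (\<lambda>_. law))"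
      unfolding ins[OF k] Pn_def ..
    also have "\<dots> = (\<integral>\<^sup>+z. (\<integral>\<^sup>+v. ennreal ((norm (W k (z(k := v))))\<^sup>2) \<partial>law) \<partial>PiM ?J (\<lambda>_. law))"
    proof (rule P.product_nn_integral_insert)
      show "(\<lambda>z. ennreal ((norm (W k z))\<^sup>2)) \<in> borel_measurable (PiM (insert k ?J) (\<lambda>_. law))"
        using W_meas[OF k] unfolding ins[OF k] Pn_def by measurable
    qed auto
    also have "\<dots> = (\<integral>\<^sup>+z. (\<integral>\<^sup>+v. ennreal ((norm (residual (lo' k z) (hi' k z) v))\<^sup>2) \<partial>law) \<partial>PiM ?J (\<lambda>_. law))"
      unfolding loo[OF k] upd by simp
    also have "\<dots> \<le> (\<integral>\<^sup>+z. ennreal \<sigma>2 \<partial>PiM ?J (\<lambda>_. law))"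
      unfolding \<sigma>2_def by (intro nn_integral_mono nn_integral_residual)
    also have "\<dots> = ennreal \<sigma>2"
      by (simp add: J.emeasure_space_1)
    finally show ?thesis .
  qed
  have sq_int: "integrable Pn (\<lambda>z. (norm (W k z))\<^sup>2)" if k: "k < n" for k
    using W_meas[OF k] le_less_trans[OF sq[OF k] ennreal_less_top]
    by (intro integrableI_bounded) auto
  have sq_le: "(\<integral>z. (norm (W k z))\<^sup>2 \<partial>Pn) \<le> \<sigma>2" if k: "k < n" for k
  proof -
    have "ennreal (\<integral>z. (norm (W k z))\<^sup>2 \<partial>Pn) \<le> ennreal \<sigma>2"
      using sq[OF k] by (subst (asm) nn_integral_eq_integral[OF sq_int[OF k]]) auto
    then show ?thesis
      using \<sigma>2 by (simp add: ennreal_le_iff)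
  qed
  have inner_int: "integrable Pn (\<lambda>z. inner (W k z) (W l z))" if kl: "k < n" "l < n" for k l
  proof (rule Bochner_Integration.integrable_bound)
    show "integrable Pn (\<lambda>z. (norm (W k z))\<^sup>2 + (norm (W l z))\<^sup>2)"
      using sq_int kl by simp
    show "(\<lambda>z. inner (W k z) (W l z)) \<in> borel_measurable Pn"
      using W_meas[OF kl(1)] W_meas[OF kl(2)] by measurable
    show "AE z in Pn. norm (inner (W k z) (W l z)) \<le> norm ((norm (W k z))\<^sup>2 + (norm (W l z))\<^sup>2)"
    proof (rule AE_I2)
      fix z
      have "\<bar>inner (W k z) (W l z)\<bar> \<le> norm (W k z) * norm (W l z)"
        by (rule Cauchy_Schwarz_ineq2)
      moreover have "2 * (norm (W k z) * norm (W l z)) \<le> (norm (W k z))\<^sup>2 + (norm (W l z))\<^sup>2"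
        using sum_squares_bound[of "norm (W k z)" "norm (W l z)"] by (simp add: mult.assoc)
      moreover have "0 \<le> norm (W k z) * norm (W l z)" by simp
      ultimately show "norm (inner (W k z) (W l z)) \<le> norm ((norm (W k z))\<^sup>2 + (norm (W l z))\<^sup>2)"
        by simp
    qed
  qed
  have cross: "(\<integral>z. inner (W k z) (W l z) \<partial>Pn) = 0" if kl: "k < n" "l < n" "k \<noteq> l" for k l
  proof -
    let ?J = "{..<n} - {k}"
    have "(\<integral>z. inner (W k z) (W l z) \<partial>Pn) = (\<integral>z. inner (W k z) (W l z) \<partial>PiM (insert k ?J) (\<lambda>_. law))"
      unfolding ins[OF kl(1)] Pn_def ..
    also have "\<dots> = (\<integral>z. (\<integral>v. inner (W k (z(k := v))) (W l (z(k := v))) \<partial>law) \<partial>PiM ?J (\<lambda>_. law))"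
    proof (rule P.product_integral_insert)
      show "integrable (PiM (insert k ?J) (\<lambda>_. law)) (\<lambda>z. inner (W k z) (W l z))"
        using inner_int[OF kl(1,2)] unfolding ins[OF kl(1)] Pn_def .
    qed auto
    also have "\<dots> = (\<integral>z. (\<integral>v. inner (residual (lo' k z) (hi' k z) v) (residual (lo' k z) (hi' k z) (z l)) \<partial>law) \<partial>PiM ?J (\<lambda>_. law))"
      unfolding loo_inner[OF kl(1)] upd using kl(3) by simp
    also have "\<dots> = (\<integral>z. 0 \<partial>PiM ?J (\<lambda>_. law))"
      by (intro Bochner_Integration.integral_cong refl)
         (subst integral_inner_left, auto simp: integral_residual)
    finally show ?thesis by simp
  qed
  have expand: "(norm (\<Sum>k<n. W k z))\<^sup>2 = (\<Sum>k<n. \<Sum>l<n. inner (W k z) (W l z))" for z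
    unfolding power2_norm_eq_inner inner_sum_left inner_sum_right
    by (intro sum.cong refl inner_commute)
  have int_Pn: "integrable Pn (\<lambda>z. (norm (\<Sum>k<n. W k z))\<^sup>2)"
    unfolding expand using inner_int by (intro Bochner_Integration.integrable_sum) auto
  have "(\<integral>z. (norm (\<Sum>k<n. W k z))\<^sup>2 \<partial>Pn) = (\<Sum>k<n. (\<integral>z. (\<Sum>l<n. inner (W k z) (W l z)) \<partial>Pn))"
    unfolding expand
    by (intro Bochner_Integration.integral_sum Bochner_Integration.integrable_sum inner_int) auto
  also have "\<dots> = (\<Sum>k<n. \<Sum>l<n. (\<integral>z. inner (W k z) (W l z) \<partial>Pn))"
    by (intro sum.cong refl Bochner_Integration.integral_sum inner_int) auto
  also have "\<dots> = (\<Sum>k<n. \<Sum>l<n. if l = k then (\<integral>z. inner (W k z) (W k z) \<partial>Pn) else 0)"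
    by (intro sum.cong refl) (auto simp: cross)
  also have "\<dots> = (\<Sum>k<n. (\<integral>z. (norm (W k z))\<^sup>2 \<partial>Pn))"
    by (simp add: power2_norm_eq_inner)
  also have "\<dots> \<le> (\<Sum>k<n. \<sigma>2)"
    by (intro sum_mono sq_le) auto
  finally have bound_Pn: "(\<integral>z. (norm (\<Sum>k<n. W k z))\<^sup>2 \<partial>Pn) \<le> real n * \<sigma>2"
    by simp

  define T where "T = (\<lambda>\<omega>. \<lambda>i\<in>{..<n}. (Xs i \<omega>, Ys i \<omega>))"
  have T [measurable]: "T \<in> measurable M (PiM {..<n} (\<lambda>_. borel \<Otimes>\<^sub>M borel))"
    unfolding T_def by (rule measurable_restrict) measurable
  have S: "S \<omega> = (\<Sum>k<n. W k (T \<omega>))" for \<omega>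
  proof -
    have "lo (T \<omega>) = a \<omega>" "hi (T \<omega>) = b \<omega>"
      unfolding lo_def hi_def a_def b_def by (auto intro!: order_stat_cong simp: T_def)
    then show ?thesis
      unfolding S_def W_def by (auto simp: T_def intro!: sum.cong)
  qed
  have distr: "distr M (PiM {..<n} (\<lambda>_. borel \<Otimes>\<^sub>M borel)) T = Pn"
    unfolding T_def Pn_def by (rule sample_law[OF n])
  have sets: "sets Pn = sets (PiM {..<n} (\<lambda>_. borel \<Otimes>\<^sub>M borel))"
    unfolding Pn_def by (rule sets_PiM_cong) auto
  have meas: "(\<lambda>z. (norm (\<Sum>k<n. W k z))\<^sup>2) \<in> borel_measurable (PiM {..<n} (\<lambda>_. borel \<Otimes>\<^sub>M borel))"
    using borel_measurable_integrable[OF int_Pn] measurable_cong_sets[OF sets refl] by blast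
  show "integrable M (\<lambda>\<omega>. (norm (S \<omega>))\<^sup>2)"
    unfolding S using int_Pn integrable_distr_eq[OF T meas] by (simp add: distr)
  have "expectation (\<lambda>\<omega>. (norm (S \<omega>))\<^sup>2) = (\<integral>z. (norm (\<Sum>k<n. W k z))\<^sup>2 \<partial>Pn)"
    unfolding S using integral_distr[OF T meas] by (simp add: distr)
  then show "expectation (\<lambda>\<omega>. (norm (S \<omega>))\<^sup>2) \<le> real n * expectation (\<lambda>\<omega>. (norm (X \<omega>))\<^sup>2)"
    using bound_Pn by (simp add: \<sigma>2_def)
qed

end

section \<open>Comparison of the sample and population sliced covariances\<close>

lemma norm_tensor_diff_le:
  fixes a b u :: "'h::real_inner"
  shows "norm (tensor a a u - tensor b b u) \<le> norm (a - b) * (norm a + norm b) * norm u"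
proof -
  have "tensor a a u - tensor b b u = inner (a - b) u *\<^sub>R a + inner b u *\<^sub>R (a - b)"
    by (simp add: tensor_def algebra_simps)
  also have "norm \<dots> \<le> \<bar>inner (a - b) u\<bar> * norm a + \<bar>inner b u\<bar> * norm (a - b)"
    by (rule norm_triangle_le) simp
  also have "\<dots> \<le> (norm (a - b) * norm u) * norm a + (norm b * norm u) * norm (a - b)"
    by (intro add_mono mult_right_mono Cauchy_Schwarz_ineq2) auto
  finally show ?thesis
    by (simp add: algebra_simps)
qed

lemma bounded_linear_tensor: "bounded_linear (tensor a b)"
  unfolding tensor_def by (intro bounded_linear_intros)

lemma bounded_linear_Gamma_hat: "bounded_linear (Gamma_hat x y H c)"
  unfolding Gamma_hat_def[abs_def]
  by (intro bounded_linear_const_scaleR bounded_linear_sum bounded_linear_tensor)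

lemma bounded_linear_Gamma_tilde: "bounded_linear (Gamma_tilde M X Y y H c)"
  unfolding Gamma_tilde_def[abs_def]
  by (intro bounded_linear_const_scaleR bounded_linear_sum bounded_linear_tensor)

lemma abs_onorm_le:
  assumes "bounded_linear f" "0 \<le> b" "\<And>u. norm (f u) \<le> b * norm u"
  shows "\<bar>onorm f\<bar> \<le> b"
  using onorm_pos_le[OF assms(1)] onorm_bound[OF assms(2,3)] by simp

lemma sum_le_sum_sort_key:
  fixes f :: "nat \<Rightarrow> real"
  assumes "\<And>i. f i \<ge> 0" "A \<subseteq> {..<n}"
  shows "(\<Sum>q\<in>A. f (sort_key y [0..<n] ! q)) \<le> (\<Sum>i<n. f i)"
proof -
  have "(\<Sum>q\<in>A. f (sort_key y [0..<n] ! q)) \<le> (\<Sum>q<n. f (sort_key y [0..<n] ! q))"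
    using assms by (intro sum_mono2) auto
  also have "\<dots> = (\<Sum>i<n. f i)"
    by (rule sum.reindex_bij_betw[OF bij_betw_sort_key])
  finally show ?thesis .
qed

lemma block_subset:
  fixes c h H :: nat
  assumes "1 \<le> h" "h \<le> H"
  shows "{c * (h - 1)..<c * (h - 1) + c} \<subseteq> {..<H * c}"
proof -
  have "c * (h - 1) + c = c * h"
    using mult_Suc_right[of c "h - 1"] assms(1) by (simp add: add.commute)
  also have "\<dots> \<le> H * c"
    using assms by (simp add: mult.commute)
  finally show ?thesis by auto
qed

text \<open>Crude, as it sums over the whole sample instead of one slice; for fixed \<open>H\<close> this only affects
  constants.\<close>

lemma norm_slice_sample_mean_sq_le:
  fixes x :: "nat \<Rightarrow> 'h::real_normed_vector"
  assumes "1 \<le> h" "h \<le> H" "c > 0"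
  shows "(norm (slice_sample_mean x y H c h))\<^sup>2 \<le> (\<Sum>i<H * c. (norm (x i))\<^sup>2) / real c"
proof -
  let ?B = "{c * (h - 1)..<c * (h - 1) + c}"
  let ?v = "\<lambda>q. x (sort_key y [0..<H * c] ! q)"
  have "(norm (\<Sum>q\<in>?B. ?v q))\<^sup>2 \<le> (\<Sum>q\<in>?B. norm (?v q))\<^sup>2"
    by (intro power_mono norm_sum) auto
  also have "\<dots> \<le> real (card ?B) * (\<Sum>q\<in>?B. (norm (?v q))\<^sup>2)"
    using Cauchy_Schwarz_ineq_sum[of "\<lambda>_. 1" "\<lambda>q. norm (?v q)" ?B] by simp
  also have "\<dots> \<le> real c * (\<Sum>i<H * c. (norm (x i))\<^sup>2)"
  proof -
    have "(\<Sum>q\<in>?B. (norm (?v q))\<^sup>2) \<le> (\<Sum>i<H * c. (norm (x i))\<^sup>2)"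
      by (rule sum_le_sum_sort_key[OF _ block_subset[OF assms(1,2)]]) simp
    then show ?thesis
      by (intro mult_mono) (auto simp: sum_nonneg)
  qed
  finally have "(norm (\<Sum>q\<in>?B. ?v q))\<^sup>2 / (real c)\<^sup>2 \<le> real c * (\<Sum>i<H * c. (norm (x i))\<^sup>2) / (real c)\<^sup>2"
    by (rule divide_right_mono) simp
  then show ?thesis
    using assms by (simp add: slice_sample_mean_eq power_divide power2_eq_square)
qed

lemma Gamma_hat_le:
  assumes "H > 0" "c > 0"
  shows "norm (Gamma_hat x y H c u) \<le> (\<Sum>i<H * c. (norm (x i))\<^sup>2) / real c * norm u"
proof -
  let ?Q = "(\<Sum>i<H * c. (norm (x i))\<^sup>2) / real c"
  have "norm (Gamma_hat x y H c u) \<le>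
      1 / real H * (\<Sum>h=1..H. norm (tensor (slice_sample_mean x y H c h) (slice_sample_mean x y H c h) u))"
    unfolding Gamma_hat_def by (simp add: norm_sum divide_right_mono)
  also have "\<dots> \<le> 1 / real H * (\<Sum>h=1..H. ?Q * norm u)"
  proof (intro mult_left_mono sum_mono)
    fix h assume h: "h \<in> {1..H}"
    let ?x = "slice_sample_mean x y H c h"
    have "norm (tensor ?x ?x u) = \<bar>inner ?x u\<bar> * norm ?x"
      by (simp add: tensor_def)
    also have "\<dots> \<le> (norm ?x * norm u) * norm ?x"
      by (intro mult_right_mono Cauchy_Schwarz_ineq2) auto
    also have "\<dots> = (norm ?x)\<^sup>2 * norm u"
      by (simp add: power2_eq_square)
    also have "\<dots> \<le> ?Q * norm u"
      using h assms by (intro mult_right_mono norm_slice_sample_mean_sq_le) auto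
    finally show "norm (tensor ?x ?x u) \<le> ?Q * norm u" .
  qed simp
  finally show ?thesis
    using assms by simp
qed

text \<open>Boundedness in probability requires one constant for all indices. Finitely many indices can be
  absorbed into it since a single real random variable is tight; so only large indices matter.\<close>

lemma (in prob_space) bigO_prob_if_eventually_le:
  fixes V :: "nat \<Rightarrow> 'a \<Rightarrow> real"
  assumes pos: "\<And>c. c \<in> I \<Longrightarrow> 0 < a c"
    and V [measurable]: "\<And>c. c \<in> I \<Longrightarrow> V c \<in> borel_measurable M"
    and dom: "\<And>c \<omega>. c \<in> I \<Longrightarrow> \<omega> \<in> space M \<Longrightarrow> \<bar>D c \<omega>\<bar> \<le> V c \<omega>"
    and ev: "\<And>\<epsilon>. 0 < \<epsilon> \<Longrightarrow> \<exists>C c0. \<forall>c\<in>I. c0 \<le> c \<longrightarrow> prob {\<omega>\<in>space M. C * a c \<le> V c \<omega>} \<le> \<epsilon>"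
  shows "bigO_prob M I D a"
  unfolding bigO_prob_def
proof (intro allI impI)
  fix \<epsilon> :: real assume \<epsilon>: "0 < \<epsilon>"
  obtain C0 c0 where C0: "\<And>c. c \<in> I \<Longrightarrow> c0 \<le> c \<Longrightarrow> prob {\<omega>\<in>space M. C0 * a c \<le> V c \<omega>} \<le> \<epsilon>"
    using ev[OF \<epsilon>] by blast
  have "\<exists>C. prob {\<omega>\<in>space M. C * a c \<le> V c \<omega>} \<le> \<epsilon>" if c: "c \<in> I" for c
  proof -
    note [measurable] = V[OF c]
    let ?A = "\<lambda>j::nat. {\<omega>\<in>space M. real j * a c \<le> V c \<omega>}"
    have "decseq ?A"
      using pos[OF c] by (intro decseq_SucI) (auto simp: algebra_simps)
    then have "(\<lambda>j. prob (?A j)) \<longlonglongrightarrow> prob (\<Inter>j. ?A j)"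
      by (intro finite_Lim_measure_decseq) auto
    also have "(\<Inter>j. ?A j) = {}"
    proof (rule ccontr)
      assume "(\<Inter>j. ?A j) \<noteq> {}"
      then obtain \<omega> where \<omega>: "\<And>j. real j * a c \<le> V c \<omega>" by auto
      obtain j where "V c \<omega> / a c < real j"
        using reals_Archimedean2 by blast
      then show False
        using \<omega>[of j] pos[OF c] by (simp add: pos_divide_less_eq)
    qed
    finally have "(\<lambda>j. prob (?A j)) \<longlonglongrightarrow> 0" by simp
    then have "eventually (\<lambda>j. prob (?A j) < \<epsilon>) sequentially"
      using \<epsilon> by (rule order_tendstoD(2))
    then obtain j where "prob (?A j) < \<epsilon>"
      by (auto simp: eventually_sequentially)
    then show ?thesis
      by (intro exI[of _ "real j"]) simp
  qed
  then obtain Cf where Cf: "\<And>c. c \<in> I \<Longrightarrow> prob {\<omega>\<in>space M. Cf c * a c \<le> V c \<omega>} \<le> \<epsilon>"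
    by metis
  define C where "C = \<bar>C0\<bar> + (\<Sum>c<c0. \<bar>Cf c\<bar>) + 1"
  have "C > 0" unfolding C_def by (simp add: add_nonneg_pos sum_nonneg)
  moreover have "prob {\<omega>\<in>space M. C * a c \<le> \<bar>D c \<omega>\<bar>} \<le> \<epsilon>" if c: "c \<in> I" for c
  proof -
    note [measurable] = V[OF c]
    have "\<exists>C'\<le>C. prob {\<omega>\<in>space M. C' * a c \<le> V c \<omega>} \<le> \<epsilon>"
    proof (cases "c0 \<le> c")
      case True
      have "0 \<le> (\<Sum>c<c0. \<bar>Cf c\<bar>)" by (simp add: sum_nonneg)
      then have "C0 \<le> C" unfolding C_def by linarith
      then show ?thesis using C0[OF c True] by blast
    next
      case False
      then have "\<bar>Cf c\<bar> \<le> (\<Sum>c<c0. \<bar>Cf c\<bar>)"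
        by (intro member_le_sum) auto
      then have "Cf c \<le> C" unfolding C_def by simp
      then show ?thesis using Cf[OF c] by blast
    qed
    then obtain C' where C': "C' \<le> C" "prob {\<omega>\<in>space M. C' * a c \<le> V c \<omega>} \<le> \<epsilon>" by blast
    have "prob {\<omega>\<in>space M. C * a c \<le> \<bar>D c \<omega>\<bar>} \<le> prob {\<omega>\<in>space M. C' * a c \<le> V c \<omega>}"
    proof (rule measure_mono_outer)
      have "C' * a c \<le> C * a c"
        using C'(1) pos[OF c] by (intro mult_right_mono) auto
      then show "{\<omega>\<in>space M. C * a c \<le> \<bar>D c \<omega>\<bar>} \<subseteq> {\<omega>\<in>space M. C' * a c \<le> V c \<omega>}"
        using dom[OF c] by fastforce
    qed measurable
    then show ?thesis using C'(2) by simp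
  qed
  ultimately show "\<exists>C>0. \<forall>i\<in>I. prob {\<omega>\<in>space M. C * a i \<le> \<bar>D i \<omega>\<bar>} \<le> \<epsilon>" by blast
qed

context sliced_sample
begin

text \<open>Each slice consists of the observations in its open slab and, except for the last one, of the
  observation at its right end point. The latter is not covered by the orthogonality argument and is
  bounded by the root of the sum of all squared norms.\<close>

lemma slice_mean_deviation:
  assumes h: "1 \<le> h" "h \<le> H" and H: "H \<ge> 2" and c: "c > 0"
    and inj: "inj_on y {..<H * c}"
  defines "\<mu> \<equiv> slab_mean (slice_cut y H c (h - 1)) (slice_cut y H c h)"
  shows "real c * norm (slice_sample_mean x y H c h - \<mu>) \<le>
    norm (\<Sum>k<H * c. residual (slice_cut y H c (h - 1)) (slice_cut y H c h) (x k, y k))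
      + sqrt (\<Sum>i<H * c. (norm (x i))\<^sup>2) + norm \<mu>"
proof -
  define n where "n = H * c"
  let ?S = "sort_key y [0..<n]"
  let ?a = "slice_cut y H c (h - 1)" and ?b = "slice_cut y H c h"
  define r where "r = c * (h - 1)"
  define e where "e = (if h = H then n else c * h - 1)"
  have ch: "c * h = r + c" "c * h \<le> n"
    using h by (auto simp: r_def n_def algebra_simps)
  have e: "r \<le> e" "e \<le> n"
    using ch c h unfolding e_def by auto
  have ab: "?a = order_stat y [0..<n] r" "?b = order_stat y [0..<n] (e + 1)"
    using h H c ch by (auto simp: slice_cut_def n_def r_def e_def)
  have "(\<Sum>k<n. residual ?a ?b (x k, y k)) =
      (\<Sum>k\<in>{k\<in>{..<n}. ?a < ereal (y k) \<and> ereal (y k) < ?b}. x k - \<mu>)"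
    unfolding residual_def \<mu>_def sum.inter_filter[OF finite_lessThan] fst_conv snd_conv by (rule refl)
  also have "{k\<in>{..<n}. ?a < ereal (y k) \<and> ereal (y k) < ?b} = (!) ?S ` {r..<e}"
    using open_slab_eq[of y n r "e + 1"] inj e unfolding ab n_def by simp
  also have "(\<Sum>k\<in>(!) ?S ` {r..<e}. x k - \<mu>) = (\<Sum>q\<in>{r..<e}. x (?S ! q) - \<mu>)"
    using e by (subst sum.reindex) (auto intro: inj_on_subset[OF bij_betw_imp_inj_on[OF bij_betw_sort_key]])
  finally have inner: "(\<Sum>k<n. residual ?a ?b (x k, y k)) = (\<Sum>q\<in>{r..<e}. x (?S ! q) - \<mu>)" .
  have block: "real c *\<^sub>R (slice_sample_mean x y H c h - \<mu>) = (\<Sum>q\<in>{r..<r + c}. x (?S ! q) - \<mu>)"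
    unfolding slice_sample_mean_eq scaleR_diff_right sum_subtractf r_def[symmetric] n_def[symmetric]
    using c by (simp add: sum_constant_scaleR)
  have "norm (\<Sum>q\<in>{r..<r + c}. x (?S ! q) - \<mu>) \<le>
      norm (\<Sum>q\<in>{r..<e}. x (?S ! q) - \<mu>) + sqrt (\<Sum>i<n. (norm (x i))\<^sup>2) + norm \<mu>"
  proof (cases "h = H")
    case True
    then have "{r..<r + c} = {r..<e}"
      using ch by (auto simp: e_def n_def algebra_simps)
    then show ?thesis by (simp add: sum_nonneg)
  next
    case False
    then have "{r..<r + c} = insert e {r..<e}" "e < n"
      using ch c by (auto simp: e_def)
    then have "norm (\<Sum>q\<in>{r..<r + c}. x (?S ! q) - \<mu>) = norm ((x (?S ! e) - \<mu>) + (\<Sum>q\<in>{r..<e}. x (?S ! q) - \<mu>))"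
      by simp
    also have "\<dots> \<le> norm (x (?S ! e)) + norm \<mu> + norm (\<Sum>q\<in>{r..<e}. x (?S ! q) - \<mu>)"
      by (intro order_trans[OF norm_triangle_ineq] add_right_mono norm_triangle_ineq4)
    also have "norm (x (?S ! e)) \<le> sqrt (\<Sum>i<n. (norm (x i))\<^sup>2)"
      using sum_le_sum_sort_key[of "\<lambda>i. (norm (x i))\<^sup>2" "{e}" n y] \<open>e < n\<close>
      by (intro real_le_rsqrt) simp
    finally show ?thesis by simp
  qed
  then show ?thesis
    unfolding n_def[symmetric] inner block[symmetric] using c by simp
qed

lemma no_ties: "AE \<omega> in M. inj_on (\<lambda>i. Ys i \<omega>) {..<n}"
proof -
  have tie: "AE \<omega> in M. Ys i \<omega> \<noteq> Ys j \<omega>" if "i \<noteq> j" for i j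
  proof -
    have ind: "indep_var borel (Ys i) borel (Ys j)"
    proof -
      have "indep_var borel ((\<lambda>f. f i) \<circ> (\<lambda>\<omega>. restrict (\<lambda>k. Ys k \<omega>) {i}))
          borel ((\<lambda>f. f j) \<circ> (\<lambda>\<omega>. restrict (\<lambda>k. Ys k \<omega>) {j}))"
        using that by (intro indep_var_compose[OF indep_var_restrict[OF indep_Ys[of UNIV]]]) auto
      then show ?thesis by (simp add: comp_def)
    qed
    interpret D: prob_space "distr M borel (Ys i)" by (rule prob_space_distr) simp
    interpret D': prob_space "distr M borel (Ys j)" by (rule prob_space_distr) simp
    interpret P: pair_prob_space "distr M borel (Ys i)" "distr M borel (Ys j)" ..
    have "AE t in distr M borel (Ys i). AE s in distr M borel (Ys j). t \<noteq> s"
    proof (rule AE_I2)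
      fix t
      have "prob {\<omega>\<in>space M. Ys j \<omega> \<in> {t}} = 0"
        using same_law_Y[of "{t}" j] no_atoms[of t] by simp
      then have "{\<omega>\<in>space M. Ys j \<omega> \<in> {t}} \<in> null_sets M"
        by (intro null_setsI) (auto simp: emeasure_eq_measure)
      from AE_not_in[OF this] have "AE \<omega> in M. t \<noteq> Ys j \<omega>"
        using AE_space by eventually_elim auto
      then show "AE s in distr M borel (Ys j). t \<noteq> s"
        by (subst AE_distr_iff) auto
    qed
    moreover have meas: "{z \<in> space (distr M borel (Ys i) \<Otimes>\<^sub>M distr M borel (Ys j)). fst z \<noteq> snd z}
        \<in> sets (distr M borel (Ys i) \<Otimes>\<^sub>M distr M borel (Ys j))"
      by measurable
    ultimately have "AE z in distr M borel (Ys i) \<Otimes>\<^sub>M distr M borel (Ys j). fst z \<noteq> snd z"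
      by (intro P.AE_pair_measure[OF meas]) simp
    then have "AE z in distr M (borel \<Otimes>\<^sub>M borel) (\<lambda>\<omega>. (Ys i \<omega>, Ys j \<omega>)). fst z \<noteq> snd z"
      using conjunct2[OF conjunct2[OF iffD1[OF indep_var_distribution_eq ind]]] by (simp only:)
    then show ?thesis
      by (subst (asm) AE_distr_iff) auto
  qed
  have "AE \<omega> in M. \<forall>i\<in>{..<n}. \<forall>j\<in>{..<n}. i \<noteq> j \<longrightarrow> Ys i \<omega> \<noteq> Ys j \<omega>"
    using tie by (simp add: AE_ball_countable)
  then show ?thesis
    by eventually_elim (auto simp: inj_on_def)
qed

lemma sum_norm_sq:
  "integrable M (\<lambda>\<omega>. \<Sum>i<n. (norm (Xs i \<omega>))\<^sup>2)"
  "expectation (\<lambda>\<omega>. \<Sum>i<n. (norm (Xs i \<omega>))\<^sup>2) = real n * expectation (\<lambda>\<omega>. (norm (X \<omega>))\<^sup>2)"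
proof -
  have "integrable law (\<lambda>z. (norm (fst z))\<^sup>2)"
    using second_moment by (subst integrable_distr_eq) auto
  then have int: "integrable M (\<lambda>\<omega>. (norm (Xs i \<omega>))\<^sup>2)" for i
    unfolding same_law[of i, symmetric] by (subst (asm) integrable_distr_eq) auto
  have "(\<integral>z. (norm (fst z))\<^sup>2 \<partial>law) = expectation (\<lambda>\<omega>. (norm (X \<omega>))\<^sup>2)"
    by (subst integral_distr) auto
  then have eq: "expectation (\<lambda>\<omega>. (norm (Xs i \<omega>))\<^sup>2) = expectation (\<lambda>\<omega>. (norm (X \<omega>))\<^sup>2)" for i
    unfolding same_law[of i, symmetric] by (subst (asm) integral_distr) auto
  show "integrable M (\<lambda>\<omega>. \<Sum>i<n. (norm (Xs i \<omega>))\<^sup>2)"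
    using int by simp
  show "expectation (\<lambda>\<omega>. \<Sum>i<n. (norm (Xs i \<omega>))\<^sup>2) = real n * expectation (\<lambda>\<omega>. (norm (X \<omega>))\<^sup>2)"
    using int eq by (subst Bochner_Integration.integral_sum) auto
qed

lemma prob_sum_norm_sq_ge:
  assumes "n > 0" "B > 0"
  shows "prob {\<omega>\<in>space M. real n * B \<le> (\<Sum>i<n. (norm (Xs i \<omega>))\<^sup>2)} \<le> expectation (\<lambda>\<omega>. (norm (X \<omega>))\<^sup>2) / B"
proof -
  have "prob {\<omega>\<in>space M. real n * B \<le> (\<Sum>i<n. (norm (Xs i \<omega>))\<^sup>2)}
      \<le> expectation (\<lambda>\<omega>. \<Sum>i<n. (norm (Xs i \<omega>))\<^sup>2) / (real n * B)"
    using assms by (intro integral_Markov_inequality_measure[of _ _ "{}"] sum_norm_sq) (auto simp: sum_nonneg)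
  then show ?thesis
    using assms by (simp add: sum_norm_sq)
qed

definition slice_sum :: "nat \<Rightarrow> nat \<Rightarrow> nat \<Rightarrow> 'a \<Rightarrow> 'h" where
  "slice_sum H c h \<omega> = (\<Sum>k<H * c. residual (slice_cut (\<lambda>i. Ys i \<omega>) H c (h - 1)) (slice_cut (\<lambda>i. Ys i \<omega>) H c h) (Xs k \<omega>, Ys k \<omega>))"

lemma prob_slice_sum_ge:
  assumes "H > 0" "c > 0" "B > 0"
  shows "prob {\<omega>\<in>space M. real (H * c) * B \<le> (norm (slice_sum H c h \<omega>))\<^sup>2} \<le> expectation (\<lambda>\<omega>. (norm (X \<omega>))\<^sup>2) / B"
proof -
  have n: "H * c > 0" using assms by simp
  have S: "integrable M (\<lambda>\<omega>. (norm (slice_sum H c h \<omega>))\<^sup>2)"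
    "expectation (\<lambda>\<omega>. (norm (slice_sum H c h \<omega>))\<^sup>2) \<le> real (H * c) * expectation (\<lambda>\<omega>. (norm (X \<omega>))\<^sup>2)"
    unfolding slice_sum_def slice_cut_def by (rule second_moment_slice_sum[OF n])+
  have "prob {\<omega>\<in>space M. real (H * c) * B \<le> (norm (slice_sum H c h \<omega>))\<^sup>2}
      \<le> expectation (\<lambda>\<omega>. (norm (slice_sum H c h \<omega>))\<^sup>2) / (real (H * c) * B)"
    using assms by (intro integral_Markov_inequality_measure[of _ _ "{}"] S) auto
  also have "\<dots> \<le> real (H * c) * expectation (\<lambda>\<omega>. (norm (X \<omega>))\<^sup>2) / (real (H * c) * B)"
    using assms by (intro divide_right_mono S) auto
  also have "\<dots> = expectation (\<lambda>\<omega>. (norm (X \<omega>))\<^sup>2) / B"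
    using n by simp
  finally show ?thesis .
qed

text \<open>The random variable that dominates the distance of the two sliced covariances in operator norm. In
  contrast to the operator norm itself it is evidently measurable.\<close>

definition mean_gap :: "nat \<Rightarrow> nat \<Rightarrow> 'a \<Rightarrow> real" where
  "mean_gap H c \<omega> = 1 / real H * (\<Sum>h=1..H.
     norm (slice_sample_mean (\<lambda>i. Xs i \<omega>) (\<lambda>i. Ys i \<omega>) H c h - slab_mean (slice_cut (\<lambda>i. Ys i \<omega>) H c (h - 1)) (slice_cut (\<lambda>i. Ys i \<omega>) H c h)) *
     (norm (slice_sample_mean (\<lambda>i. Xs i \<omega>) (\<lambda>i. Ys i \<omega>) H c h) + norm (slab_mean (slice_cut (\<lambda>i. Ys i \<omega>) H c (h - 1)) (slice_cut (\<lambda>i. Ys i \<omega>) H c h))))"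

lemma measurable_slice_sample_mean:
  assumes "1 \<le> h" "h \<le> H"
  shows "(\<lambda>\<omega>. slice_sample_mean (\<lambda>i. Xs i \<omega>) (\<lambda>i. Ys i \<omega>) H c h) \<in> borel_measurable M"
  unfolding slice_sample_mean_eq
  using block_subset[OF assms, of c]
  by (intro borel_measurable_scaleR borel_measurable_const borel_measurable_sum measurable_sort_key_nth[where v = Xs]) auto

lemma measurable_mean_gap: "mean_gap H c \<in> borel_measurable M"
proof -
  have "(\<lambda>\<omega>. norm (slice_sample_mean (\<lambda>i. Xs i \<omega>) (\<lambda>i. Ys i \<omega>) H c h - slab_mean (slice_cut (\<lambda>i. Ys i \<omega>) H c (h - 1)) (slice_cut (\<lambda>i. Ys i \<omega>) H c h)) *
      (norm (slice_sample_mean (\<lambda>i. Xs i \<omega>) (\<lambda>i. Ys i \<omega>) H c h) + norm (slab_mean (slice_cut (\<lambda>i. Ys i \<omega>) H c (h - 1)) (slice_cut (\<lambda>i. Ys i \<omega>) H c h))))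
      \<in> borel_measurable M" if "h \<in> {1..H}" for h
  proof -
    have [measurable]: "(\<lambda>\<omega>. slice_sample_mean (\<lambda>i. Xs i \<omega>) (\<lambda>i. Ys i \<omega>) H c h) \<in> borel_measurable M"
      using that by (intro measurable_slice_sample_mean) auto
    show ?thesis by measurable
  qed
  then show ?thesis
    unfolding mean_gap_def[abs_def]
    by (rule borel_measurable_times[OF borel_measurable_const borel_measurable_sum])
qed

lemma onorm_Gamma_hat_Gamma_tilde_le:
  assumes H: "H \<ge> 2" and c: "c > 0"
  shows "\<bar>onorm (\<lambda>u. Gamma_hat (\<lambda>i. Xs i \<omega>) (\<lambda>i. Ys i \<omega>) H c u - Gamma_tilde M X Y (\<lambda>i. Ys i \<omega>) H c u)\<bar> \<le> mean_gap H c \<omega>"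
proof (rule abs_onorm_le)
  show "bounded_linear (\<lambda>u. Gamma_hat (\<lambda>i. Xs i \<omega>) (\<lambda>i. Ys i \<omega>) H c u - Gamma_tilde M X Y (\<lambda>i. Ys i \<omega>) H c u)"
    by (intro bounded_linear_sub bounded_linear_Gamma_hat bounded_linear_Gamma_tilde)
  show "0 \<le> mean_gap H c \<omega>"
    unfolding mean_gap_def by (intro mult_nonneg_nonneg sum_nonneg add_nonneg_nonneg) auto
  fix u
  define x where "x = (\<lambda>h. slice_sample_mean (\<lambda>i. Xs i \<omega>) (\<lambda>i. Ys i \<omega>) H c h)"
  define \<mu> where "\<mu> = (\<lambda>h. slab_mean (slice_cut (\<lambda>i. Ys i \<omega>) H c (h - 1)) (slice_cut (\<lambda>i. Ys i \<omega>) H c h))"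
  have "Gamma_tilde M X Y (\<lambda>i. Ys i \<omega>) H c u = (1 / real H) *\<^sub>R (\<Sum>h=1..H. tensor (\<mu> h) (\<mu> h) u)"
    unfolding Gamma_tilde_def \<mu>_def using H c by (simp add: slice_population_mean_eq)
  then have "Gamma_hat (\<lambda>i. Xs i \<omega>) (\<lambda>i. Ys i \<omega>) H c u - Gamma_tilde M X Y (\<lambda>i. Ys i \<omega>) H c u =
      (1 / real H) *\<^sub>R (\<Sum>h=1..H. tensor (x h) (x h) u - tensor (\<mu> h) (\<mu> h) u)"
    by (simp add: Gamma_hat_def x_def sum_subtractf scaleR_diff_right)
  also have "norm \<dots> \<le> 1 / real H * (\<Sum>h=1..H. norm (tensor (x h) (x h) u - tensor (\<mu> h) (\<mu> h) u))"
    by (simp add: norm_sum divide_right_mono)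
  also have "\<dots> \<le> 1 / real H * (\<Sum>h=1..H. norm (x h - \<mu> h) * (norm (x h) + norm (\<mu> h)) * norm u)"
    by (intro mult_left_mono sum_mono norm_tensor_diff_le) simp
  also have "\<dots> = mean_gap H c \<omega> * norm u"
    unfolding mean_gap_def x_def \<mu>_def by (simp add: sum_distrib_right)
  finally show "norm (Gamma_hat (\<lambda>i. Xs i \<omega>) (\<lambda>i. Ys i \<omega>) H c u - Gamma_tilde M X Y (\<lambda>i. Ys i \<omega>) H c u)
      \<le> mean_gap H c \<omega> * norm u" .
qed

text \<open>On this event the population means of the slices are bounded by \<open>e\<close> because each slice has probability
  at least \<open>1 / (2 H)\<close>, the sample means by \<open>sqrt (H B)\<close>, and their differences by a multiple of
  \<open>sqrt n / c = H / sqrt n\<close>.\<close>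

lemma mean_gap_le:
  fixes B :: real and H c :: nat and \<omega> :: 'a
  defines "e \<equiv> 2 * real H * expectation (\<lambda>\<omega>. norm (X \<omega>))"
  assumes H: "H \<ge> 2" and c: "c > 0" and B: "B > 0"
    and inj: "inj_on (\<lambda>i. Ys i \<omega>) {..<H * c}"
    and bal: "balanced (1 / 2) (\<lambda>i. Ys i \<omega>) H c"
    and Q: "(\<Sum>i<H * c. (norm (Xs i \<omega>))\<^sup>2) \<le> real (H * c) * B"
    and S: "\<And>h. h \<in> {1..H} \<Longrightarrow> (norm (slice_sum H c h \<omega>))\<^sup>2 \<le> real (H * c) * B"
  shows "mean_gap H c \<omega> \<le> (real H * (2 * sqrt B + e)) * (sqrt (real H * B) + e) * sqrt (1 / real (H * c))"
proof -
  define n where "n = H * c"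
  have n: "n > 0" using H c by (simp add: n_def)
  then have sn: "1 \<le> sqrt (real n)" by simp
  define x where "x = (\<lambda>h. slice_sample_mean (\<lambda>i. Xs i \<omega>) (\<lambda>i. Ys i \<omega>) H c h)"
  define \<mu> where "\<mu> = (\<lambda>h. slab_mean (slice_cut (\<lambda>i. Ys i \<omega>) H c (h - 1)) (slice_cut (\<lambda>i. Ys i \<omega>) H c h))"
  have e: "0 \<le> e" unfolding e_def by simp
  have \<mu>: "norm (\<mu> h) \<le> e" if h: "h \<in> {1..H}" for h
  proof -
    let ?p = "prob (slab (slice_cut (\<lambda>i. Ys i \<omega>) H c (h - 1)) (slice_cut (\<lambda>i. Ys i \<omega>) H c h))"
    have p: "(1 - 1 / 2) / real H \<le> ?p"
      using bal h by (auto simp: balanced_def)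
    have "norm (\<mu> h) \<le> expectation (\<lambda>\<omega>. norm (X \<omega>)) / ?p"
      unfolding \<mu>_def by (rule norm_slab_mean_le)
    also have "\<dots> \<le> expectation (\<lambda>\<omega>. norm (X \<omega>)) / ((1 - 1 / 2) / real H)"
      using p H by (intro divide_left_mono mult_pos_pos) (auto intro: less_le_trans[rotated])
    also have "\<dots> = e"
      by (simp add: e_def)
    finally show ?thesis .
  qed
  have x: "norm (x h) \<le> sqrt (real H * B)" if h: "h \<in> {1..H}" for h
  proof (rule real_le_rsqrt)
    have "(norm (x h))\<^sup>2 \<le> (\<Sum>i<H * c. (norm (Xs i \<omega>))\<^sup>2) / real c"
      unfolding x_def using h c by (intro norm_slice_sample_mean_sq_le) auto
    also have "\<dots> \<le> (real (H * c) * B) / real c"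
      using Q by (intro divide_right_mono) auto
    finally show "(norm (x h))\<^sup>2 \<le> real H * B"
      using c by simp
  qed
  have gap: "norm (x h - \<mu> h) \<le> real H * (2 * sqrt B + e) * sqrt (1 / real n)" if h: "h \<in> {1..H}" for h
  proof -
    have "real c * norm (x h - \<mu> h) \<le> norm (slice_sum H c h \<omega>) + sqrt (\<Sum>i<H * c. (norm (Xs i \<omega>))\<^sup>2) + norm (\<mu> h)"
      unfolding x_def \<mu>_def slice_sum_def using h H c inj by (intro slice_mean_deviation) auto
    also have "\<dots> \<le> sqrt (real n * B) + sqrt (real n * B) + e"
      using S[OF h] Q \<mu>[OF h] unfolding n_def
      by (intro add_mono real_le_rsqrt real_sqrt_le_mono) auto
    also have "\<dots> \<le> sqrt (real n) * (2 * sqrt B + e)"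
      using mult_right_mono[OF sn e] by (simp add: real_sqrt_mult algebra_simps)
    finally have "real c * norm (x h - \<mu> h) \<le> sqrt (real n) * (2 * sqrt B + e)" .
    then have "real n * norm (x h - \<mu> h) \<le> real H * (sqrt (real n) * (2 * sqrt B + e))"
      unfolding n_def using mult_left_mono[of _ _ "real H"] by (simp add: mult.assoc)
    also have "\<dots> = real n * (real H * (2 * sqrt B + e) * sqrt (1 / real n))"
      using n by (simp add: real_sqrt_divide field_simps)
    finally show ?thesis
      using n by simp
  qed
  have "mean_gap H c \<omega> = 1 / real H * (\<Sum>h=1..H. norm (x h - \<mu> h) * (norm (x h) + norm (\<mu> h)))"
    by (simp add: mean_gap_def x_def \<mu>_def)
  also have "\<dots> \<le> 1 / real H * (\<Sum>h=1..H. (real H * (2 * sqrt B + e) * sqrt (1 / real n)) * (sqrt (real H * B) + e))"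
    using e B x \<mu> gap
    by (intro mult_left_mono sum_mono mult_mono add_mono) auto
  also have "\<dots> = (real H * (2 * sqrt B + e)) * (sqrt (real H * B) + e) * sqrt (1 / real n)"
    using H by simp
  finally show ?thesis
    by (simp add: n_def)
qed

text \<open>The probability that the hypotheses of the previous lemma fail: an unbalanced slice (tolerance
  \<open>1 / 2\<close> and \<open>8\<close> cells per slice), a tie, or a violation of one of the \<open>H + 1\<close> second moment bounds.\<close>

lemma mean_gap_tail:
  fixes H c :: nat and B :: real
  defines "e \<equiv> 2 * real H * expectation (\<lambda>\<omega>. norm (X \<omega>))"
  defines "C \<equiv> (real H * (2 * sqrt B + e)) * (sqrt (real H * B) + e) + 1"
  assumes H: "H \<ge> 2" and c: "c > 0" and B: "B > 0"
  shows "prob {\<omega>\<in>space M. C * sqrt (1 / real (H * c)) \<le> mean_gap H c \<omega>}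
    \<le> 2 * (8 * real H + 1) * exp (- (real c / 64)) + (real H + 1) * expectation (\<lambda>\<omega>. (norm (X \<omega>))\<^sup>2) / B"
proof -
  define n where "n = H * c"
  have n: "n > 0" using H c by (simp add: n_def)
  define \<sigma>2 where "\<sigma>2 = expectation (\<lambda>\<omega>. (norm (X \<omega>))\<^sup>2)"
  define E0 where "E0 = {\<omega>\<in>space M. \<not> balanced (1 / 2) (\<lambda>i. Ys i \<omega>) H c}"
  define E1 where "E1 = {\<omega>\<in>space M. real n * B \<le> (\<Sum>i<n. (norm (Xs i \<omega>))\<^sup>2)}"
  define E2 where "E2 = (\<lambda>h. {\<omega>\<in>space M. real n * B \<le> (norm (slice_sum H c h \<omega>))\<^sup>2})"
  have [measurable]: "E0 \<in> events"
    unfolding E0_def balanced_def by measurable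
  have [measurable]: "E1 \<in> events" unfolding E1_def by measurable
  have [measurable]: "E2 h \<in> events" for h
    unfolding E2_def slice_sum_def by measurable
  obtain N where N: "{\<omega>\<in>space M. \<not> inj_on (\<lambda>i. Ys i \<omega>) {..<n}} \<subseteq> N" "emeasure M N = 0" "N \<in> events"
    using no_ties[of n] by (rule AE_E)
  have "{\<omega>\<in>space M. C * sqrt (1 / real (H * c)) \<le> mean_gap H c \<omega>} \<subseteq> E0 \<union> (E1 \<union> (N \<union> (\<Union>h\<in>{1..H}. E2 h)))"
  proof (rule subsetI, rule ccontr)
    fix \<omega> assume \<omega>: "\<omega> \<in> {\<omega>\<in>space M. C * sqrt (1 / real (H * c)) \<le> mean_gap H c \<omega>}"
      and "\<omega> \<notin> E0 \<union> (E1 \<union> (N \<union> (\<Union>h\<in>{1..H}. E2 h)))"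
    then have out: "\<omega> \<in> space M" "\<omega> \<notin> E0" "\<omega> \<notin> E1" "\<omega> \<notin> N" "\<And>h. h \<in> {1..H} \<Longrightarrow> \<omega> \<notin> E2 h"
      by auto
    have "mean_gap H c \<omega> \<le> (C - 1) * sqrt (1 / real (H * c))"
      unfolding C_def e_def add_diff_cancel_right'
    proof (rule mean_gap_le[OF H c B])
      show "inj_on (\<lambda>i. Ys i \<omega>) {..<H * c}" "balanced (1 / 2) (\<lambda>i. Ys i \<omega>) H c"
        using out N(1) by (auto simp: E0_def n_def)
      show "(\<Sum>i<H * c. (norm (Xs i \<omega>))\<^sup>2) \<le> real (H * c) * B"
        using out(1,3) by (simp add: E1_def n_def)
      show "(norm (slice_sum H c h \<omega>))\<^sup>2 \<le> real (H * c) * B" if "h \<in> {1..H}" for h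
        using out(1) out(5)[OF that] by (simp add: E2_def n_def)
    qed
    also have "\<dots> < C * sqrt (1 / real (H * c))"
      using n by (intro mult_strict_right_mono) (auto simp: n_def)
    finally show False using \<omega> by simp
  qed
  then have "prob {\<omega>\<in>space M. C * sqrt (1 / real (H * c)) \<le> mean_gap H c \<omega>} \<le> prob (E0 \<union> (E1 \<union> (N \<union> (\<Union>h\<in>{1..H}. E2 h))))"
    using N(3) by (intro measure_mono_outer) auto
  also have "\<dots> \<le> prob E0 + (prob E1 + (prob N + prob (\<Union>h\<in>{1..H}. E2 h)))"
    using N(3) by (intro order_trans[OF measure_Un_le] add_left_mono) auto
  also have "\<dots> \<le> 2 * (8 * real H + 1) * exp (- (real c / 64)) + (\<sigma>2 / B + (0 + real H * (\<sigma>2 / B)))"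
  proof (intro add_mono)
    show "prob E0 \<le> 2 * (8 * real H + 1) * exp (- (real c / 64))"
      unfolding E0_def using prob_not_balanced[of "1 / 2" H c 8] H c
      by (simp add: power2_eq_square mult.commute)
    show "prob E1 \<le> \<sigma>2 / B"
      unfolding E1_def \<sigma>2_def by (rule prob_sum_norm_sq_ge[OF n B])
    show "prob N \<le> 0" using N(2) by (simp add: measure_def)
    have "prob (\<Union>h\<in>{1..H}. E2 h) \<le> (\<Sum>h\<in>{1..H}. prob (E2 h))"
      by (rule finite_measure_subadditive_finite) auto
    also have "\<dots> \<le> (\<Sum>h\<in>{1..H}. \<sigma>2 / B)"
      unfolding E2_def \<sigma>2_def n_def using H c B by (intro sum_mono prob_slice_sum_ge) auto
    finally show "prob (\<Union>h\<in>{1..H}. E2 h) \<le> real H * (\<sigma>2 / B)" by simp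
  qed
  also have "\<dots> = 2 * (8 * real H + 1) * exp (- (real c / 64)) + (real H + 1) * \<sigma>2 / B"
    by (simp add: algebra_simps add_divide_distrib)
  finally show ?thesis unfolding \<sigma>2_def .
qed

lemma bigO_Gamma_hat_Gamma_tilde:
  assumes H: "H \<ge> 2" and I: "\<And>c. c \<in> I \<Longrightarrow> 0 < c"
  shows "bigO_prob M I
    (\<lambda>c \<omega>. onorm (\<lambda>u. Gamma_hat (\<lambda>i. Xs i \<omega>) (\<lambda>i. Ys i \<omega>) H c u - Gamma_tilde M X Y (\<lambda>i. Ys i \<omega>) H c u))
    (\<lambda>c. sqrt (1 / real (H * c)))"
proof (rule bigO_prob_if_eventually_le[where V = "mean_gap H"])
  fix c assume c: "c \<in> I"
  show "0 < sqrt (1 / real (H * c))" using H I[OF c] by simp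
  show "mean_gap H c \<in> borel_measurable M" by (rule measurable_mean_gap)
  show "\<bar>onorm (\<lambda>u. Gamma_hat (\<lambda>i. Xs i \<omega>) (\<lambda>i. Ys i \<omega>) H c u - Gamma_tilde M X Y (\<lambda>i. Ys i \<omega>) H c u)\<bar> \<le> mean_gap H c \<omega>" for \<omega>
    by (rule onorm_Gamma_hat_Gamma_tilde_le[OF H I[OF c]])
next
  fix \<epsilon> :: real assume \<epsilon>: "0 < \<epsilon>"
  define \<sigma>2 where "\<sigma>2 = expectation (\<lambda>\<omega>. (norm (X \<omega>))\<^sup>2)"
  have \<sigma>2: "0 \<le> \<sigma>2" by (simp add: \<sigma>2_def)
  define B where "B = 2 * (real H + 1) * \<sigma>2 / \<epsilon> + 1"
  have B: "B > 0" using \<sigma>2 \<epsilon> by (auto simp: B_def intro!: add_nonneg_pos)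
  have \<sigma>2_B: "(real H + 1) * \<sigma>2 / B \<le> \<epsilon> / 2"
  proof -
    have "(real H + 1) * \<sigma>2 \<le> \<epsilon> / 2 * B"
      using \<epsilon> by (simp add: B_def field_simps)
    then show ?thesis using B by (simp add: pos_divide_le_eq)
  qed
  have lim: "(\<lambda>c. 2 * (8 * real H + 1) * exp (- (real c / 64))) \<longlonglongrightarrow> 0"
  proof -
    have "exp (- (real c / 64)) = exp (- (1 / 64)) ^ c" for c
      by (simp add: exp_of_nat_mult[symmetric])
    moreover have "(\<lambda>c. exp (- (1 / 64)) ^ c :: real) \<longlonglongrightarrow> 0"
      by (rule LIMSEQ_power_zero) simp
    ultimately show ?thesis
      by (simp only:) (rule tendsto_mult_right_zero)
  qed
  have "eventually (\<lambda>c. 2 * (8 * real H + 1) * exp (- (real c / 64)) < \<epsilon> / 2) sequentially"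
    by (rule order_tendstoD(2)[OF lim]) (use \<epsilon> in simp)
  then obtain c0 where c0: "\<And>c. c0 \<le> c \<Longrightarrow> 2 * (8 * real H + 1) * exp (- (real c / 64)) < \<epsilon> / 2"
    by (auto simp: eventually_sequentially)
  define C where "C = real H * (2 * sqrt B + 2 * real H * expectation (\<lambda>\<omega>. norm (X \<omega>))) *
      (sqrt (real H * B) + 2 * real H * expectation (\<lambda>\<omega>. norm (X \<omega>))) + 1"
  have "prob {\<omega>\<in>space M. C * sqrt (1 / real (H * c)) \<le> mean_gap H c \<omega>} \<le> \<epsilon>" if "c \<in> I" "c0 \<le> c" for c
    using mean_gap_tail[OF H I[OF that(1)] B] c0[OF that(2)] \<sigma>2_B unfolding C_def \<sigma>2_def by linarith
  then show "\<exists>C c0. \<forall>c\<in>I. c0 \<le> c \<longrightarrow> prob {\<omega>\<in>space M. C * sqrt (1 / real (H * c)) \<le> mean_gap H c \<omega>} \<le> \<epsilon>"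
    by blast
qed

end

section \<open>Rates and tail probabilities\<close>

context sliced_curve
begin

text \<open>Since \<open>H\<close> and \<open>\<tau>\<close> are fixed, the rate is bounded below by \<open>1 / \<tau>\<close>, and it is enough that the difference is
  bounded in probability; this follows from Markov's inequality for the average of \<open>\<parallel>X\<^sub>i\<parallel>\<^sup>2\<close>.\<close>

lemma bigO_Gamma_hat_cov_m:
  assumes H: "H > 0" and \<tau>: "\<tau> > 0" and I: "\<And>c. c \<in> I \<Longrightarrow> 0 < c"
  shows "bigO_prob M I
    (\<lambda>c \<omega>. onorm (\<lambda>u. Gamma_hat (\<lambda>i. Xs i \<omega>) (\<lambda>i. Ys i \<omega>) H c u - cov_operator M (\<lambda>\<omega>. m (Y \<omega>)) u))
    (\<lambda>c. 1 / \<tau> + sqrt (1 / real (H * c)))"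
  unfolding bigO_prob_def
proof (intro allI impI)
  fix \<epsilon> :: real assume \<epsilon>: "0 < \<epsilon>"
  define G where "G = cov_operator M (\<lambda>\<omega>. m (Y \<omega>))"
  have G: "bounded_linear G" unfolding G_def by (rule bounded_linear_cov_m)
  define \<sigma>2 where "\<sigma>2 = expectation (\<lambda>\<omega>. (norm (X \<omega>))\<^sup>2)"
  have \<sigma>2: "0 \<le> \<sigma>2" by (simp add: \<sigma>2_def)
  define B where "B = \<sigma>2 / \<epsilon> + 1"
  have B: "B > 0" using \<sigma>2 \<epsilon> by (auto simp: B_def intro!: add_nonneg_pos)
  have \<sigma>2_B: "\<sigma>2 / B \<le> \<epsilon>"
    using B \<epsilon> by (simp add: pos_divide_le_eq B_def field_simps)
  define C where "C = \<tau> * (real H * B + onorm G)"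
  have G0: "0 \<le> onorm G" by (rule onorm_pos_le[OF G])
  have C: "C > 0" unfolding C_def using \<tau> H B G0 by (intro mult_pos_pos add_pos_nonneg) auto
  have "prob {\<omega>\<in>space M. C * (1 / \<tau> + sqrt (1 / real (H * c))) \<le>
      \<bar>onorm (\<lambda>u. Gamma_hat (\<lambda>i. Xs i \<omega>) (\<lambda>i. Ys i \<omega>) H c u - G u)\<bar>} \<le> \<epsilon>" if "c \<in> I" for c
  proof -
    have c: "c > 0" using I that by simp
    have n: "H * c > 0" using H c by simp
    have "prob {\<omega>\<in>space M. C * (1 / \<tau> + sqrt (1 / real (H * c))) \<le>
        \<bar>onorm (\<lambda>u. Gamma_hat (\<lambda>i. Xs i \<omega>) (\<lambda>i. Ys i \<omega>) H c u - G u)\<bar>}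
      \<le> prob {\<omega>\<in>space M. real (H * c) * B \<le> (\<Sum>i<H * c. (norm (Xs i \<omega>))\<^sup>2)}"
    proof (rule measure_mono_outer, clarify)
      fix \<omega> assume "C * (1 / \<tau> + sqrt (1 / real (H * c))) \<le>
        \<bar>onorm (\<lambda>u. Gamma_hat (\<lambda>i. Xs i \<omega>) (\<lambda>i. Ys i \<omega>) H c u - G u)\<bar>"
      also have "\<dots> \<le> (\<Sum>i<H * c. (norm (Xs i \<omega>))\<^sup>2) / real c + onorm G"
      proof (rule abs_onorm_le)
        show "bounded_linear (\<lambda>u. Gamma_hat (\<lambda>i. Xs i \<omega>) (\<lambda>i. Ys i \<omega>) H c u - G u)"
          by (intro bounded_linear_sub bounded_linear_Gamma_hat G)
        show "0 \<le> (\<Sum>i<H * c. (norm (Xs i \<omega>))\<^sup>2) / real c + onorm G"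
          using G0 by (intro add_nonneg_nonneg divide_nonneg_nonneg sum_nonneg) auto
        show "norm (Gamma_hat (\<lambda>i. Xs i \<omega>) (\<lambda>i. Ys i \<omega>) H c u - G u)
            \<le> ((\<Sum>i<H * c. (norm (Xs i \<omega>))\<^sup>2) / real c + onorm G) * norm u" for u
          unfolding distrib_right
          by (rule order_trans[OF norm_triangle_ineq4 add_mono[OF Gamma_hat_le[OF H c] onorm[OF G]]])
      qed
      finally have "C * (1 / \<tau> + sqrt (1 / real (H * c))) \<le> (\<Sum>i<H * c. (norm (Xs i \<omega>))\<^sup>2) / real c + onorm G" .
      moreover have "real H * B + onorm G = C * (1 / \<tau>)"
        using \<tau> by (simp add: C_def)
      moreover have "C * (1 / \<tau>) \<le> C * (1 / \<tau> + sqrt (1 / real (H * c)))"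
        using C by (intro mult_left_mono) auto
      ultimately have "real H * B \<le> (\<Sum>i<H * c. (norm (Xs i \<omega>))\<^sup>2) / real c"
        by linarith
      then show "real (H * c) * B \<le> (\<Sum>i<H * c. (norm (Xs i \<omega>))\<^sup>2)"
        using c by (simp add: pos_le_divide_eq mult_ac)
    qed measurable
    also have "\<dots> \<le> \<sigma>2 / B"
      unfolding \<sigma>2_def by (rule prob_sum_norm_sq_ge[OF n B])
    finally show ?thesis using \<sigma>2_B by simp
  qed
  then show "\<exists>C>0. \<forall>c\<in>I. prob {\<omega>\<in>space M. C * (1 / \<tau> + sqrt (1 / real (H * c))) \<le>
      \<bar>onorm (\<lambda>u. Gamma_hat (\<lambda>i. Xs i \<omega>) (\<lambda>i. Ys i \<omega>) H c u - cov_operator M (\<lambda>\<omega>. m (Y \<omega>)) u)\<bar>} \<le> \<epsilon>"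
    using C unfolding G_def by blast
qed

lemma prob_Gamma_tilde_near_cov_m:
  assumes wss: "weak_sliced_stable M \<gamma> K \<tau> m Y"
    and \<delta>: "0 < \<delta>" "\<delta> \<le> \<gamma>" "\<gamma> < 1" "\<delta> \<le> 1 / (2 * \<tau>)" and r: "real r \<ge> 4 / \<delta>"
    and H: "H \<ge> K" "H \<ge> 2" and c: "c > 0"
  shows "1 - 2 * (real (H * r) + 1) * exp (- (real c * \<delta>\<^sup>2 / 16)) \<le>
    prob {\<omega>\<in>space M. \<forall>u. norm u = 1 \<longrightarrow>
      \<bar>inner (Gamma_tilde M X Y (\<lambda>i. Ys i \<omega>) H c u - cov_operator M (\<lambda>\<omega>. m (Y \<omega>)) u) u\<bar>
        \<le> 3 / \<tau> * inner (cov_operator M (\<lambda>\<omega>. m (Y \<omega>)) u) u}" (is "_ \<le> prob ?E")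
proof -
  have E: "?E \<in> events"
    by (rule Gamma_tilde_near_cov_m_event[OF H(2) c])
  have [measurable]: "{\<omega>\<in>space M. \<not> balanced \<delta> (\<lambda>i. Ys i \<omega>) H c} \<in> events"
    unfolding balanced_def by measurable
  have "1 - prob ?E = prob (space M - ?E)"
    using E by (simp add: prob_compl)
  also have "\<dots> \<le> prob {\<omega>\<in>space M. \<not> balanced \<delta> (\<lambda>i. Ys i \<omega>) H c}"
    using Gamma_tilde_near_cov_m[OF wss _ \<delta> H c] by (intro finite_measure_mono) auto
  also have "\<dots> \<le> 2 * (real (H * r) + 1) * exp (- (real c * \<delta>\<^sup>2 / 16))"
    using \<delta> H c r by (intro prob_not_balanced) auto
  finally show ?thesis by simp
qed

text \<open>The exponent on the left is of order \<open>\<delta>\<^sup>2 n / H\<close>, the one on the right of order \<open>\<gamma>\<^sup>2 n / H\<^sup>2\<close>. For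
  \<open>H \<ge> \<gamma>\<^sup>2 / \<delta>\<^sup>2\<close> the additional factor \<open>H\<close> pays for the smaller tolerance.\<close>

lemma grid_bound_le:
  fixes \<delta> \<gamma> :: real and H c r :: nat
  assumes \<delta>: "0 < \<delta>" and H: "\<gamma>\<^sup>2 / \<delta>\<^sup>2 \<le> real H" "H > 0" and c: "c > 0"
  shows "2 * (real (H * r) + 1) * exp (- (real c * \<delta>\<^sup>2 / 16)) \<le>
    2 * (real r + 1) * (real H)\<^sup>2 * sqrt (real (H * c) + 1) * exp (- (\<gamma>\<^sup>2 * (real (H * c) + 1)) / (32 * (real H)\<^sup>2))"
proof -
  have H1: "1 \<le> real H" using H(2) by simp
  have "1 \<le> H * c" using H(2) c by (simp add: Suc_le_eq)
  then have n1: "1 \<le> real (H * c)"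
    using of_nat_mono[of 1 "H * c", where 'a = real] by simp
  have "\<gamma>\<^sup>2 \<le> real H * \<delta>\<^sup>2"
    using H \<delta> by (simp add: pos_divide_le_eq)
  then have "\<gamma>\<^sup>2 * (real (H * c) + 1) \<le> (real H * \<delta>\<^sup>2) * (2 * real (H * c))"
    using n1 by (intro mult_mono) auto
  also have "\<dots> = (real c * \<delta>\<^sup>2 / 16) * (32 * (real H)\<^sup>2)"
    by (simp add: power2_eq_square)
  finally have "\<gamma>\<^sup>2 * (real (H * c) + 1) / (32 * (real H)\<^sup>2) \<le> real c * \<delta>\<^sup>2 / 16"
    using H(2) by (simp add: pos_divide_le_eq)
  then have exp: "exp (- (real c * \<delta>\<^sup>2 / 16)) \<le> exp (- (\<gamma>\<^sup>2 * (real (H * c) + 1)) / (32 * (real H)\<^sup>2))"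
    by simp
  have "real (H * r) + 1 \<le> real H * (real r + 1)"
    using H1 by (simp add: algebra_simps)
  also have "\<dots> \<le> (real H)\<^sup>2 * (real r + 1)"
    using H1 by (intro mult_right_mono) (auto simp: power2_eq_square)
  also have "\<dots> \<le> (real H)\<^sup>2 * (real r + 1) * sqrt (real (H * c) + 1)"
    using mult_left_mono[of 1 "sqrt (real (H * c) + 1)" "(real H)\<^sup>2 * (real r + 1)"] by simp
  finally have "2 * (real (H * r) + 1) \<le> 2 * ((real H)\<^sup>2 * (real r + 1) * sqrt (real (H * c) + 1))"
    by (rule mult_left_mono) simp
  also have "\<dots> = 2 * (real r + 1) * (real H)\<^sup>2 * sqrt (real (H * c) + 1)"
    by (simp only: mult_ac)
  finally show ?thesis
    using exp by (rule mult_mono) auto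
qed

end

section \<open>Convergence of the sliced covariances\<close>

theorem lemma2:
  fixes M :: "'a measure"
    and X :: "'a \<Rightarrow> 'h::{real_inner,banach,second_countable_topology}"
    and Y \<epsilon> :: "'a \<Rightarrow> real"
    and f :: "(real ^ 'd) \<times> real \<Rightarrow> real"
    and \<beta> :: "'d \<Rightarrow> 'h"
    and eigval :: "nat \<Rightarrow> real"
    and \<phi> :: "nat \<Rightarrow> 'h"
    and m :: "real \<Rightarrow> 'h"
    and Xs :: "nat \<Rightarrow> 'a \<Rightarrow> 'h"
    and Ys :: "nat \<Rightarrow> 'a \<Rightarrow> real"
    and K :: nat and \<tau> \<gamma> c\<^sub>1 :: real
  defines "\<Gamma> \<equiv> cov_operator M X"
    and "\<Gamma>\<^sub>e \<equiv> cov_operator M (\<lambda>\<omega>. m (Y \<omega>))"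
    and "\<Gamma>hat \<equiv> (\<lambda>H c \<omega>. Gamma_hat (\<lambda>i. Xs i \<omega>) (\<lambda>i. Ys i \<omega>) H c)"
    and "\<Gamma>tilde \<equiv> (\<lambda>H c \<omega>. Gamma_tilde M X Y (\<lambda>i. Ys i \<omega>) H c)"
  assumes "prob_space M"
    and X: "X \<in> borel_measurable M"
    and Y: "Y \<in> borel_measurable M"
    and eps: "\<epsilon> \<in> borel_measurable M"
    and f: "f \<in> borel_measurable borel"
    and model: "\<And>\<omega>. \<omega> \<in> space M \<Longrightarrow> Y \<omega> = f ((\<chi> i. inner (\<beta> i) (X \<omega>)), \<epsilon> \<omega>)"
    and noise: "prob_space.indep_set M {X -` A \<inter> space M |A. A \<in> sets borel}
                                       {\<epsilon> -` B \<inter> space M |B. B \<in> sets borel}"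
    and mean_zero: "(\<integral>\<omega>. X \<omega> \<partial>M) = 0"
    and fourth_moment: "integrable M (\<lambda>\<omega>. norm (X \<omega>) ^ 4)"
    and nonsingular: "inj \<Gamma>"
    and eigenbasis: "orthonormal_basis \<phi>" "\<And>i. \<Gamma> (\<phi> i) = eigval i *\<^sub>R \<phi> i"
    and eigenvalues: "decseq eigval" "\<And>i. eigval i > 0"
    and no_atoms: "\<And>y. measure M {\<omega>\<in>space M. Y \<omega> = y} = 0"
    and samples: "\<And>i. Xs i \<in> borel_measurable M" "\<And>i. Ys i \<in> borel_measurable M"
    and iid: "prob_space.indep_vars M (\<lambda>_. borel \<Otimes>\<^sub>M borel) (\<lambda>i \<omega>. (Xs i \<omega>, Ys i \<omega>)) UNIV"
      "\<And>i. distr M (borel \<Otimes>\<^sub>M borel) (\<lambda>\<omega>. (Xs i \<omega>, Ys i \<omega>)) =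
            distr M (borel \<Otimes>\<^sub>M borel) (\<lambda>\<omega>. (X \<omega>, Y \<omega>))"
    and gamma: "0 < \<gamma>" "\<gamma> < 1"
    and curve: "central_curve M X Y m"
    and WSSC: "weak_sliced_stable M \<gamma> K \<tau> m Y"
    and c1: "c\<^sub>1 > 0" "\<And>i. (\<integral>\<omega>. inner (X \<omega>) (\<phi> i) ^ 4 \<partial>M) / eigval i ^ 2 \<le> c\<^sub>1"
  shows "\<exists>C>0. \<exists>H\<^sub>0\<ge>K.
     (\<exists>N. \<forall>H>H\<^sub>0. CARD('d) \<le> H \<longrightarrow>
        (\<forall>n c. n = H * c \<and> n \<ge> N \<and> real n > 1 + 4 * real H / \<gamma> \<longrightarrow>
           measure M {\<omega>\<in>space M. \<forall>u. norm u = 1 \<longrightarrow>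
                        \<bar>inner (\<Gamma>tilde H c \<omega> u - \<Gamma>\<^sub>e u) u\<bar> \<le> 3 / \<tau> * inner (\<Gamma>\<^sub>e u) u}
           \<ge> 1 - C * real H ^ 2 * sqrt (real n + 1) * exp (- (\<gamma> ^ 2 * (real n + 1)) / (32 * real H ^ 2)))) \<and>
     (\<forall>H>H\<^sub>0. CARD('d) \<le> H \<longrightarrow>
        (\<exists>N. let I = {c. H * c \<ge> N \<and> real (H * c) > 1 + 4 * real H / \<gamma>} in
           bigO_prob M I (\<lambda>c \<omega>. onorm (\<lambda>u. \<Gamma>hat H c \<omega> u - \<Gamma>\<^sub>e u))
                         (\<lambda>c. 1 / \<tau> + sqrt (1 / real (H * c))) \<and>
           bigO_prob M I (\<lambda>c \<omega>. onorm (\<lambda>u. \<Gamma>hat H c \<omega> u - \<Gamma>tilde H c \<omega> u))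
                         (\<lambda>c. sqrt (1 / real (H * c)))))"
proof -
  interpret prob_space M by fact
  have [measurable]: "X \<in> borel_measurable M" by (rule X)
  have second_moment: "integrable M (\<lambda>\<omega>. (norm (X \<omega>))\<^sup>2)"
    by (rule square_integrable_imp_integrable) (use fourth_moment in simp_all)
  interpret sliced_curve M X Y Xs Ys m
    by unfold_locales (use X Y second_moment no_atoms samples iid mean_zero curve in auto)
  have \<tau>: "1 < \<tau>" using WSSC by (simp add: weak_sliced_stable_def)
  \<comment> \<open>Fine enough for \<open>\<gamma>\<close>-partitions and for an imbalance of order \<open>1 / \<tau>\<close>.\<close>
  define \<delta> where "\<delta> = min \<gamma> (1 / (2 * \<tau>))"
  have \<delta>: "0 < \<delta>" "\<delta> \<le> \<gamma>" "\<delta> \<le> 1 / (2 * \<tau>)"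
    using gamma \<tau> by (auto simp: \<delta>_def)
  obtain r :: nat where r: "4 / \<delta> \<le> real r"
    using real_arch_simple by blast
  define C where "C = 2 * (real r + 1)"
  obtain t :: nat where t: "\<gamma>\<^sup>2 / \<delta>\<^sup>2 \<le> real t"
    using real_arch_simple by blast
  \<comment> \<open>At least two slices: a single one would end at the largest observation.\<close>
  define H\<^sub>0 where "H\<^sub>0 = max (max K 1) t"
  have H\<^sub>0: "H \<ge> K" "H \<ge> 2" "\<gamma>\<^sup>2 / \<delta>\<^sup>2 \<le> real H" if "H > H\<^sub>0" for H
  proof -
    show "H \<ge> K" "H \<ge> 2" using that by (auto simp: H\<^sub>0_def)
    have "real t \<le> real H" using that by (simp add: H\<^sub>0_def)
    with t show "\<gamma>\<^sup>2 / \<delta>\<^sup>2 \<le> real H" by (rule order_trans)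
  qed
  have c_pos: "c > 0" if "real (H * c) > 1 + 4 * real H / \<gamma>" for H c :: nat
  proof (rule gr0I)
    assume "c = 0"
    moreover have "0 \<le> 4 * real H / \<gamma>" using gamma by simp
    ultimately show False using that by simp
  qed
  have part1: "measure M {\<omega>\<in>space M. \<forall>u. norm u = 1 \<longrightarrow>
      \<bar>inner (\<Gamma>tilde H c \<omega> u - \<Gamma>\<^sub>e u) u\<bar> \<le> 3 / \<tau> * inner (\<Gamma>\<^sub>e u) u}
      \<ge> 1 - C * real H ^ 2 * sqrt (real n + 1) * exp (- (\<gamma> ^ 2 * (real n + 1)) / (32 * real H ^ 2))"
    if H: "H > H\<^sub>0" and n: "n = H * c" "real n > 1 + 4 * real H / \<gamma>" for H n c
  proof -
    have c: "c > 0" using c_pos[of H c] n by simp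
    have "2 * (real (H * r) + 1) * exp (- (real c * \<delta>\<^sup>2 / 16))
        \<le> C * real H ^ 2 * sqrt (real n + 1) * exp (- (\<gamma> ^ 2 * (real n + 1)) / (32 * real H ^ 2))"
      unfolding C_def n(1) using H\<^sub>0[OF H] c \<delta> by (intro grid_bound_le) auto
    then show ?thesis
      using prob_Gamma_tilde_near_cov_m[OF WSSC \<delta>(1,2) gamma(2) \<delta>(3) r H\<^sub>0(1,2)[OF H] c]
      unfolding \<Gamma>tilde_def \<Gamma>\<^sub>e_def by linarith
  qed
  have part2: "let I = {c. H * c \<ge> 0 \<and> real (H * c) > 1 + 4 * real H / \<gamma>} in
      bigO_prob M I (\<lambda>c \<omega>. onorm (\<lambda>u. \<Gamma>hat H c \<omega> u - \<Gamma>\<^sub>e u)) (\<lambda>c. 1 / \<tau> + sqrt (1 / real (H * c))) \<and>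
      bigO_prob M I (\<lambda>c \<omega>. onorm (\<lambda>u. \<Gamma>hat H c \<omega> u - \<Gamma>tilde H c \<omega> u)) (\<lambda>c. sqrt (1 / real (H * c)))"
    if H: "H > H\<^sub>0" for H
    unfolding Let_def \<Gamma>hat_def \<Gamma>\<^sub>e_def \<Gamma>tilde_def
  proof (intro conjI)
    show "bigO_prob M {c. H * c \<ge> 0 \<and> real (H * c) > 1 + 4 * real H / \<gamma>}
        (\<lambda>c \<omega>. onorm (\<lambda>u. Gamma_hat (\<lambda>i. Xs i \<omega>) (\<lambda>i. Ys i \<omega>) H c u - cov_operator M (\<lambda>\<omega>. m (Y \<omega>)) u))
        (\<lambda>c. 1 / \<tau> + sqrt (1 / real (H * c)))"
      using H\<^sub>0[OF H] \<tau> c_pos[of H] by (intro bigO_Gamma_hat_cov_m) auto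
    show "bigO_prob M {c. H * c \<ge> 0 \<and> real (H * c) > 1 + 4 * real H / \<gamma>}
        (\<lambda>c \<omega>. onorm (\<lambda>u. Gamma_hat (\<lambda>i. Xs i \<omega>) (\<lambda>i. Ys i \<omega>) H c u - Gamma_tilde M X Y (\<lambda>i. Ys i \<omega>) H c u))
        (\<lambda>c. sqrt (1 / real (H * c)))"
      using H\<^sub>0[OF H] c_pos[of H] by (intro bigO_Gamma_hat_Gamma_tilde) auto
  qed
  show ?thesis
  proof (rule exI[of _ C], rule conjI, goal_cases)
    case 1
    show ?case by (simp add: C_def)
  next
    case 2
    have "H\<^sub>0 \<ge> K" by (simp add: H\<^sub>0_def)
    moreover have "\<exists>N. \<forall>H>H\<^sub>0. CARD('d) \<le> H \<longrightarrow>
        (\<forall>n c. n = H * c \<and> n \<ge> N \<and> real n > 1 + 4 * real H / \<gamma> \<longrightarrow>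
           measure M {\<omega>\<in>space M. \<forall>u. norm u = 1 \<longrightarrow>
                        \<bar>inner (\<Gamma>tilde H c \<omega> u - \<Gamma>\<^sub>e u) u\<bar> \<le> 3 / \<tau> * inner (\<Gamma>\<^sub>e u) u}
           \<ge> 1 - C * real H ^ 2 * sqrt (real n + 1) * exp (- (\<gamma> ^ 2 * (real n + 1)) / (32 * real H ^ 2)))"
      using part1 by blast
    moreover have "\<forall>H>H\<^sub>0. CARD('d) \<le> H \<longrightarrow>
        (\<exists>N. let I = {c. H * c \<ge> N \<and> real (H * c) > 1 + 4 * real H / \<gamma>} in
           bigO_prob M I (\<lambda>c \<omega>. onorm (\<lambda>u. \<Gamma>hat H c \<omega> u - \<Gamma>\<^sub>e u))
                         (\<lambda>c. 1 / \<tau> + sqrt (1 / real (H * c))) \<and>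
           bigO_prob M I (\<lambda>c \<omega>. onorm (\<lambda>u. \<Gamma>hat H c \<omega> u - \<Gamma>tilde H c \<omega> u))
                         (\<lambda>c. sqrt (1 / real (H * c))))"
      using part2 by blast
    ultimately show ?case by blast
  qed
qed

end
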